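(* Let $d\ge 1$ and $\omega>0$. Let $\Gamma\subset S^{d-1}\times\mathbb{R}$ be such that the map $(u,m)\mapsto mu$ is a bijection from $\Gamma$ onto $\mathbb{Z}^d$, and let $\Lambda_\omega=\{(m,n,u) : (u,m)\in\Gamma,\ n\in\omega\mathbb{Z}\}$. Let $g\in L^2(\mathbb{R})$ be such that $\hat g$ is compactly supported and such that for every $k\in \frac{1}{\omega}\mathbb{Z}\setminus\{0\}$, $\hat g(\gamma)\hat g(\gamma+k)=0$ for almost every $\gamma\in\mathbb{R}$. Suppose furthermore that it is not the case that $\hat g$ is zero almost everywhere on the interval $[-1/4,1/4]$. Then $\{g_{m,n,u}\}_{(m,n,u)\in\Lambda_\omega}$ is a discrete frame for the subspace of functions in $L^2(\mathbb{R}^d)$ with support contained in $[-1/2,1/2]^d$; that is, there exist constants $0<A\le B<\infty$ such that $$A\|f\|_2^2\le\sum_{(m,n,u)\in\Lambda_\omega}|\langle f,g_{m,n,u}\rangle|^2\le B\|f\|_2^2$$ for all $f\in L^2(\mathbb{R}^d)$ with support contained in $[-1/2,1/2]^d$.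
   Context: $S^{d-1}$ is the unit sphere in $\mathbb{R}^d$. The Fourier transform is $\hat g(\gamma)=\int_{\mathbb{R}} g(x)e^{-2\pi i\gamma x}\,dx$, extended unitarily to $L^2(\mathbb{R})$. For $g:\mathbb{R}\to\mathbb{C}$, $m,t\in\mathbb{R}$ and $u\in S^{d-1}$, let $g^{m,t}(s)=e^{2\pi i ms}g(s-t)$ for $s\in\mathbb{R}$, and $g_{m,t,u}(x)=g^{m,t}(u\cdot x)$ for $x\in\mathbb{R}^d$. The functions $g_{m,t,u}$ are in general not in $L^2(\mathbb{R}^d)$; the pairing is $\langle f,g_{m,t,u}\rangle=\int_{\mathbb{R}^d}f(x)\overline{g_{m,t,u}(x)}\,dx$. *)

theory Defs
  imports "HOL-Analysis.Analysis"
begin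

definition square_integrable :: "('a::euclidean_space \<Rightarrow> complex) \<Rightarrow> bool" where
  "square_integrable f \<longleftrightarrow>
     f \<in> borel_measurable lebesgue \<and> integrable lebesgue (\<lambda>x. (norm (f x))\<^sup>2)"

definition l2norm :: "('a::euclidean_space \<Rightarrow> complex) \<Rightarrow> real" where
  "l2norm f = sqrt (LINT x|lebesgue. (norm (f x))\<^sup>2)"

definition pairing :: "('a::euclidean_space \<Rightarrow> complex) \<Rightarrow> ('a \<Rightarrow> complex) \<Rightarrow> complex" where
  "pairing f h = (LINT x|lebesgue. f x * cnj (h x))"

definition fourier :: "(real \<Rightarrow> complex) \<Rightarrow> real \<Rightarrow> complex" where
  "fourier g \<gamma> = (LINT x|lebesgue. g x * cis (- 2 * pi * \<gamma> * x))"

text \<open>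
  The Fourier transform on \<open>L\<^sup>2(\<real>)\<close> is the closure of the integral transform on
  \<open>L\<^sup>1 \<inter> L\<^sup>2\<close>. It is determined only up to null sets, so it is given as a relation:
  \<open>G\<close> is a representative of the transform of \<open>g\<close>. By Plancherel's theorem every
  square integrable \<open>g\<close> has such a \<open>G\<close>, unique almost everywhere, and the requirement that
  \<open>fourier (h n)\<close> be square integrable always holds; it is listed because
  \<open>l2norm\<close> is \<open>0\<close> on functions that are not square integrable.
\<close>
definition is_fourier_L2 :: "(real \<Rightarrow> complex) \<Rightarrow> (real \<Rightarrow> complex) \<Rightarrow> bool" where
  "is_fourier_L2 g G \<longleftrightarrow> square_integrable g \<and> square_integrable G \<and>
     (\<exists>h :: nat \<Rightarrow> real \<Rightarrow> complex.
        (\<forall>n. integrable lebesgue (h n) \<and> square_integrable (h n) \<and>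
             square_integrable (fourier (h n))) \<and>
        (\<lambda>n. l2norm (\<lambda>x. h n x - g x)) \<longlonglongrightarrow> 0 \<and>
        (\<lambda>n. l2norm (\<lambda>\<gamma>. fourier (h n) \<gamma> - G \<gamma>)) \<longlonglongrightarrow> 0)"

definition essentially_supported_in ::
    "('a::euclidean_space \<Rightarrow> complex) \<Rightarrow> 'a set \<Rightarrow> bool" where
  "essentially_supported_in f K \<longleftrightarrow> (AE x in lebesgue. x \<notin> K \<longrightarrow> f x = 0)"

definition L2_supported_in :: "'a::euclidean_space set \<Rightarrow> ('a \<Rightarrow> complex) set" where
  "L2_supported_in K = {f. square_integrable f \<and> essentially_supported_in f K}"

definition gabor :: "(real \<Rightarrow> complex) \<Rightarrow> real \<Rightarrow> real \<Rightarrow> real \<Rightarrow> complex" where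
  "gabor g m t s = cis (2 * pi * m * s) * g (s - t)"

definition gabor_ridge ::
    "(real \<Rightarrow> complex) \<Rightarrow> real \<times> real \<times> (real ^ 'd) \<Rightarrow> real ^ 'd \<Rightarrow> complex" where
  "gabor_ridge g = (\<lambda>(m, t, u) x. gabor g m t (u \<bullet> x))"

definition integer_lattice :: "(real ^ 'd) set" where
  "integer_lattice = {k. \<forall>i. k $ i \<in> \<int>}"

definition ridge_index ::
    "((real ^ 'd) \<times> real) set \<Rightarrow> real \<Rightarrow> (real \<times> real \<times> (real ^ 'd)) set" where
  "ridge_index \<Gamma> \<omega> = {(m, n, u). (u, m) \<in> \<Gamma> \<and> (\<exists>j::int. n = \<omega> * of_int j)}"

text \<open>
  The frame elements need not be square integrable. Summability is stated explicitly because
  \<open>infsum\<close> is \<open>0\<close> on families that are not summable.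
\<close>
definition discrete_frame_for ::
    "'i set \<Rightarrow> ('i \<Rightarrow> 'a::euclidean_space \<Rightarrow> complex) \<Rightarrow> ('a \<Rightarrow> complex) set \<Rightarrow> bool" where
  "discrete_frame_for I \<phi> V \<longleftrightarrow>
     (\<exists>A B :: real. 0 < A \<and> A \<le> B \<and>
        (\<forall>f\<in>V.
           (\<lambda>i. (norm (pairing f (\<phi> i)))\<^sup>2) summable_on I \<and>
           A * (l2norm f)\<^sup>2 \<le> (\<Sum>\<^sub>\<infinity>i\<in>I. (norm (pairing f (\<phi> i)))\<^sup>2) \<and>
           (\<Sum>\<^sub>\<infinity>i\<in>I. (norm (pairing f (\<phi> i)))\<^sup>2) \<le> B * (l2norm f)\<^sup>2))"

end

theory Submission
  imports Defs "HOL-Probability.Probability" "HOL-Complex_Analysis.Complex_Analysis"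
begin

text \<open>
  Write \<open>F(\<xi>)\<close> for the Fourier transform of a function \<open>f\<close> carried by the unit cube, and \<open>w = |ghat|\<^sup>2\<close>.

  Since \<open>ghat\<close> is integrable, \<open>g\<close> agrees almost everywhere with its inverse transform
  (\<open>fourier_L2_inversion\<close>), and Fubini turns the coefficient of \<open>f\<close> against the ridge \<open>(m, n, u)\<close> into
  \<open>\<integral> H(\<gamma>) e\<^sup>2\<^sup>\<pi>\<^sup>i\<^sup>\<gamma>\<^sup>n d\<gamma>\<close> with \<open>H(\<gamma>) = cnj (ghat \<gamma>) F((m + \<gamma>) u)\<close> (\<open>pairing_ridge\<close>). For
  \<open>n \<in> \<omega>\<int>\<close> these numbers are the Fourier coefficients of the \<open>1/\<omega>\<close>-periodization of \<open>H\<close>. The translates that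
  are added up there have essentially disjoint supports, so Parseval's identity gives the sum over \<open>n\<close>
  as \<open>(1/\<omega>) \<integral> |H|\<^sup>2\<close> (\<open>parseval_periodization\<close>). Writing \<open>k = m u\<close> and \<open>u = u\<^sub>k\<close>, the whole frame sum is
  \<open>(1/\<omega>) \<integral> w(\<gamma>) (\<Sum>k. |F(k + \<gamma> u\<^sub>k)|\<^sup>2) d\<gamma>\<close>, the sum running over the integer lattice.

  At \<open>\<gamma> = 0\<close> the inner sum is \<open>||f||\<^sup>2\<close>, by Parseval's identity for the cube. For other \<open>\<gamma>\<close> expand
  \<open>F(k + \<gamma> u\<^sub>k)\<close> in powers of \<open>\<gamma>\<close>. The coefficients are moments of \<open>f\<close>, and their \<open>l\<^sup>2\<close> norm over \<open>k\<close> is at most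
  \<open>c\<^sup>n ||f|| / n!\<close> with \<open>c\<close> depending on the dimension only (\<open>moment_bound\<close>). This yields the upper frame bound,
  \<open>ghat\<close> having bounded support.

  For the lower bound take a finite set \<open>S\<close> of lattice points that carries half of the energy of \<open>f\<close> at \<open>\<gamma> = 0\<close>.
  Then \<open>h(\<gamma>) = (\<Sum>k\<in>S. F(k + \<gamma> u\<^sub>k) cnj (F k)) / ||f||\<^sup>2\<close> is an entire function of \<open>\<gamma>\<close> with \<open>h(0) \<ge> 1/2\<close>, whose
  Taylor coefficients satisfy a bound independent of \<open>f\<close> and \<open>S\<close>. All such functions form a compact family,
  and no member vanishes on a set of positive measure; hence \<open>\<integral> w |h|\<^sup>2\<close> has a positive lower bound on
  the family (\<open>entire_family_lower_bound\<close>). By the Cauchy-Schwarz inequality \<open>||f||\<^sup>2 |h(\<gamma>)|\<^sup>2\<close> is at most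
  \<open>\<Sum>k\<in>S. |F(k + \<gamma> u\<^sub>k)|\<^sup>2\<close>, and the lower frame bound follows (\<open>averaged_sampling_frame\<close>). The compactness
  argument gives no explicit constant.
\<close>

section \<open>Square integrable functions and orthonormal systems\<close>

definition sq_int :: "'a measure \<Rightarrow> ('a \<Rightarrow> complex) \<Rightarrow> bool" where
  "sq_int M f \<longleftrightarrow> f \<in> borel_measurable M \<and> integrable M (\<lambda>x. (norm (f x))\<^sup>2)"

lemma sq_int_integrable: "sq_int M f \<Longrightarrow> integrable M (\<lambda>x. (norm (f x))\<^sup>2)"
  by (auto simp: sq_int_def)

lemma norm_add_sq_le: "(norm (a + b))\<^sup>2 \<le> 2 * (norm a)\<^sup>2 + 2 * (norm b)\<^sup>2"
  for a b :: "'a::real_normed_vector"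
proof -
  have "(norm (a + b))\<^sup>2 \<le> (norm a + norm b)\<^sup>2"
    by (intro power_mono norm_triangle_ineq) auto
  also have "\<dots> \<le> 2 * (norm a)\<^sup>2 + 2 * (norm b)\<^sup>2"
    using zero_le_power2[of "norm a - norm b"] by (simp add: power2_eq_square algebra_simps)
  finally show ?thesis .
qed

lemma sq_int_bound:
  assumes "sq_int M f" "g \<in> borel_measurable M" "AE x in M. norm (g x) \<le> C * norm (f x)"
  shows "sq_int M g"
proof -
  have "integrable M (\<lambda>x. (norm (g x))\<^sup>2)"
  proof (rule Bochner_Integration.integrable_bound)
    show "integrable M (\<lambda>x. C\<^sup>2 * (norm (f x))\<^sup>2)"
      using assms(1) by (auto simp: sq_int_def)
    show "AE x in M. norm ((norm (g x))\<^sup>2) \<le> norm (C\<^sup>2 * (norm (f x))\<^sup>2)"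
      using assms(3) by eventually_elim (auto simp flip: power_mult_distrib intro!: power_mono)
  qed (use assms in measurable)
  then show ?thesis using assms by (auto simp: sq_int_def)
qed

lemma sq_int_add: assumes "sq_int M f" "sq_int M g" shows "sq_int M (\<lambda>x. f x + g x)"
proof -
  have [measurable]: "f \<in> borel_measurable M" "g \<in> borel_measurable M"
    using assms by (auto simp: sq_int_def)
  have "integrable M (\<lambda>x. (norm (f x + g x))\<^sup>2)"
  proof (rule Bochner_Integration.integrable_bound)
    show "integrable M (\<lambda>x. 2 * (norm (f x))\<^sup>2 + 2 * (norm (g x))\<^sup>2)"
      using assms by (auto simp: sq_int_def)
    show "AE x in M. norm ((norm (f x + g x))\<^sup>2) \<le> norm (2 * (norm (f x))\<^sup>2 + 2 * (norm (g x))\<^sup>2)"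
      by (intro AE_I2) (use norm_add_sq_le in auto)
  qed measurable
  then show ?thesis by (auto simp: sq_int_def)
qed

lemma sq_int_cmult: assumes "sq_int M f" shows "sq_int M (\<lambda>x. c * f x)"
  by (rule sq_int_bound[OF assms, of _ "norm c"]) (use assms in \<open>auto simp: norm_mult sq_int_def\<close>)

lemma sq_int_diff: assumes "sq_int M f" "sq_int M g" shows "sq_int M (\<lambda>x. f x - g x)"
  using sq_int_add[OF assms(1) sq_int_cmult[OF assms(2), of "-1"]] by simp

lemma sq_int_sum: assumes "\<And>i. i \<in> I \<Longrightarrow> sq_int M (f i)" shows "sq_int M (\<lambda>x. \<Sum>i\<in>I. f i x)"
  using assms by (induction I rule: infinite_finite_induct) (auto simp: sq_int_add, auto simp: sq_int_def)

lemma sq_int_cnj: "sq_int M f \<Longrightarrow> sq_int M (\<lambda>x. cnj (f x))"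
  using borel_measurable_continuous_on[OF continuous_on_cnj[OF continuous_on_id]]
  by (auto simp: sq_int_def)

lemma integrable_mult_sq_int:
  assumes "sq_int M f" "sq_int M g" shows "integrable M (\<lambda>x. f x * g x)"
proof (rule Bochner_Integration.integrable_bound)
  show "integrable M (\<lambda>x. (norm (f x))\<^sup>2 + (norm (g x))\<^sup>2)"
    using assms by (auto simp: sq_int_def)
  have "a * b \<le> a\<^sup>2 + b\<^sup>2" if "a \<ge> 0" "b \<ge> 0" for a b :: real
    using that sum_squares_bound[of a b] mult_nonneg_nonneg[OF that] by linarith
  then show "AE x in M. norm (f x * g x) \<le> norm ((norm (f x))\<^sup>2 + (norm (g x))\<^sup>2)"
    by (intro AE_I2) (simp add: norm_mult)
qed (use assms in \<open>auto simp: sq_int_def\<close>)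

lemma (in finite_measure) integrable_sq_int:
  assumes "sq_int M f" shows "integrable M f"
proof -
  have "sq_int M (\<lambda>_. 1)" by (auto simp: sq_int_def)
  from integrable_mult_sq_int[OF assms this] show ?thesis by simp
qed

lemma (in finite_measure) sq_int_bounded:
  assumes "f \<in> borel_measurable M" "AE x in M. norm (f x) \<le> B"
  shows "sq_int M f"
proof (rule sq_int_bound[OF _ assms(1), where C = B])
  show "sq_int M (\<lambda>_. 1)" by (auto simp: sq_int_def)
qed (use assms in auto)

definition orthonormal_on :: "'a measure \<Rightarrow> ('i \<Rightarrow> 'a \<Rightarrow> complex) \<Rightarrow> 'i set \<Rightarrow> bool" where
  "orthonormal_on M e I \<longleftrightarrow> (\<forall>k\<in>I. sq_int M (e k)) \<and>
     (\<forall>j\<in>I. \<forall>k\<in>I. (LINT x|M. e j x * cnj (e k x)) = (if j = k then 1 else 0))"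

text \<open>
  Completing the square: the Fourier coefficients of \<open>f\<close> are the best choice of \<open>c\<close>. Bessel's inequality is the
  case \<open>c = F\<close>, and Parseval's identity follows as soon as some \<open>c\<close> makes the left side small.
\<close>

lemma orthonormal_distance:
  assumes on: "orthonormal_on M e I" and S: "finite S" "S \<subseteq> I" and f: "sq_int M f"
  defines "F \<equiv> \<lambda>k. LINT x|M. f x * cnj (e k x)"
  shows "(LINT x|M. (norm (f x - (\<Sum>k\<in>S. c k * e k x)))\<^sup>2) =
         (LINT x|M. (norm (f x))\<^sup>2) - (\<Sum>k\<in>S. (norm (F k))\<^sup>2) + (\<Sum>k\<in>S. (norm (F k - c k))\<^sup>2)"
proof -
  have e: "sq_int M (e k)" if "k \<in> S" for k using on S that by (auto simp: orthonormal_on_def)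
  have o: "(LINT x|M. e j x * cnj (e k x)) = (if j = k then 1 else 0)" if "j \<in> S" "k \<in> S" for j k
    using on subsetD[OF S(2) that(1)] subsetD[OF S(2) that(2)] unfolding orthonormal_on_def by simp
  note i = integrable_mult_sq_int sq_int_cnj f e
  have i1[simp]: "integrable M (\<lambda>x. f x * cnj (f x))" by (intro i)
  have i2: "integrable M (\<lambda>x. cnj (c k) * (f x * cnj (e k x)))" if "k \<in> S" for k
    by (intro integrable_mult_right i that)
  have i3: "integrable M (\<lambda>x. c k * (cnj (f x) * e k x))" if "k \<in> S" for k
    by (intro integrable_mult_right i that)
  have i4: "integrable M (\<lambda>x. c j * cnj (c k) * (e j x * cnj (e k x)))" if "j \<in> S" "k \<in> S" for j k
    by (intro integrable_mult_right i that)
  have F': "(LINT x|M. cnj (f x) * e k x) = cnj (F k)" for k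
    unfolding F_def Bochner_Integration.integral_cnj[symmetric] by simp
  have ex: "complex_of_real ((norm (f x - (\<Sum>k\<in>S. c k * e k x)))\<^sup>2) =
      f x * cnj (f x) - (\<Sum>k\<in>S. cnj (c k) * (f x * cnj (e k x)))
       - (\<Sum>k\<in>S. c k * (cnj (f x) * e k x)) + (\<Sum>k\<in>S. \<Sum>j\<in>S. c j * cnj (c k) * (e j x * cnj (e k x)))" for x
    unfolding complex_norm_square
    by (simp add: algebra_simps sum_distrib_left sum_distrib_right sum_product)
  have "complex_of_real (LINT x|M. (norm (f x - (\<Sum>k\<in>S. c k * e k x)))\<^sup>2) =
      (LINT x|M. f x * cnj (f x)) - (\<Sum>k\<in>S. cnj (c k) * F k)
       - (\<Sum>k\<in>S. c k * cnj (F k)) + (\<Sum>k\<in>S. \<Sum>j\<in>S. c j * cnj (c k) * (if j = k then 1 else 0))"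
    unfolding integral_complex_of_real[symmetric] ex
    by (simp add: i1 i2 i3 i4 Bochner_Integration.integrable_sum Bochner_Integration.integrable_diff
        Bochner_Integration.integrable_add Bochner_Integration.integral_sum F' o F_def
        del: integral_complex_of_real of_real_power)
  also have "(LINT x|M. f x * cnj (f x)) = complex_of_real (LINT x|M. (norm (f x))\<^sup>2)"
    unfolding integral_complex_of_real[symmetric] complex_norm_square ..
  also have "(\<Sum>k\<in>S. \<Sum>j\<in>S. c j * cnj (c k) * (if j = k then 1 else 0)) = (\<Sum>j\<in>S. c j * cnj (c j))"
    by (intro sum.cong refl) (simp add: if_distrib S cong: if_cong)
  finally have "complex_of_real (LINT x|M. (norm (f x - (\<Sum>k\<in>S. c k * e k x)))\<^sup>2) =
     complex_of_real (LINT x|M. (norm (f x))\<^sup>2) - (\<Sum>k\<in>S. cnj (c k) * F k)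
       - (\<Sum>k\<in>S. c k * cnj (F k)) + (\<Sum>j\<in>S. c j * cnj (c j))" .
  also have "\<dots> = complex_of_real (LINT x|M. (norm (f x))\<^sup>2) - (\<Sum>k\<in>S. F k * cnj (F k)) +
       (\<Sum>k\<in>S. (F k - c k) * cnj (F k - c k))"
    by (simp add: algebra_simps sum.distrib sum_subtractf)
  also have "\<dots> = complex_of_real ((LINT x|M. (norm (f x))\<^sup>2) - (\<Sum>k\<in>S. (norm (F k))\<^sup>2)
       + (\<Sum>k\<in>S. (norm (F k - c k))\<^sup>2))"
    by (simp only: complex_norm_square of_real_add of_real_diff of_real_sum)
  finally show ?thesis unfolding of_real_eq_iff .
qed

lemma bessel_inequality:
  assumes "orthonormal_on M e I" "finite S" "S \<subseteq> I" "sq_int M f"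
  shows "(\<Sum>k\<in>S. (norm (LINT x|M. f x * cnj (e k x)))\<^sup>2) \<le> (LINT x|M. (norm (f x))\<^sup>2)"
proof -
  have "0 \<le> (LINT x|M. (norm (f x - (\<Sum>k\<in>S. (LINT x|M. f x * cnj (e k x)) * e k x)))\<^sup>2)"
    by (intro integral_nonneg_AE) auto
  then show ?thesis by (subst (asm) orthonormal_distance[OF assms]) simp
qed

lemma parseval:
  assumes on: "orthonormal_on M e I" and f: "sq_int M f"
    and dense: "\<And>\<epsilon>. \<epsilon> > 0 \<Longrightarrow> \<exists>S c. finite S \<and> S \<subseteq> I \<and>
                  (LINT x|M. (norm (f x - (\<Sum>k\<in>S. c k * e k x)))\<^sup>2) < \<epsilon>"
  shows "((\<lambda>k. (norm (LINT x|M. f x * cnj (e k x)))\<^sup>2) has_sum (LINT x|M. (norm (f x))\<^sup>2)) I"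
proof -
  let ?F = "\<lambda>k. (norm (LINT x|M. f x * cnj (e k x)))\<^sup>2"
  have ub: "sum ?F S \<le> (LINT x|M. (norm (f x))\<^sup>2)" if "finite S" "S \<subseteq> I" for S
    using bessel_inequality[OF on that f] .
  have bdd: "bdd_above (sum ?F ` {F. F \<subseteq> I \<and> finite F})"
    using ub by (intro bdd_aboveI2) auto
  have hs: "(?F has_sum (SUP F\<in>{F. finite F \<and> F \<subseteq> I}. sum ?F F)) I"
    by (rule nonneg_bdd_above_has_sum[OF _ bdd]) auto
  have "(SUP F\<in>{F. finite F \<and> F \<subseteq> I}. sum ?F F) = (LINT x|M. (norm (f x))\<^sup>2)"
  proof (rule antisym)
    show "(SUP F\<in>{F. finite F \<and> F \<subseteq> I}. sum ?F F) \<le> (LINT x|M. (norm (f x))\<^sup>2)"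
      using ub by (intro cSUP_least) auto
    show "(LINT x|M. (norm (f x))\<^sup>2) \<le> (SUP F\<in>{F. finite F \<and> F \<subseteq> I}. sum ?F F)"
    proof (rule field_le_epsilon)
      fix \<epsilon> :: real assume "\<epsilon> > 0"
      from dense[OF this] obtain S c where S: "finite S" "S \<subseteq> I"
        and l: "(LINT x|M. (norm (f x - (\<Sum>k\<in>S. c k * e k x)))\<^sup>2) < \<epsilon>" by blast
      have "0 \<le> (\<Sum>k\<in>S. (norm ((LINT x|M. f x * cnj (e k x)) - c k))\<^sup>2)" by (intro sum_nonneg) auto
      then have "(LINT x|M. (norm (f x))\<^sup>2) \<le> sum ?F S + \<epsilon>"
        using l unfolding orthonormal_distance[OF on S f] by linarith
      also have "sum ?F S \<le> (SUP F\<in>{F. finite F \<and> F \<subseteq> I}. sum ?F F)"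
        using bdd S by (intro cSUP_upper) (auto simp: conj_commute)
      finally show "(LINT x|M. (norm (f x))\<^sup>2) \<le> (SUP F\<in>{F. finite F \<and> F \<subseteq> I}. sum ?F F) + \<epsilon>" by simp
    qed
  qed
  with hs show ?thesis by simp
qed

section \<open>The characters of the unit cube\<close>

definition cube :: "'a::euclidean_space set" where
  "cube = {x. \<forall>b\<in>Basis. \<bar>x \<bullet> b\<bar> \<le> 1/2}"

text \<open>
  The cube as a measure on the whole space instead of a restricted one, so that measurability is plain
  Borel measurability and values off the cube are irrelevant.
\<close>

definition cube_measure :: "'a::euclidean_space measure" where
  "cube_measure = density lborel (\<lambda>x. ennreal (indicator cube x))"

definition lattice :: "'a::euclidean_space set" where
  "lattice = {k. \<forall>b\<in>Basis. k \<bullet> b \<in> \<int>}"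

definition harmonic :: "'a::euclidean_space \<Rightarrow> 'a \<Rightarrow> complex" where
  "harmonic k x = cis (2 * pi * (k \<bullet> x))"

lemma cube_eq_cbox: "cube = cbox (- (\<Sum>b\<in>Basis. (1/2) *\<^sub>R b)) (\<Sum>b\<in>Basis. (1/2) *\<^sub>R b)"
  unfolding cube_def cbox_def by (intro Collect_cong ball_cong refl) (auto simp: abs_le_iff)

lemma compact_cube: "compact cube" unfolding cube_eq_cbox by (rule compact_cbox)

lemma cube_borel [measurable]: "cube \<in> sets borel"
  unfolding cube_eq_cbox by simp

lemma sets_cube_measure [simp, measurable_cong]: "sets cube_measure = sets borel"
  by (simp add: cube_measure_def)

lemma space_cube_measure [simp]: "space cube_measure = UNIV"
  by (simp add: cube_measure_def)

lemma borel_measurable_cube_measure [simp]: "measurable cube_measure N = measurable borel N"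
  by (rule measurable_cong_sets) auto

lemma integral_cube_measure:
  fixes f :: "_ \<Rightarrow> 'b::{banach, second_countable_topology}"
  assumes [measurable]: "f \<in> borel_measurable borel"
  shows "(LINT x|cube_measure. f x) = (LINT x|lborel. indicator cube x *\<^sub>R f x)"
  unfolding cube_measure_def by (rule integral_density) auto

lemma integrable_cube_measure:
  fixes f :: "_ \<Rightarrow> 'b::{banach, second_countable_topology}"
  assumes [measurable]: "f \<in> borel_measurable borel"
  shows "integrable cube_measure f \<longleftrightarrow> integrable lborel (\<lambda>x. indicator cube x *\<^sub>R f x)"
  unfolding cube_measure_def by (rule integrable_density) auto

lemma AE_cube_measure: "(AE x in cube_measure. P x) \<longleftrightarrow> (AE x in lborel. x \<in> cube \<longrightarrow> P x)"
  unfolding cube_measure_def by (subst AE_density) (auto simp: indicator_def)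

interpretation cube: finite_measure "cube_measure :: 'a::euclidean_space measure"
proof
  have "emeasure cube_measure (UNIV :: 'a set) = emeasure lborel (cube :: 'a set)"
    unfolding cube_measure_def by (subst emeasure_density) (auto simp: ennreal_indicator)
  also have "\<dots> < \<infinity>"
    using compact_imp_bounded[OF compact_cube] by (rule emeasure_bounded_finite)
  finally show "emeasure cube_measure (space cube_measure :: 'a set) \<noteq> \<infinity>" by simp
qed

text \<open>
  All integrals over the cube that are needed explicitly are integrals of products of functions of one
  coordinate each, and so reduce to integrals over an interval.
\<close>

lemma integral_lborel_prod:
  fixes \<phi> :: "'a::euclidean_space \<Rightarrow> real \<Rightarrow> complex"
  assumes \<phi>: "\<And>b. b \<in> Basis \<Longrightarrow> integrable lborel (\<phi> b)"
  shows "(LINT x|lborel. (\<Prod>b\<in>Basis. \<phi> b (x \<bullet> b))) = (\<Prod>b\<in>Basis. LINT t|lborel. \<phi> b t)"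
proof -
  interpret product_sigma_finite "\<lambda>_::'a. lborel :: real measure" ..
  have [measurable]: "\<phi> b \<in> borel_measurable borel" if "b \<in> Basis" for b
    using \<phi>[OF that] by auto
  have "(LINT x|lborel. (\<Prod>b\<in>Basis. \<phi> b (x \<bullet> b))) =
     (LINT f|(\<Pi>\<^sub>M b\<in>Basis. lborel). (\<Prod>b\<in>Basis. \<phi> b ((\<Sum>b\<in>Basis. f b *\<^sub>R b) \<bullet> b)))"
    by (subst lborel_eq, subst integral_distr) auto
  also have "\<dots> = (LINT f|(\<Pi>\<^sub>M b\<in>(Basis::'a set). lborel). (\<Prod>b\<in>Basis. \<phi> b (f b)))"
    by simp
  also have "\<dots> = (\<Prod>b\<in>Basis. LINT t|lborel. \<phi> b t)"
    by (rule product_integral_prod) (auto intro: \<phi>)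
  finally show ?thesis .
qed

lemma indicator_cube: "(indicator cube x :: 'b::real_field) = (\<Prod>b\<in>Basis. indicator {-1/2..1/2} (x \<bullet> b))"
  for x :: "'a::euclidean_space"
proof (cases "x \<in> cube")
  case True
  then have "x \<bullet> b \<in> {-1/2..1/2}" if "b \<in> Basis" for b
    using that by (force simp: cube_def abs_le_iff)
  with True show ?thesis by simp
next
  case False
  then obtain b where "b \<in> Basis" "\<bar>x \<bullet> b\<bar> > 1/2" by (force simp: cube_def)
  then have "\<exists>b\<in>Basis. indicator {-1/2..1/2} (x \<bullet> b) = (0::'b)"
    by (intro bexI[of _ b]) (auto simp: abs_le_iff indicator_def)
  then show ?thesis using False by (subst prod_zero) auto
qed

lemma integral_cube_prod:
  fixes \<phi> :: "'a::euclidean_space \<Rightarrow> real \<Rightarrow> complex"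
  assumes \<phi>: "\<And>b. b \<in> Basis \<Longrightarrow> continuous_on UNIV (\<phi> b)"
  shows "(LINT x|cube_measure. (\<Prod>b\<in>Basis. \<phi> b (x \<bullet> b))) =
         (\<Prod>b\<in>Basis. LINT t|lborel. indicator {-1/2..1/2} t *\<^sub>R \<phi> b t)"
proof -
  have [measurable]: "\<phi> b \<in> borel_measurable borel" if "b \<in> Basis" for b
    using borel_measurable_continuous_onI \<phi> that by blast
  have "(LINT x|cube_measure. (\<Prod>b\<in>Basis. \<phi> b (x \<bullet> b))) =
    (LINT x|lborel. (\<Prod>b\<in>Basis. (\<lambda>t. indicator {-1/2..1/2} t *\<^sub>R \<phi> b t) (x \<bullet> b)))"
    by (subst integral_cube_measure) (auto simp: indicator_cube prod.distrib scaleR_conv_of_real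
      simp flip: of_real_prod)
  also have "\<dots> = (\<Prod>b\<in>Basis. LINT t|lborel. indicator {-1/2..1/2} t *\<^sub>R \<phi> b t)"
    by (rule integral_lborel_prod, rule borel_integrable_compact) (auto intro: continuous_on_subset[OF \<phi>])
  finally show ?thesis .
qed

lemma integral_cube_coordinate:
  fixes \<phi> :: "real \<Rightarrow> complex" and b :: "'a::euclidean_space"
  assumes \<phi>: "continuous_on UNIV \<phi>" and b: "b \<in> Basis"
  shows "(LINT x|cube_measure. \<phi> (x \<bullet> b)) = (LINT t|lborel. indicator {-1/2..1/2} t *\<^sub>R \<phi> t)"
proof -
  have "(LINT x|cube_measure. \<phi> (x \<bullet> b)) =
        (LINT x|cube_measure. (\<Prod>b'\<in>Basis. (\<lambda>t. if b' = b then \<phi> t else 1) (x \<bullet> b')))"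
    using b by (intro Bochner_Integration.integral_cong refl) (simp add: prod.delta)
  also have "\<dots> = (\<Prod>b'\<in>Basis. LINT t|lborel. indicator {-1/2..1/2} t *\<^sub>R (if b' = b then \<phi> t else 1))"
  proof (rule integral_cube_prod)
    show "continuous_on UNIV (\<lambda>t. if b' = b then \<phi> t else 1)" for b'
      using \<phi> by (cases "b' = b") auto
  qed
  also have "\<dots> = (\<Prod>b'\<in>Basis. if b' = b then (LINT t|lborel. indicator {-1/2..1/2} t *\<^sub>R \<phi> t) else 1)"
    by (intro prod.cong refl) auto
  also have "\<dots> = (LINT t|lborel. indicator {-1/2..1/2} t *\<^sub>R \<phi> t)"
    using b by (simp add: prod.delta)
  finally show ?thesis .
qed

lemma cis_sum: "cis (\<Sum>i\<in>I. f i) = (\<Prod>i\<in>I. cis (f i))"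
  by (induction I rule: infinite_finite_induct) (auto simp: cis_mult[symmetric])

lemma cis_2pi_int: "s \<in> \<int> \<Longrightarrow> cis (2 * pi * s) = 1"
  by (simp add: cis_multiple_2pi)

lemma integral_cis_period:
  assumes "s \<in> \<int>"
  shows "(LINT t|lborel. indicator {-1/2..1/2} t *\<^sub>R cis (2 * pi * (s * t))) = (if s = 0 then 1 else 0)"
proof (cases "s = 0")
  case True then show ?thesis by simp
next
  case False
  define a where "a = 2 * pi * s * \<i>"
  have a: "a \<noteq> 0" using False by (simp add: a_def)
  have "exp a = 1" using cis_2pi_int[OF assms] by (simp add: a_def cis_conv_exp mult_ac)
  then have e: "exp (a / 2) = exp (- a / 2)"
    using exp_diff[of "a/2" a] by (simp add: field_simps)
  have "(LINT t|lborel. indicator {-1/2..1/2} t *\<^sub>R exp (a * of_real t)) =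
     exp (a * of_real (1/2)) / a - exp (a * of_real (-1/2)) / a"
  proof (rule integral_FTC_Icc)
    show "((\<lambda>t. exp (a * of_real t) / a) has_vector_derivative exp (a * of_real t)) (at t within {-1/2..1/2})" for t
      using a by (auto intro!: derivative_eq_intros has_vector_derivative_real_field)
  qed (auto intro!: continuous_intros)
  also have "\<dots> = 0" using e by (simp add: divide_simps)
  finally show ?thesis using False by (simp add: a_def cis_conv_exp mult_ac)
qed

text \<open>
  The Fourier coefficients of the sawtooth. Only their size is needed: together with the value of
  \<open>\<Sum>n. 1/n\<^sup>2\<close> it decides that the sawtooth satisfies Parseval's identity.
\<close>

lemma integral_id_cis_period:
  assumes "s \<in> \<int>" "s \<noteq> 0"
  shows "norm (LINT t|lborel. indicator {-1/2..1/2} t *\<^sub>R (of_real t * cis (2 * pi * (s * t)))) = 1 / (2 * pi * \<bar>s\<bar>)"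
proof -
  define a where "a = 2 * pi * s * \<i>"
  have a: "a \<noteq> 0" using assms by (simp add: a_def)
  have "exp a = 1" using cis_2pi_int[OF assms(1)] by (simp add: a_def cis_conv_exp mult_ac)
  then have e: "exp (- a / 2) = exp (a / 2)"
    using exp_diff[of "a/2" a] by (simp add: field_simps)
  have "(LINT t|lborel. indicator {-1/2..1/2} t *\<^sub>R (of_real t * exp (a * of_real t))) =
     exp (a * of_real (1/2)) * (of_real (1/2) / a - 1 / a^2) - exp (a * of_real (-1/2)) * (of_real (-1/2) / a - 1 / a^2)"
  proof (rule integral_FTC_Icc)
    \<comment> \<open>Integration by parts gives the antiderivative; its two end values have the same exponential factor.\<close>
    show "((\<lambda>t. exp (a * of_real t) * (of_real t / a - 1 / a^2)) has_vector_derivative of_real t * exp (a * of_real t))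
            (at t within {-1/2..1/2})" for t
      using a by (auto intro!: derivative_eq_intros has_vector_derivative_real_field simp: field_simps power2_eq_square)
  qed (auto intro!: continuous_intros)
  also have "\<dots> = exp (a / 2) / a" using e a by (simp add: field_simps)
  finally have "(LINT t|lborel. indicator {-1/2..1/2} t *\<^sub>R (of_real t * exp (a * of_real t))) = exp (a / 2) / a" .
  moreover have "norm (exp (a / 2)) = 1" by (simp add: a_def norm_exp_eq_Re)
  moreover have "norm a = 2 * pi * \<bar>s\<bar>" by (simp add: a_def norm_mult)
  ultimately show ?thesis by (simp add: a_def cis_conv_exp mult_ac norm_divide)
qed

lemma integral_square_period: "(LINT t|lborel. indicator {-1/2..1/2} t *\<^sub>R (of_real (t^2) :: complex)) = 1 / 12"
proof -
  have "(LINT t|lborel. indicator {-1/2..1/2} t *\<^sub>R (of_real (t^2) :: complex)) =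
     of_real ((1/2)^3/3) - of_real ((-1/2)^3/3)"
  proof (rule integral_FTC_Icc)
    show "((\<lambda>t. of_real (t^3/3) :: complex) has_vector_derivative of_real (t^2)) (at t within {-1/2..1/2})" for t
      unfolding has_vector_derivative_complex_iff 
      by (auto intro!: derivative_eq_intros simp flip: has_real_derivative_iff_has_vector_derivative)
  qed (auto intro!: continuous_intros)
  also have "\<dots> = 1/12" by (simp add: power3_eq_cube)
  finally show ?thesis .
qed

lemma continuous_harmonic [continuous_intros]: "continuous_on S (harmonic k)"
  unfolding harmonic_def by (intro continuous_intros)

lemma measurable_harmonic [measurable]: "harmonic k \<in> borel_measurable borel"
  by (intro borel_measurable_continuous_onI continuous_intros)

lemma norm_harmonic [simp]: "norm (harmonic k x) = 1"
  by (simp add: harmonic_def)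

lemma cnj_harmonic: "cnj (harmonic k x) = harmonic (- k) x"
  by (simp add: harmonic_def cis_cnj)

lemma harmonic_mult: "harmonic j x * harmonic k x = harmonic (j + k) x"
  by (simp add: harmonic_def cis_mult algebra_simps)

lemma orthonormal_harmonic:
  "orthonormal_on (cube_measure :: 'a::euclidean_space measure) harmonic lattice"
  unfolding orthonormal_on_def
proof (intro conjI ballI)
  show "sq_int cube_measure (harmonic k)" for k :: 'a
    by (rule cube.sq_int_bounded[where B = 1]) auto
  fix j k :: 'a assume jk: "j \<in> lattice" "k \<in> lattice"
  have "(LINT x|cube_measure. harmonic j x * cnj (harmonic k x)) =
        (LINT x|cube_measure. (\<Prod>b\<in>Basis. cis (2 * pi * (((j - k) \<bullet> b) * (x \<bullet> b)))))"
  proof (intro Bochner_Integration.integral_cong refl)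
    fix x :: 'a
    have "(j - k) \<bullet> x = (\<Sum>b\<in>Basis. ((j - k) \<bullet> b) * (x \<bullet> b))" by (rule euclidean_inner)
    then show "harmonic j x * cnj (harmonic k x) = (\<Prod>b\<in>Basis. cis (2 * pi * (((j - k) \<bullet> b) * (x \<bullet> b))))"
      unfolding cis_sum[symmetric] sum_distrib_left[symmetric]
      by (simp only: cnj_harmonic harmonic_mult) (simp add: harmonic_def)
  qed
  also have "\<dots> = (\<Prod>b\<in>Basis. LINT t|lborel. indicator {-1/2..1/2} t *\<^sub>R cis (2 * pi * (((j - k) \<bullet> b) * t)))"
    by (rule integral_cube_prod) (auto intro!: continuous_intros)
  also have "\<dots> = (\<Prod>b\<in>Basis. if (j - k) \<bullet> b = 0 then 1 else 0)"
    using jk by (intro prod.cong refl integral_cis_period) (auto simp: lattice_def inner_diff_left)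
  also have "\<dots> = (if j = k then 1 else 0)"
  proof (cases "j = k")
    case False
    then obtain b where "b \<in> Basis" "(j - k) \<bullet> b \<noteq> 0"
      by (metis euclidean_all_zero_iff right_minus_eq)
    then show ?thesis using False by (subst prod_zero) auto
  qed auto
  finally show "(LINT x|cube_measure. harmonic j x * cnj (harmonic k x)) = (if j = k then 1 else 0)" .
qed

section \<open>Completeness of the characters of the unit cube\<close>

inductive trig_poly :: "('a::euclidean_space \<Rightarrow> complex) \<Rightarrow> bool" where
  monomial: "k \<in> lattice \<Longrightarrow> trig_poly (\<lambda>x. c * harmonic k x)"
| add: "trig_poly p \<Longrightarrow> trig_poly q \<Longrightarrow> trig_poly (\<lambda>x. p x + q x)"

lemma trig_poly_continuous: "trig_poly p \<Longrightarrow> continuous_on S p"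
  by (induction rule: trig_poly.induct) (auto intro!: continuous_intros)

lemma trig_poly_measurable: "trig_poly p \<Longrightarrow> p \<in> borel_measurable borel"
  by (intro borel_measurable_continuous_onI trig_poly_continuous)

lemma trig_poly_bounded: "trig_poly p \<Longrightarrow> \<exists>B. \<forall>x. norm (p x) \<le> B"
proof (induction rule: trig_poly.induct)
  case (monomial k c)
  then show ?case by (intro exI[of _ "norm c"]) (auto simp: norm_mult)
next
  case (add p q)
  then obtain B C where "\<forall>x. norm (p x) \<le> B" "\<forall>x. norm (q x) \<le> C" by blast
  then show ?case by (intro exI[of _ "B + C"]) (auto intro: norm_triangle_le add_mono)
qed

lemma trig_poly_sq_int: assumes "trig_poly p" shows "sq_int cube_measure p"
proof -
  obtain B where "\<forall>x. norm (p x) \<le> B" using trig_poly_bounded[OF assms] by blast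
  then show ?thesis
    by (intro cube.sq_int_bounded[where B = B]) (auto simp: trig_poly_measurable[OF assms])
qed

lemma lattice_add: "j \<in> lattice \<Longrightarrow> k \<in> lattice \<Longrightarrow> j + k \<in> lattice"
  by (auto simp: lattice_def inner_add_left)

lemma trig_poly_mult:
  assumes "trig_poly p" "trig_poly q" shows "trig_poly (\<lambda>x. p x * q x)"
  using assms
proof (induction arbitrary: q rule: trig_poly.induct)
  case (monomial k c)
  from monomial(2) show ?case
  proof (induction rule: trig_poly.induct)
    case (monomial l d)
    have "(\<lambda>x. c * harmonic k x * (d * harmonic l x)) = (\<lambda>x. (c * d) * harmonic (k + l) x)"
      by (simp add: fun_eq_iff harmonic_mult[symmetric])
    then show ?case using trig_poly.monomial[OF lattice_add[OF \<open>k \<in> lattice\<close> monomial]] by metis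
  next
    case (add p q)
    then show ?case using trig_poly.add by (simp add: algebra_simps)
  qed
next
  case (add p p')
  show ?case using trig_poly.add[OF add.IH[OF add.prems]] by (simp add: algebra_simps)
qed

lemma trig_poly_const: "trig_poly (\<lambda>x. c)"
  using trig_poly.monomial[of 0 c] by (simp add: harmonic_def lattice_def)

lemma trig_poly_sum:
  assumes "finite S" "S \<subseteq> lattice" shows "trig_poly (\<lambda>x. \<Sum>k\<in>S. c k * harmonic k x)"
  using assms by (induction S rule: finite_induct) (auto intro: trig_poly_const trig_poly.intros)

lemma trig_poly_expansion:
  assumes "trig_poly p"
  obtains S c where "finite S" "S \<subseteq> lattice" "p = (\<lambda>x. \<Sum>k\<in>S. c k * harmonic k x)"
proof -
  have "\<exists>S c. finite S \<and> S \<subseteq> lattice \<and> p = (\<lambda>x. \<Sum>k\<in>S. c k * harmonic k x)"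
    using assms
  proof (induction rule: trig_poly.induct)
    case (monomial k c)
    then show ?case by (intro exI[of _ "{k}"] exI[of _ "\<lambda>_. c"]) auto
  next
    case (add p q)
    then obtain S c T d where S: "finite S" "S \<subseteq> lattice" "p = (\<lambda>x. \<Sum>k\<in>S. c k * harmonic k x)"
      and T: "finite T" "T \<subseteq> lattice" "q = (\<lambda>x. \<Sum>k\<in>T. d k * harmonic k x)" by blast
    let ?e = "\<lambda>k. (if k \<in> S then c k else 0) + (if k \<in> T then d k else 0)"
    have "(\<Sum>k\<in>S. c k * harmonic k x) = (\<Sum>k\<in>S\<union>T. (if k \<in> S then c k else 0) * harmonic k x)" for x
      using S(1) T(1) by (intro sum.mono_neutral_cong_left) auto
    moreover have "(\<Sum>k\<in>T. d k * harmonic k x) = (\<Sum>k\<in>S\<union>T. (if k \<in> T then d k else 0) * harmonic k x)" for x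
      using S(1) T(1) by (intro sum.mono_neutral_cong_left) auto
    ultimately have "(\<lambda>x. p x + q x) = (\<lambda>x. \<Sum>k\<in>S\<union>T. ?e k * harmonic k x)"
      unfolding S(3) T(3) by (simp add: distrib_right sum.distrib)
    then show ?case using S(1,2) T(1,2) by (intro exI[of _ "S \<union> T"] exI[of _ ?e]) auto
  qed
  then show ?thesis using that by blast
qed

lemma integral_sq_triangle:
  assumes "sq_int M f" "sq_int M g" "sq_int M h"
  shows "(LINT x|M. (norm (f x - h x))\<^sup>2) \<le> 2 * (LINT x|M. (norm (f x - g x))\<^sup>2) + 2 * (LINT x|M. (norm (g x - h x))\<^sup>2)"
proof -
  note i = sq_int_integrable[OF sq_int_diff]
  have "(LINT x|M. (norm (f x - h x))\<^sup>2) \<le> (LINT x|M. 2 * (norm (f x - g x))\<^sup>2 + 2 * (norm (g x - h x))\<^sup>2)"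
    using assms norm_add_sq_le[of "f x - g x" "g x - h x" for x]
    by (intro integral_mono i Bochner_Integration.integrable_add integrable_mult_right) auto
  also have "\<dots> = 2 * (LINT x|M. (norm (f x - g x))\<^sup>2) + 2 * (LINT x|M. (norm (g x - h x))\<^sup>2)"
    using i[OF assms(1,2)] i[OF assms(2,3)] by simp
  finally show ?thesis .
qed

lemma integral_sq_mult_le:
  assumes "sq_int M f" "g \<in> borel_measurable M" "AE x in M. norm (g x) \<le> C"
  shows "(LINT x|M. (norm (g x * f x))\<^sup>2) \<le> C\<^sup>2 * (LINT x|M. (norm (f x))\<^sup>2)"
proof -
  have "sq_int M (\<lambda>x. g x * f x)"
  proof (rule sq_int_bound[OF assms(1)])
    show "AE x in M. norm (g x * f x) \<le> C * norm (f x)"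
      using assms(3) by eventually_elim (auto simp: norm_mult intro: mult_right_mono)
  qed (use assms in \<open>auto simp: sq_int_def\<close>)
  then have "(LINT x|M. (norm (g x * f x))\<^sup>2) \<le> (LINT x|M. C\<^sup>2 * (norm (f x))\<^sup>2)"
    using assms
    by (intro integral_mono_AE sq_int_integrable integrable_mult_right)
       (auto simp: norm_mult power_mult_distrib intro!: mult_right_mono power_mono elim: eventually_mono)
  then show ?thesis by simp
qed

text \<open>
  Membership in the closed span of the characters. Three facts drive the proof that this is all of \<open>L\<^sup>2\<close>:
  bounded members form an algebra (\<open>trig_approximable_mult\<close>), the coordinates are members
  (\<open>trig_approximable_coordinate\<close>), and the closed span contains its dominated limits. The first two give all
  polynomials, the Stone-Weierstrass theorem gives all continuous functions, and limits give the rest.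
\<close>

definition trig_approximable :: "('a::euclidean_space \<Rightarrow> complex) \<Rightarrow> bool" where
  "trig_approximable f \<longleftrightarrow> sq_int cube_measure f \<and>
     (\<forall>\<epsilon>>0. \<exists>p. trig_poly p \<and> (LINT x|cube_measure. (norm (f x - p x))\<^sup>2) < \<epsilon>)"

lemma trig_approximableD: "trig_approximable f \<Longrightarrow> sq_int cube_measure f"
  by (simp add: trig_approximable_def)

lemma trig_approximableE:
  assumes "trig_approximable f" "\<epsilon> > 0"
  obtains p where "trig_poly p" "sq_int cube_measure p" "(LINT x|cube_measure. (norm (f x - p x))\<^sup>2) < \<epsilon>"
  using assms trig_poly_sq_int unfolding trig_approximable_def by blast

lemma trig_poly_approximable: "trig_poly p \<Longrightarrow> trig_approximable p"
  unfolding trig_approximable_def by (auto simp: trig_poly_sq_int intro!: exI[of _ p])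

lemma trig_approximable_closed:
  assumes f: "sq_int cube_measure f"
    and lim: "\<And>\<epsilon>. \<epsilon> > 0 \<Longrightarrow> \<exists>g. trig_approximable g \<and> (LINT x|cube_measure. (norm (f x - g x))\<^sup>2) < \<epsilon>"
  shows "trig_approximable f"
  unfolding trig_approximable_def
proof (intro conjI allI impI f)
  fix \<epsilon> :: real assume "\<epsilon> > 0"
  then obtain g where g: "trig_approximable g" "(LINT x|cube_measure. (norm (f x - g x))\<^sup>2) < \<epsilon> / 4"
    using lim[of "\<epsilon> / 4"] by auto
  obtain p where p: "trig_poly p" "sq_int cube_measure p" "(LINT x|cube_measure. (norm (g x - p x))\<^sup>2) < \<epsilon> / 4"
    using trig_approximableE[OF g(1), of "\<epsilon> / 4"] \<open>\<epsilon> > 0\<close> by auto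
  show "\<exists>p. trig_poly p \<and> (LINT x|cube_measure. (norm (f x - p x))\<^sup>2) < \<epsilon>"
    using integral_sq_triangle[OF f trig_approximableD[OF g(1)] p(2)] g p by (intro exI[of _ p]) auto
qed

lemma trig_approximable_add:
  assumes "trig_approximable f" "trig_approximable g"
  shows "trig_approximable (\<lambda>x. f x + g x)"
  unfolding trig_approximable_def
proof (intro conjI allI impI)
  note fg = assms[THEN trig_approximableD]
  show "sq_int cube_measure (\<lambda>x. f x + g x)" by (intro sq_int_add fg)
  fix \<epsilon> :: real assume "\<epsilon> > 0"
  then obtain p where p: "trig_poly p" "sq_int cube_measure p" "(LINT x|cube_measure. (norm (f x - p x))\<^sup>2) < \<epsilon> / 4"
    using trig_approximableE[OF assms(1), of "\<epsilon> / 4"] by auto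
  obtain q where q: "trig_poly q" "sq_int cube_measure q" "(LINT x|cube_measure. (norm (g x - q x))\<^sup>2) < \<epsilon> / 4"
    using trig_approximableE[OF assms(2), of "\<epsilon> / 4"] \<open>\<epsilon> > 0\<close> by auto
  have "(LINT x|cube_measure. (norm (f x + g x - (p x + q x)))\<^sup>2) \<le>
        2 * (LINT x|cube_measure. (norm (f x - p x))\<^sup>2) + 2 * (LINT x|cube_measure. (norm (g x - q x))\<^sup>2)"
    using integral_sq_triangle[OF sq_int_add[OF fg] sq_int_add[OF p(2) fg(2)] sq_int_add[OF p(2) q(2)]]
    by (simp add: algebra_simps)
  then show "\<exists>p. trig_poly p \<and> (LINT x|cube_measure. (norm (f x + g x - p x))\<^sup>2) < \<epsilon>"
    using p q by (intro exI[of _ "\<lambda>x. p x + q x"]) (auto intro: trig_poly.intros)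
qed

lemma trig_approximable_trig_poly_mult:
  assumes f: "trig_approximable f" and p: "trig_poly p"
  shows "trig_approximable (\<lambda>x. p x * f x)"
proof -
  obtain C where C: "norm (p x) \<le> C" for x using trig_poly_bounded[OF p] by blast
  have [measurable]: "p \<in> borel_measurable borel" using trig_poly_measurable[OF p] .
  have [measurable]: "f \<in> borel_measurable borel" using trig_approximableD[OF f] by (auto simp: sq_int_def)
  show ?thesis unfolding trig_approximable_def
  proof (intro conjI allI impI)
    show "sq_int cube_measure (\<lambda>x. p x * f x)"
      by (rule sq_int_bound[OF trig_approximableD[OF f], of _ C])
         (auto simp: norm_mult C intro!: mult_right_mono)
    fix \<epsilon> :: real assume \<epsilon>: "\<epsilon> > 0"
    have C1: "0 < C\<^sup>2 + 1" by (simp add: add_nonneg_pos)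
    then obtain q where q: "trig_poly q" "sq_int cube_measure q" "(LINT x|cube_measure. (norm (f x - q x))\<^sup>2) < \<epsilon> / (C\<^sup>2 + 1)"
      using trig_approximableE[OF f, of "\<epsilon> / (C\<^sup>2 + 1)"] \<epsilon> by auto
    have "(LINT x|cube_measure. (norm (p x * f x - p x * q x))\<^sup>2) = (LINT x|cube_measure. (norm (p x * (f x - q x)))\<^sup>2)"
      by (simp add: algebra_simps)
    also have "\<dots> \<le> C\<^sup>2 * (LINT x|cube_measure. (norm (f x - q x))\<^sup>2)"
      by (rule integral_sq_mult_le) (auto intro: C sq_int_diff trig_approximableD[OF f] q)
    also have "\<dots> \<le> (C\<^sup>2 + 1) * (LINT x|cube_measure. (norm (f x - q x))\<^sup>2)"
      by (intro mult_right_mono integral_nonneg_AE) auto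
    also have "\<dots> < \<epsilon>" using q(3) C1 by (simp add: field_simps)
    finally show "\<exists>q. trig_poly q \<and> (LINT x|cube_measure. (norm (p x * f x - q x))\<^sup>2) < \<epsilon>"
      using trig_poly_mult[OF p q(1)] by blast
  qed
qed

lemma trig_approximable_cmult: "trig_approximable f \<Longrightarrow> trig_approximable (\<lambda>x. c * f x)"
  using trig_approximable_trig_poly_mult[OF _ trig_poly_const] .

text \<open>
  Approximate \<open>g\<close> by a trigonometric polynomial \<open>q\<close>. Then \<open>q f\<close> is close to \<open>g f\<close> because \<open>f\<close> is bounded, and
  \<open>q f\<close> is in the closed span because multiplication by a character permutes the characters.
\<close>

lemma trig_approximable_mult:
  assumes f: "trig_approximable f" and g: "trig_approximable g"
    and C: "\<And>x. x \<in> cube \<Longrightarrow> norm (f x) \<le> C"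
    and D: "\<And>x. x \<in> cube \<Longrightarrow> norm (g x) \<le> D"
  shows "trig_approximable (\<lambda>x. g x * f x)"
proof (rule trig_approximable_closed)
  have [measurable]: "f \<in> borel_measurable borel" "g \<in> borel_measurable borel"
    using trig_approximableD[OF f] trig_approximableD[OF g] by (auto simp: sq_int_def)
  show "sq_int cube_measure (\<lambda>x. g x * f x)"
    by (rule sq_int_bound[OF trig_approximableD[OF f], of _ D])
       (auto simp: norm_mult D AE_cube_measure intro!: mult_right_mono)
  fix \<epsilon> :: real assume \<epsilon>: "\<epsilon> > 0"
  have C1: "0 < C\<^sup>2 + 1" by (simp add: add_nonneg_pos)
  then obtain q where q: "trig_poly q" "sq_int cube_measure q" "(LINT x|cube_measure. (norm (g x - q x))\<^sup>2) < \<epsilon> / (C\<^sup>2 + 1)"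
    using trig_approximableE[OF g, of "\<epsilon> / (C\<^sup>2 + 1)"] \<epsilon> by auto
  have "(LINT x|cube_measure. (norm (g x * f x - q x * f x))\<^sup>2) = (LINT x|cube_measure. (norm (f x * (g x - q x)))\<^sup>2)"
    by (simp add: algebra_simps)
  also have "\<dots> \<le> C\<^sup>2 * (LINT x|cube_measure. (norm (g x - q x))\<^sup>2)"
    by (rule integral_sq_mult_le) (auto intro: C sq_int_diff trig_approximableD[OF g] q simp: AE_cube_measure)
  also have "\<dots> \<le> (C\<^sup>2 + 1) * (LINT x|cube_measure. (norm (g x - q x))\<^sup>2)"
    by (intro mult_right_mono integral_nonneg_AE) auto
  also have "\<dots> < \<epsilon>" using q(3) C1 by (simp add: field_simps)
  finally show "\<exists>h. trig_approximable h \<and> (LINT x|cube_measure. (norm (g x * f x - h x))\<^sup>2) < \<epsilon>"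
    using trig_approximable_trig_poly_mult[OF f q(1)] by blast
qed

text \<open>
  The coordinate has energy \<open>1/12\<close>, and its partial Fourier sums have energy
  \<open>(1 / (2 \<pi>\<^sup>2)) (\<Sum>n=1..N. 1/n\<^sup>2)\<close>, which tends to \<open>1/12\<close> by Euler's formula \<open>\<Sum>n. 1/n\<^sup>2 = \<pi>\<^sup>2/6\<close>. So the distance
  to the partial sums tends to zero.
\<close>

lemma trig_approximable_coordinate:
  fixes b :: "'a::euclidean_space"
  assumes b: "b \<in> Basis"
  shows "trig_approximable (\<lambda>x. complex_of_real (x \<bullet> b))"
proof -
  let ?f = "\<lambda>x::'a. complex_of_real (x \<bullet> b)"
  have f: "sq_int cube_measure ?f"
    using b by (intro cube.sq_int_bounded[where B = "1/2"]) (auto simp: AE_cube_measure cube_def)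
  define F where "F k = (LINT x|cube_measure. ?f x * cnj (harmonic k x))" for k
  have F: "(norm (F (s *\<^sub>R b)))\<^sup>2 = 1 / (4 * pi\<^sup>2) * (1 / s\<^sup>2)" if "s \<in> \<int>" "s \<noteq> 0" for s
  proof -
    have "F (s *\<^sub>R b) = (LINT x|cube_measure. (\<lambda>t. of_real t * cis (2 * pi * (- s * t))) (x \<bullet> b))"
      unfolding F_def by (intro Bochner_Integration.integral_cong refl) (simp add: cnj_harmonic, simp add: harmonic_def inner_commute)
    also have "\<dots> = (LINT t|lborel. indicator {-1/2..1/2} t *\<^sub>R (of_real t * cis (2 * pi * (- s * t))))"
      by (rule integral_cube_coordinate[OF _ b]) (intro continuous_intros)
    also have "norm \<dots> = 1 / (2 * pi * \<bar>- s\<bar>)"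
      by (rule integral_id_cis_period) (use that in auto)
    finally show ?thesis by (simp add: power_divide power_mult_distrib)
  qed
  have sq: "(LINT x|cube_measure. (norm (?f x))\<^sup>2) = 1 / 12"
  proof -
    have "complex_of_real (LINT x|cube_measure. (norm (?f x))\<^sup>2) =
       (LINT x|cube_measure. (\<lambda>t. complex_of_real (t^2)) (x \<bullet> b))"
      by (simp flip: integral_complex_of_real del: of_real_power)
    also have "\<dots> = (LINT t|lborel. indicator {-1/2..1/2} t *\<^sub>R complex_of_real (t^2))"
      by (rule integral_cube_coordinate[OF _ b]) (intro continuous_intros)
    also have "\<dots> = complex_of_real (1 / 12)" unfolding integral_square_period by simp
    finally show ?thesis unfolding of_real_eq_iff .
  qed
  show ?thesis unfolding trig_approximable_def
  proof (intro conjI allI impI f)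
    fix \<epsilon> :: real assume \<epsilon>: "\<epsilon> > 0"
    have "\<forall>\<^sub>F N in sequentially. (\<Sum>n<N. 1 / (real n + 1)\<^sup>2) > pi\<^sup>2/6 - \<epsilon>"
      using inverse_squares_sums \<epsilon> unfolding sums_def by (intro order_tendstoD(1)) (auto simp: add.commute)
    then obtain N where N: "(\<Sum>n<N. 1 / (real n + 1)\<^sup>2) > pi\<^sup>2/6 - \<epsilon>"
      by (auto simp: eventually_sequentially)
    define P where "P = (\<lambda>n. (real n + 1) *\<^sub>R b) ` {..<N}"
    define Q where "Q = (\<lambda>n. (- (real n + 1)) *\<^sub>R b) ` {..<N}"
    have b0: "b \<noteq> 0" using b by auto
    have inj: "inj_on (\<lambda>n. (real n + 1) *\<^sub>R b) {..<N}" "inj_on (\<lambda>n. (- (real n + 1)) *\<^sub>R b) {..<N}"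
      using b0 by (auto simp: inj_on_def)
    have fin: "finite P" "finite Q" by (auto simp: P_def Q_def)
    have "real n + 1 \<noteq> - (real m + 1)" for n m by linarith
    then have "(real n + 1) *\<^sub>R b \<noteq> (- (real m + 1)) *\<^sub>R b" for n m
      using b0 unfolding scaleR_cancel_right by blast
    then have disj: "P \<inter> Q = {}" unfolding P_def Q_def by (blast elim: imageE)
    have "s *\<^sub>R b \<in> lattice" if "s \<in> \<int>" for s
      using that b by (auto simp: inner_Basis lattice_def)
    then have lat: "P \<union> Q \<subseteq> lattice" unfolding P_def Q_def
      by (intro Un_least image_subsetI) simp_all
    have nz: "real n + 1 \<noteq> 0" for n by linarith
    have "(\<Sum>k\<in>P. (norm (F k))\<^sup>2) = 1 / (4 * pi\<^sup>2) * (\<Sum>n<N. 1 / (real n + 1)\<^sup>2)"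
      unfolding P_def sum.reindex[OF inj(1)] o_def sum_distrib_left
      by (intro sum.cong refl F) (auto simp: nz)
    moreover have "(\<Sum>k\<in>Q. (norm (F k))\<^sup>2) = 1 / (4 * pi\<^sup>2) * (\<Sum>n<N. 1 / (real n + 1)\<^sup>2)"
      unfolding Q_def sum.reindex[OF inj(2)] o_def sum_distrib_left
    proof (intro sum.cong refl)
      fix n
      have "- (real n + 1) \<in> \<int>" "- (real n + 1) \<noteq> 0" using nz[of n] by simp_all
      from F[OF this] show "(norm (F ((- (real n + 1)) *\<^sub>R b)))\<^sup>2 = 1 / (4 * pi\<^sup>2) * (1 / (real n + 1)\<^sup>2)"
        unfolding power2_minus .
    qed
    ultimately have S: "(\<Sum>k\<in>P\<union>Q. (norm (F k))\<^sup>2) = 1 / (2 * pi\<^sup>2) * (\<Sum>n<N. 1 / (real n + 1)\<^sup>2)"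
      using fin disj by (simp add: sum.union_disjoint field_simps)
    have "(LINT x|cube_measure. (norm (?f x - (\<Sum>k\<in>P\<union>Q. F k * harmonic k x)))\<^sup>2) = 1 / 12 - (\<Sum>k\<in>P\<union>Q. (norm (F k))\<^sup>2)"
      using orthonormal_distance[OF orthonormal_harmonic _ lat f, of F] fin sq by (simp add: F_def)
    also have "\<dots> < 1 / 12 - 1 / (2 * pi\<^sup>2) * (pi\<^sup>2/6 - \<epsilon>)"
      unfolding S using N by (intro diff_strict_left_mono mult_strict_left_mono) auto
    also have "\<dots> = \<epsilon> / (2 * pi\<^sup>2)" by (simp add: field_simps)
    also have "\<dots> \<le> \<epsilon>"
    proof -
      have "1 \<le> pi" using pi_gt3 by linarith
      then have "1 * 1 \<le> pi * pi" by (intro mult_mono) auto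
      then show ?thesis using \<epsilon> by (simp add: divide_simps power2_eq_square)
    qed
    finally show "\<exists>p. trig_poly p \<and> (LINT x|cube_measure. (norm (?f x - p x))\<^sup>2) < \<epsilon>"
      using trig_poly_sum[OF _ lat, of F] fin by blast
  qed
qed

lemma trig_approximable_real_polynomial:
  assumes "real_polynomial_function p"
  shows "trig_approximable (\<lambda>x. complex_of_real (p x))"
  using assms
proof (induction rule: real_polynomial_function.induct)
  case (linear f)
  have span: "trig_approximable (\<lambda>x. \<Sum>b\<in>S. complex_of_real (f b) * complex_of_real (x \<bullet> b))" if "S \<subseteq> Basis" for S
    using finite_subset[OF that finite_Basis] that
  proof (induction S rule: finite_induct)
    case empty
    then show ?case by (simp add: trig_poly_approximable trig_poly_const)
  next
    case (insert b S)
    then have "trig_approximable (\<lambda>x. complex_of_real (f b) * complex_of_real (x \<bullet> b)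
        + (\<Sum>b\<in>S. complex_of_real (f b) * complex_of_real (x \<bullet> b)))"
      by (intro trig_approximable_add[OF trig_approximable_cmult[OF trig_approximable_coordinate]]) auto
    with insert show ?case by simp
  qed
  have f_eq: "f x = (\<Sum>b\<in>Basis. f b * (x \<bullet> b))" for x
  proof -
    interpret bounded_linear f by fact
    have "f x = f (\<Sum>b\<in>Basis. (x \<bullet> b) *\<^sub>R b)" by (simp add: euclidean_representation)
    also have "\<dots> = (\<Sum>b\<in>Basis. f b * (x \<bullet> b))" by (simp add: sum scaleR mult.commute)
    finally show ?thesis .
  qed
  have "(\<lambda>x. complex_of_real (f x)) = (\<lambda>x. \<Sum>b\<in>Basis. complex_of_real (f b) * complex_of_real (x \<bullet> b))"
  proof
    show "complex_of_real (f x) = (\<Sum>b\<in>Basis. complex_of_real (f b) * complex_of_real (x \<bullet> b))" for x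
      using arg_cong[OF f_eq[of x], of complex_of_real] by simp
  qed
  with span[OF order_refl] show ?case by (simp only:)
next
  case (const c)
  then show ?case by (intro trig_poly_approximable trig_poly_const)
next
  case (add f g)
  from trig_approximable_add[OF add.IH] show ?case by simp
next
  case (mult f g)
  have bounded: "\<exists>B. \<forall>x\<in>cube. norm (complex_of_real (h x)) \<le> B" if "real_polynomial_function h" for h :: "'a \<Rightarrow> real"
  proof -
    have "continuous_on cube h"
      by (rule continuous_on_polymonial_function[OF iffD1[OF real_polynomial_function_eq that]])
    then have "bounded (h ` cube)"
      by (intro compact_imp_bounded compact_continuous_image compact_cube)
    then show ?thesis by (auto simp: bounded_iff)
  qed
  obtain B where B: "norm (complex_of_real (f x)) \<le> B" if "x \<in> cube" for x using bounded[OF mult.hyps(1)] by blast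
  obtain C where C: "norm (complex_of_real (g x)) \<le> C" if "x \<in> cube" for x using bounded[OF mult.hyps(2)] by blast
  have "trig_approximable (\<lambda>x. complex_of_real (f x) * complex_of_real (g x))"
    by (rule trig_approximable_mult[OF mult.IH(2,1) C B])
  then show ?case by simp
qed

lemma trig_approximable_continuous:
  assumes f: "continuous_on UNIV (f :: 'a::euclidean_space \<Rightarrow> real)"
  shows "trig_approximable (\<lambda>x. complex_of_real (f x))"
proof (rule trig_approximable_closed)
  have [measurable]: "f \<in> borel_measurable borel" using f by (rule borel_measurable_continuous_onI)
  have fc: "continuous_on cube f" using f by (rule continuous_on_subset) auto
  have "bounded (f ` cube)"
    by (intro compact_imp_bounded compact_continuous_image compact_cube fc)
  then obtain B where "\<And>x. x \<in> cube \<Longrightarrow> norm (f x) \<le> B" by (auto simp: bounded_iff)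
  then show sf: "sq_int cube_measure (\<lambda>x. complex_of_real (f x))"
    by (intro cube.sq_int_bounded[where B = B]) (auto simp: AE_cube_measure)
  have one: "sq_int (cube_measure :: 'a measure) (\<lambda>_. 1)"
    by (intro trig_poly_sq_int trig_poly_const)
  define m where "m = (LINT x|(cube_measure :: 'a measure). 1::real)"
  have m0: "m \<ge> 0" unfolding m_def by (intro integral_nonneg_AE) auto
  fix \<epsilon> :: real assume \<epsilon>: "\<epsilon> > 0"
  define \<delta> where "\<delta> = min 1 (\<epsilon> / (m + 1))"
  have "\<delta> \<le> \<epsilon> / (m + 1)" by (simp add: \<delta>_def)
  then have \<delta>: "\<delta> > 0" "\<delta> \<le> 1" "\<delta> * (m + 1) \<le> \<epsilon>" using \<epsilon> m0 by (simp_all add: pos_le_divide_eq) (simp_all add: \<delta>_def)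
  obtain g where g: "real_polynomial_function g" "\<And>x. x \<in> cube \<Longrightarrow> \<bar>f x - g x\<bar> < \<delta>"
    using Stone_Weierstrass_real_polynomial_function[OF compact_cube fc \<delta>(1)] by metis
  note ga = trig_approximable_real_polynomial[OF g(1)]
  have sd: "sq_int cube_measure (\<lambda>x. complex_of_real (f x) - complex_of_real (g x))"
    by (intro sq_int_diff sf trig_approximableD ga)
  have "(LINT x|cube_measure. (norm ((complex_of_real (f x) - complex_of_real (g x)) * 1))\<^sup>2) \<le>
     \<delta>\<^sup>2 * (LINT x|(cube_measure :: 'a measure). (norm (1::complex))\<^sup>2)"
  proof (rule integral_sq_mult_le[OF one])
    show "AE x in cube_measure. norm (complex_of_real (f x) - complex_of_real (g x)) \<le> \<delta>"
      using g(2) unfolding AE_cube_measure of_real_diff[symmetric] norm_of_real by (auto intro: less_imp_le)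
  qed (use sd in \<open>auto simp: sq_int_def\<close>)
  also have "\<dots> = \<delta>\<^sup>2 * m" by (simp add: m_def)
  also have "\<dots> \<le> \<delta> * m" using \<delta> m0 by (intro mult_right_mono) (auto simp: power2_eq_square mult_le_cancel_right1)
  also have "\<dots> < \<epsilon>" using \<delta> by (simp add: algebra_simps)
  finally show "\<exists>g. trig_approximable g \<and> (LINT x|cube_measure. (norm (complex_of_real (f x) - g x))\<^sup>2) < \<epsilon>"
    using ga by (intro exI[of _ "\<lambda>x. complex_of_real (g x)"]) auto
qed

lemma trig_approximable_dominated:
  fixes f :: "'a::euclidean_space \<Rightarrow> complex"
  assumes f: "sq_int cube_measure f" and s: "\<And>n::nat. trig_approximable (s n)"
    and lim: "AE x in cube_measure. (\<lambda>n. s n x) \<longlonglongrightarrow> f x"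
    and w: "integrable cube_measure w" "\<And>n. AE x in cube_measure. (norm (f x - s n x))\<^sup>2 \<le> w x"
  shows "trig_approximable f"
proof (rule trig_approximable_closed[OF f])
  fix \<epsilon> :: real assume \<epsilon>: "\<epsilon> > 0"
  have [measurable]: "f \<in> borel_measurable cube_measure" "\<And>n. s n \<in> borel_measurable cube_measure"
    using f trig_approximableD[OF s] by (auto simp: sq_int_def simp del: sets_cube_measure)
  have "(\<lambda>n. LINT x|cube_measure. (norm (f x - s n x))\<^sup>2) \<longlonglongrightarrow> (LINT x|(cube_measure :: 'a measure). 0)"
  proof (rule integral_dominated_convergence[where w = w])
    show "AE x in cube_measure. (\<lambda>n. (norm (f x - s n x))\<^sup>2) \<longlonglongrightarrow> 0"
      using lim
    proof eventually_elim
      case (elim x)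
      have "(\<lambda>n. (norm (f x - s n x))\<^sup>2) \<longlonglongrightarrow> (norm (f x - f x))\<^sup>2" by (intro tendsto_intros elim)
      then show ?case by simp
    qed
  qed (use w in auto)
  then have "\<forall>\<^sub>F n in sequentially. (LINT x|cube_measure. (norm (f x - s n x))\<^sup>2) < \<epsilon>"
    using \<epsilon> by (intro order_tendstoD(2)) auto
  then obtain n where "(LINT x|cube_measure. (norm (f x - s n x))\<^sup>2) < \<epsilon>"
    by (auto simp: eventually_sequentially)
  then show "\<exists>g. trig_approximable g \<and> (LINT x|cube_measure. (norm (f x - g x))\<^sup>2) < \<epsilon>"
    using s by blast
qed

text \<open>
  A measurable function is an almost everywhere limit of continuous ones; truncating these at the bound
  of \<open>f\<close> makes the convergence dominated.
\<close>

lemma trig_approximable_bounded: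
  fixes f :: "'a::euclidean_space \<Rightarrow> real"
  assumes f[measurable]: "f \<in> borel_measurable borel" and B: "\<And>x. \<bar>f x\<bar> \<le> B"
  shows "trig_approximable (\<lambda>x. complex_of_real (f x))"
proof -
  have "f \<in> borel_measurable lebesgue" by (intro measurable_completion) simp
  then have "f measurable_on UNIV" by (rule lebesgue_measurable_imp_measurable_on) auto
  then obtain N g where N: "negligible N" and g: "\<And>n. continuous_on UNIV (g n)"
    and lim: "\<And>x. x \<notin> N \<Longrightarrow> (\<lambda>n. g n x) \<longlonglongrightarrow> f x"
    unfolding measurable_on_def by auto
  define h where "h n x = max (- B) (min B (g n x))" for n x
  have B0: "B \<ge> 0" using B[of 0] by linarith
  have hB: "\<bar>h n x\<bar> \<le> B" for n x unfolding h_def using B0 by auto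
  have "AE x in lebesgue. x \<notin> N" using N by (intro AE_not_in) (simp add: negligible_iff_null_sets)
  then have aeN: "AE x in lborel. x \<notin> N" by (simp add: AE_completion_iff)
  show ?thesis
  proof (rule trig_approximable_dominated[where s = "\<lambda>n x. complex_of_real (h n x)" and w = "\<lambda>_. (2 * B)\<^sup>2"])
    show "sq_int cube_measure (\<lambda>x. complex_of_real (f x))"
      by (rule cube.sq_int_bounded[where B = B]) (auto simp: B)
    show "trig_approximable (\<lambda>x. complex_of_real (h n x))" for n
      unfolding h_def by (intro trig_approximable_continuous continuous_intros g)
    have "(\<lambda>n. h n x) \<longlonglongrightarrow> f x" if "x \<notin> N" for x
    proof -
      have "(\<lambda>n. h n x) \<longlonglongrightarrow> max (- B) (min B (f x))"
        unfolding h_def by (intro tendsto_intros lim that)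
      then show ?thesis using B[of x] by (simp add: max_def min_def abs_le_iff split: if_splits)
    qed
    then show "AE x in cube_measure. (\<lambda>n. complex_of_real (h n x)) \<longlonglongrightarrow> complex_of_real (f x)"
      unfolding AE_cube_measure using aeN by (auto intro!: tendsto_of_real elim: eventually_mono)
    show "AE x in cube_measure. (norm (complex_of_real (f x) - complex_of_real (h n x)))\<^sup>2 \<le> (2 * B)\<^sup>2" for n
    proof (intro AE_I2 power_mono)
      fix x
      have "\<bar>f x - h n x\<bar> \<le> 2 * B" using B[of x] hB[of n x] by linarith
      then show "norm (complex_of_real (f x) - complex_of_real (h n x)) \<le> 2 * B"
        by (simp flip: of_real_diff)
    qed auto
  qed auto
qed

lemma sq_int_trig_approximable:
  fixes f :: "'a::euclidean_space \<Rightarrow> complex"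
  assumes f: "sq_int cube_measure f"
  shows "trig_approximable f"
proof -
  have real: "trig_approximable (\<lambda>x. complex_of_real (g x))"
    if g: "sq_int cube_measure (\<lambda>x. complex_of_real (g x))" and [measurable]: "g \<in> borel_measurable borel"
    for g :: "'a \<Rightarrow> real"
  proof (rule trig_approximable_dominated[OF g,
        where s = "\<lambda>n x. complex_of_real (if \<bar>g x\<bar> \<le> real n then g x else 0)" and w = "\<lambda>x. (g x)\<^sup>2"])
    show "trig_approximable (\<lambda>x. complex_of_real (if \<bar>g x\<bar> \<le> real n then g x else 0))" for n
      by (rule trig_approximable_bounded[where B = n]) auto
    show "integrable cube_measure (\<lambda>x. (g x)\<^sup>2)" using sq_int_integrable[OF g] by simp
    have "\<forall>\<^sub>F n in sequentially. complex_of_real (if \<bar>g x\<bar> \<le> real n then g x else 0) = complex_of_real (g x)" for x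
      using eventually_ge_at_top[of "nat \<lceil>\<bar>g x\<bar>\<rceil>"] by eventually_elim (auto simp: nat_ceiling_le_eq)
    then show "AE x in cube_measure. (\<lambda>n. complex_of_real (if \<bar>g x\<bar> \<le> real n then g x else 0)) \<longlonglongrightarrow> complex_of_real (g x)"
      by (intro AE_I2 tendsto_eventually)
    show "AE x in cube_measure. (norm (complex_of_real (g x) - complex_of_real (if \<bar>g x\<bar> \<le> real n then g x else 0)))\<^sup>2 \<le> (g x)\<^sup>2" for n
      by (intro AE_I2) auto
  qed
  have [measurable]: "f \<in> borel_measurable borel" using f by (auto simp: sq_int_def)
  have "trig_approximable (\<lambda>x. complex_of_real (Re (f x)) + \<i> * complex_of_real (Im (f x)))"
    by (intro trig_approximable_add trig_approximable_cmult real sq_int_bound[OF f, where C = 1])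
       (auto simp: abs_Re_le_cmod abs_Im_le_cmod)
  then show ?thesis by (simp flip: complex_eq)
qed

theorem parseval_cube:
  assumes f: "sq_int cube_measure f"
  shows "((\<lambda>k. (norm (LINT x|cube_measure. f x * cnj (harmonic k x)))\<^sup>2) has_sum
           (LINT x|cube_measure. (norm (f x))\<^sup>2)) lattice"
proof (rule parseval[OF orthonormal_harmonic f])
  fix \<epsilon> :: real assume "\<epsilon> > 0"
  then obtain p where p: "trig_poly p" "(LINT x|cube_measure. (norm (f x - p x))\<^sup>2) < \<epsilon>"
    by (rule trig_approximableE[OF sq_int_trig_approximable[OF f]])
  obtain S c where S: "finite S" "S \<subseteq> lattice"
    and pS: "p = (\<lambda>x. \<Sum>k\<in>S. c k * harmonic k x)"
    by (rule trig_poly_expansion[OF p(1)])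
  show "\<exists>S c. finite S \<and> S \<subseteq> lattice \<and> (LINT x|cube_measure. (norm (f x - (\<Sum>k\<in>S. c k * harmonic k x)))\<^sup>2) < \<epsilon>"
    using p(2) S unfolding pS by blast
qed

section \<open>Borel representatives, null sets and Fubini\<close>

lemma borel_measurable_cnj [measurable (raw)]:
  "f \<in> borel_measurable M \<Longrightarrow> (\<lambda>x. cnj (f x)) \<in> borel_measurable M"
  by (simp add: borel_measurable_complex_iff)

lemma borel_measurable_lebesgue_AE:
  fixes f f' :: "'a::euclidean_space \<Rightarrow> 'b::topological_space"
  assumes f': "f' \<in> borel_measurable borel" and ae: "AE x in lborel. f x = f' x"
  shows "f \<in> borel_measurable lebesgue"
proof (rule measurableI)
  fix A :: "'b set" assume [measurable]: "A \<in> sets borel"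
  have f'A: "f' -` A \<inter> space lebesgue \<in> sets lebesgue"
    using f' by (intro measurable_sets[of f' _ borel]) (auto intro: measurable_completion)
  have "AE x in lebesgue. x \<in> f' -` A \<inter> space lebesgue \<longleftrightarrow> x \<in> f -` A \<inter> space lebesgue"
    using AE_completion[OF ae] by eventually_elim auto
  from completion.in_sets_AE[OF this f'A] show "f -` A \<inter> space lebesgue \<in> sets lebesgue"
    by auto
qed auto

text \<open>
  Product measures and Fubini's theorem live on the Borel sets, whereas the functions of the theorem are
  Lebesgue measurable. Every function is therefore replaced by a Borel function that agrees with it
  almost everywhere, and the next lemmas transfer integrals.
\<close>

lemma borel_representative:
  fixes f :: "'a::euclidean_space \<Rightarrow> complex"
  assumes f: "f \<in> borel_measurable lebesgue"
  obtains f' where "f' \<in> borel_measurable borel" "AE x in lborel. f x = f' x"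
proof -
  have "(\<lambda>x. Re (f x)) \<in> borel_measurable (completion lborel)" "(\<lambda>x. Im (f x)) \<in> borel_measurable (completion lborel)"
    using f by measurable
  from this[THEN completion_ex_borel_measurable_real]
  obtain p q where [measurable]: "p \<in> borel_measurable lborel" "q \<in> borel_measurable lborel"
    and ae: "AE x in lborel. Re (f x) = p x" "AE x in lborel. Im (f x) = q x" by blast
  have "AE x in lborel. f x = Complex (p x) (q x)"
    using ae by eventually_elim (simp add: complex_eq_iff)
  moreover have "(\<lambda>x. Complex (p x) (q x)) \<in> borel_measurable borel"
    by (simp add: borel_measurable_complex_iff)
  ultimately show ?thesis using that by blast
qed

lemma
  fixes f f' :: "'a::euclidean_space \<Rightarrow> 'b::{banach, second_countable_topology}"
  assumes f': "f' \<in> borel_measurable borel" and ae: "AE x in lborel. f x = f' x"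
  shows lebesgue_integral_representative: "integral\<^sup>L lebesgue f = integral\<^sup>L lborel f'"
    and integrable_lebesgue_representative: "integrable lebesgue f \<longleftrightarrow> integrable lborel f'"
proof -
  have [measurable]: "f \<in> borel_measurable lebesgue" "f' \<in> borel_measurable lebesgue"
    using borel_measurable_lebesgue_AE[OF f' ae] f' by (auto intro: measurable_completion)
  have "integral\<^sup>L lebesgue f = integral\<^sup>L lebesgue f'"
    using AE_completion[OF ae] by (intro integral_cong_AE) auto
  also have "\<dots> = integral\<^sup>L lborel f'" using f' by (intro integral_completion) auto
  finally show "integral\<^sup>L lebesgue f = integral\<^sup>L lborel f'" .
  have "integrable lebesgue f \<longleftrightarrow> integrable lebesgue f'"
    using AE_completion[OF ae] by (intro integrable_cong_AE) auto
  also have "\<dots> \<longleftrightarrow> integrable lborel f'" using f' by (intro integrable_completion) auto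
  finally show "integrable lebesgue f \<longleftrightarrow> integrable lborel f'" .
qed

lemma square_integrable_iff_sq_int: "square_integrable f \<longleftrightarrow> sq_int lebesgue f"
  by (simp add: square_integrable_def sq_int_def)

lemma sq_int_representative:
  assumes "square_integrable f" "f' \<in> borel_measurable borel" "AE x in lborel. f x = f' x"
  shows "sq_int lborel f'" "(l2norm f)\<^sup>2 = (LINT x|lborel. (norm (f' x))\<^sup>2)"
proof -
  have ae: "AE x in lborel. (norm (f x))\<^sup>2 = (norm (f' x))\<^sup>2" using assms(3) by eventually_elim simp
  have m: "(\<lambda>x. (norm (f' x))\<^sup>2) \<in> borel_measurable borel" using assms(2) by measurable
  show "sq_int lborel f'" using assms integrable_lebesgue_representative[OF m ae]
    by (auto simp: sq_int_def square_integrable_def)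
  have "0 \<le> (LINT x|lebesgue. (norm (f x))\<^sup>2)" by (intro integral_nonneg_AE) auto
  then show "(l2norm f)\<^sup>2 = (LINT x|lborel. (norm (f' x))\<^sup>2)"
    unfolding l2norm_def lebesgue_integral_representative[OF m ae, symmetric] by simp
qed

text \<open>
  Changing \<open>g\<close> on a null set must not change the ridge functions, so the preimage of a null set \<open>N\<close> under
  \<open>x \<mapsto> u \<bullet> x + c\<close> has to be null. Its measure equals that of the preimage of \<open>N - t\<close> for every \<open>t\<close>, by translation
  along \<open>u\<close>. Averaging over \<open>t \<in> [0,1]\<close> and exchanging the integrals leaves \<open>\<integral> 1\<^sub>N(a + t) dt = 0\<close> inside.
\<close>

lemma AE_inner_affine:
  fixes u :: "'a::euclidean_space" and c :: real
  assumes P: "AE s in lborel. P s" and u: "u \<noteq> 0"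
  shows "AE x in lborel. P (u \<bullet> x + c)"
proof -
  obtain N where N: "{s \<in> space lborel. \<not> P s} \<subseteq> N" "emeasure lborel N = 0" "N \<in> sets lborel"
    using AE_E[OF P] by blast
  have [measurable]: "N \<in> sets borel" using N by simp
  define v where "v = u /\<^sub>R (u \<bullet> u)"
  have uv: "u \<bullet> v = 1" using u by (simp add: v_def)
  define I where "I = (\<integral>\<^sup>+x. indicator N (u \<bullet> x + c) \<partial>lborel)"
  have shift: "(\<integral>\<^sup>+x. indicator N (u \<bullet> x + c + t) \<partial>lborel) = I" for t
  proof -
    have "I = (\<integral>\<^sup>+x. indicator N (u \<bullet> x + c) \<partial>distr lborel borel ((+) (t *\<^sub>R v)))"
      unfolding I_def lborel_distr_plus ..
    also have "\<dots> = (\<integral>\<^sup>+x. indicator N (u \<bullet> (t *\<^sub>R v + x) + c) \<partial>lborel)"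
      by (rule nn_integral_distr) auto
    also have "\<dots> = (\<integral>\<^sup>+x. indicator N (u \<bullet> x + c + t) \<partial>lborel)"
      by (simp add: inner_add_right uv ac_simps)
    finally show ?thesis by simp
  qed
  have inner0: "(\<integral>\<^sup>+t. indicator N (a + t) \<partial>lborel) = 0" for a :: real
  proof -
    have "(\<integral>\<^sup>+t. indicator N (a + t) \<partial>lborel) = (\<integral>\<^sup>+t. indicator N t \<partial>distr lborel borel ((+) a))"
      by (subst nn_integral_distr) auto
    then show ?thesis using N unfolding lborel_distr_plus by simp
  qed
  have "I = (\<integral>\<^sup>+t. indicator {0..1::real} t * I \<partial>lborel)"
    by (simp add: nn_integral_multc)
  also have "\<dots> = (\<integral>\<^sup>+t. indicator {0..1::real} t * (\<integral>\<^sup>+x. indicator N (u \<bullet> x + c + t) \<partial>lborel) \<partial>lborel)"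
    unfolding shift ..
  also have "\<dots> \<le> (\<integral>\<^sup>+t. (\<integral>\<^sup>+x. indicator N (u \<bullet> x + c + t) \<partial>lborel) \<partial>lborel)"
    by (intro nn_integral_mono) (auto simp: indicator_def)
  also have "\<dots> = (\<integral>\<^sup>+x. (\<integral>\<^sup>+t. indicator N (u \<bullet> x + c + t) \<partial>lborel) \<partial>lborel)"
    by (rule lborel_pair.Fubini') measurable
  also have "\<dots> = 0" by (simp add: inner0)
  finally have "I = 0" by simp
  then have "AE x in lborel. indicator N (u \<bullet> x + c) = (0::ennreal)"
    unfolding I_def by (subst (asm) nn_integral_0_iff_AE) auto
  then show ?thesis
  proof eventually_elim
    case (elim x)
    then show ?case using N(1) by (auto simp: indicator_def split: if_splits)
  qed
qed

lemma fubini_kernel: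
  fixes a :: "'a::euclidean_space \<Rightarrow> complex" and b :: "'b::euclidean_space \<Rightarrow> complex"
  assumes a: "integrable lborel a" and b: "integrable lborel b"
    and K [measurable]: "case_prod K \<in> borel_measurable (lborel \<Otimes>\<^sub>M lborel)"
    and K1: "\<And>x y. norm (K x y) \<le> 1"
  shows "(LINT y|lborel. b y * (LINT x|lborel. a x * K x y)) = (LINT x|lborel. a x * (LINT y|lborel. b y * K x y))"
proof -
  have [measurable]: "a \<in> borel_measurable borel" "b \<in> borel_measurable borel" using a b by auto
  have ab: "integrable (lborel \<Otimes>\<^sub>M lborel) (\<lambda>(x, y). a x * b y)"
    by (rule lborel_pair.Fubini_integrable) (use a b in \<open>auto simp: norm_mult\<close>)
  have "integrable (lborel \<Otimes>\<^sub>M lborel) (\<lambda>(x, y). a x * (b y * K x y))"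
  proof (rule Bochner_Integration.integrable_bound[OF ab])
    show "AE p in lborel \<Otimes>\<^sub>M lborel. norm (case p of (x, y) \<Rightarrow> a x * (b y * K x y)) \<le> norm (case p of (x, y) \<Rightarrow> a x * b y)"
      by (intro AE_I2) (auto simp: norm_mult intro!: mult_left_mono mult_left_le K1)
  qed measurable
  from lborel_pair.Fubini_integral[OF this]
  have "(LINT y|lborel. (LINT x|lborel. b y * (a x * K x y))) = (LINT x|lborel. (LINT y|lborel. a x * (b y * K x y)))"
    by (simp add: mult.left_commute)
  then show ?thesis by simp
qed

section \<open>Fourier inversion for square integrable functions\<close>

text \<open>
  The characteristic function of the standard normal distribution, rescaled so that the Gaussian is its
  own Fourier transform.
\<close>

lemma gaussian_fourier:
  "integrable lborel (\<lambda>s::real. exp (- pi * s\<^sup>2))"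
  "(LINT s|lborel. of_real (exp (- pi * s\<^sup>2)) * cis (2 * pi * t * s)) = complex_of_real (exp (- pi * t\<^sup>2))"
proof -
  define r where "r = sqrt (2 * pi)"
  have r: "r > 0" "r\<^sup>2 = 2 * pi" by (auto simp: r_def)
  have d: "std_normal_density (0 + r * s) = (1 / r) * exp (- pi * s\<^sup>2)" for s
    unfolding std_normal_density_def by (simp add: power_mult_distrib r) (simp add: r_def)
  have "integrable lborel (\<lambda>s. std_normal_density (0 + r * s))"
    using r by (intro lborel_integrable_real_affine) auto
  then have "integrable lborel (\<lambda>s. r * ((1 / r) * exp (- pi * s\<^sup>2)))" unfolding d by (rule integrable_mult_right)
  then show "integrable lborel (\<lambda>s::real. exp (- pi * s\<^sup>2))" using r by simp
  have "complex_of_real (exp (- pi * t\<^sup>2)) = char std_normal_distribution (r * t)"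
    unfolding char_std_normal_distribution by (simp add: power_mult_distrib r)
  also have "\<dots> = (LINT x|lborel. std_normal_density x *\<^sub>R iexp (r * t * x))"
    unfolding char_def by (subst integral_density) auto
  also have "\<dots> = r *\<^sub>R (LINT s|lborel. std_normal_density (0 + r * s) *\<^sub>R iexp (r * t * (0 + r * s)))"
    using r by (subst lborel_integral_real_affine[where c = r and t = 0]) auto
  also have "\<dots> = r *\<^sub>R (LINT s|lborel. (1 / r) *\<^sub>R (of_real (exp (- pi * s\<^sup>2)) * cis (2 * pi * t * s)))"
  proof (intro arg_cong[where f = "(*\<^sub>R) r"] Bochner_Integration.integral_cong refl)
    fix s :: real
    have "r * t * (0 + r * s) = 2 * pi * t * s" using r(2) by (simp add: power2_eq_square algebra_simps)
    then show "std_normal_density (0 + r * s) *\<^sub>R iexp (r * t * (0 + r * s)) = (1 / r) *\<^sub>R (of_real (exp (- pi * s\<^sup>2)) * cis (2 * pi * t * s))"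
      unfolding d by (simp only: cis_conv_exp) (simp add: scaleR_conv_of_real)
  qed
  also have "\<dots> = (LINT s|lborel. of_real (exp (- pi * s\<^sup>2)) * cis (2 * pi * t * s))" using r by simp
  finally show "(LINT s|lborel. of_real (exp (- pi * s\<^sup>2)) * cis (2 * pi * t * s)) = complex_of_real (exp (- pi * t\<^sup>2))" ..
qed

text \<open>
  If the transform vanishes, the positive and the negative part of \<open>r\<close> have the same mass and, once
  normalized, the same characteristic function. Levy's theorem makes them equal.
\<close>

lemma fourier_injective_real:
  fixes r :: "real \<Rightarrow> real"
  assumes r: "integrable lborel r" and z: "\<And>t. (LINT s|lborel. r s *\<^sub>R iexp (t * s)) = 0"
  shows "AE s in lborel. r s = 0"
proof -
  have [measurable]: "r \<in> borel_measurable borel" using r by auto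
  define p where "p s = max 0 (r s)" for s
  define n where "n s = max 0 (- r s)" for s
  have pn: "r s = p s - n s" "p s \<ge> 0" "n s \<ge> 0" for s by (auto simp: p_def n_def)
  have ip: "integrable lborel p" and inn: "integrable lborel n"
    unfolding p_def n_def using r by auto
  have ie: "integrable lborel (\<lambda>s. f s *\<^sub>R iexp (t * s))" if "integrable lborel f" for f :: "real \<Rightarrow> real" and t
    by (rule Bochner_Integration.integrable_bound[OF that]) (use that in \<open>auto simp: norm_mult\<close>)
  have eq: "(LINT s|lborel. p s *\<^sub>R iexp (t * s)) = (LINT s|lborel. n s *\<^sub>R iexp (t * s))" for t
    using z[of t] ie[OF ip, of t] ie[OF inn, of t] by (simp add: pn(1) scaleR_diff_left del: scaleR_conv_of_real)
  define c where "c = (LINT s|lborel. p s)"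
  have cn: "(LINT s|lborel. n s) = c"
  proof -
    have "complex_of_real (LINT s|lborel. p s) = complex_of_real (LINT s|lborel. n s)"
      using eq[of 0] by (simp add: scaleR_conv_of_real)
    then show ?thesis by (simp add: c_def)
  qed
  have "c \<ge> 0" unfolding c_def by (intro integral_nonneg_AE) (auto simp: pn)
  show ?thesis
  proof (cases "c = 0")
    case True
    then have "AE s in lborel. p s = 0" "AE s in lborel. n s = 0"
      using integral_nonneg_eq_0_iff_AE[OF ip] integral_nonneg_eq_0_iff_AE[OF inn] pn cn by (auto simp: c_def)
    then show ?thesis by eventually_elim (simp add: pn(1))
  next
    case False
    with \<open>c \<ge> 0\<close> have c: "c > 0" by simp
    define D where "D f = density lborel (\<lambda>s. ennreal (f s / c))" for f :: "real \<Rightarrow> real"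
    have rd: "real_distribution (D f)" and ch: "char (D f) t = (LINT s|lborel. f s *\<^sub>R iexp (t * s)) /\<^sub>R c"
      if f: "integrable lborel f" "\<And>s. f s \<ge> 0" "(LINT s|lborel. f s) = c" for f t
    proof -
      have [measurable]: "f \<in> borel_measurable borel" using f by auto
      have "emeasure (D f) (space (D f)) = (\<integral>\<^sup>+s. ennreal (f s / c) \<partial>lborel)"
        unfolding D_def by (subst emeasure_density) auto
      also have "\<dots> = ennreal (LINT s|lborel. f s / c)"
        using f c by (intro nn_integral_eq_integral) auto
      also have "\<dots> = 1" using f c by simp
      finally have "prob_space (D f)" by (rule prob_spaceI)
      then show "real_distribution (D f)"
        unfolding real_distribution_def real_distribution_axioms_def by (simp add: D_def)
      have "char (D f) t = (LINT s|lborel. (f s / c) *\<^sub>R iexp (t * s))"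
        unfolding char_def D_def by (rule integral_density) (use f c in auto)
      also have "\<dots> = (LINT s|lborel. inverse c *\<^sub>R (f s *\<^sub>R iexp (t * s)))"
        by (simp add: divide_inverse mult.commute)
      also have "\<dots> = (LINT s|lborel. f s *\<^sub>R iexp (t * s)) /\<^sub>R c"
        by (rule integral_scaleR_right)
      finally show "char (D f) t = (LINT s|lborel. f s *\<^sub>R iexp (t * s)) /\<^sub>R c" .
    qed
    have "D p = D n"
    proof (rule Levy_uniqueness)
      show "real_distribution (D p)" "real_distribution (D n)"
        using rd[OF ip] rd[OF inn] pn cn by (auto simp: c_def)
      show "char (D p) = char (D n)"
        using ch[OF ip] ch[OF inn] pn cn eq by (auto simp: c_def fun_eq_iff)
    qed
    then have "AE s in lborel. ennreal (p s / c) = ennreal (n s / c)"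
      unfolding D_def using ip inn
      by (subst (asm) sigma_finite_measure.density_unique_iff[OF lborel.sigma_finite_measure_axioms]) auto
    then show ?thesis
    proof eventually_elim
      case (elim s)
      then have "p s / c = n s / c" using pn c by (subst (asm) ennreal_inj) auto
      then show ?case using c by (simp add: pn(1))
    qed
  qed
qed

text \<open>
  If the transform of \<open>q\<close> vanishes at every frequency, so does that of \<open>cnj q\<close>; this reduces the claim to
  the real and imaginary parts.
\<close>

lemma fourier_injective:
  fixes q :: "real \<Rightarrow> complex"
  assumes q: "integrable lborel q" and z: "\<And>t. (LINT s|lborel. q s * cis (2 * pi * t * s)) = 0"
  shows "AE s in lborel. q s = 0"
proof -
  have [measurable]: "q \<in> borel_measurable borel" using q by auto
  have z1: "(LINT s|lborel. q s * iexp (t * s)) = 0" for t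
    using z[of "t / (2 * pi)"] by (simp add: cis_conv_exp)
  have z2: "(LINT s|lborel. cnj (q s) * iexp (t * s)) = 0" for t
  proof -
    have "(LINT s|lborel. cnj (q s) * iexp (t * s)) = (LINT s|lborel. cnj (q s * iexp (- t * s)))"
      by (intro Bochner_Integration.integral_cong refl) (simp add: exp_cnj)
    also have "\<dots> = 0" using z1[of "-t"] by (subst Bochner_Integration.integral_cnj) simp
    finally show ?thesis .
  qed
  have ie: "integrable lborel (\<lambda>s. q s * iexp (t * s))" "integrable lborel (\<lambda>s. cnj (q s) * iexp (t * s))" for t
    by (rule Bochner_Integration.integrable_bound[OF q]; use q in \<open>auto simp: norm_mult\<close>)+
  have "AE s in lborel. Re (q s) = 0"
  proof (rule fourier_injective_real)
    have "(LINT s|lborel. Re (q s) *\<^sub>R iexp (t * s)) =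
       (LINT s|lborel. (1/2) * (q s * iexp (t * s) + cnj (q s) * iexp (t * s)))" for t
      by (intro Bochner_Integration.integral_cong refl)
         (simp add: scaleR_conv_of_real complex_add_cnj[symmetric] distrib_right[symmetric] del: complex_add_cnj, simp add: complex_add_cnj)
    also have "\<dots> t = 0" for t using ie z1 z2 by simp
    finally show "(LINT s|lborel. Re (q s) *\<^sub>R iexp (t * s)) = 0" for t .
  qed (use q in auto)
  moreover have "AE s in lborel. Im (q s) = 0"
  proof (rule fourier_injective_real)
    have Im_eq: "complex_of_real (Im w) = (- \<i> / 2) * (w - cnj w)" for w by (simp add: complex_eq_iff)
    have "(LINT s|lborel. Im (q s) *\<^sub>R iexp (t * s)) =
       (LINT s|lborel. (- \<i> / 2) * (q s * iexp (t * s) - cnj (q s) * iexp (t * s)))" for t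
      by (intro Bochner_Integration.integral_cong refl) (simp only: scaleR_conv_of_real Im_eq left_diff_distrib mult.assoc)
    also have "\<dots> t = 0" for t using ie z1 z2 by simp
    finally show "(LINT s|lborel. Im (q s) *\<^sub>R iexp (t * s)) = 0" for t .
  qed (use q in auto)
  ultimately show ?thesis by eventually_elim (simp add: complex_eq_iff)
qed

lemma l2_cauchy_schwarz:
  assumes f: "sq_int M f" and g: "sq_int M g"
  shows "(norm (LINT x|M. f x * g x))\<^sup>2 \<le> (LINT x|M. (norm (f x))\<^sup>2) * (LINT x|M. (norm (g x))\<^sup>2)"
proof -
  define c where "c = (LINT x|M. (norm (g x))\<^sup>2)"
  have "c \<ge> 0" unfolding c_def by (intro integral_nonneg_AE) auto
  show ?thesis
  proof (cases "c = 0")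
    case True
    then have "AE x in M. (norm (g x))\<^sup>2 = 0"
      unfolding c_def using sq_int_integrable[OF g] by (subst (asm) integral_nonneg_eq_0_iff_AE) auto
    then have "(LINT x|M. f x * g x) = 0" by (intro integral_eq_zero_AE) auto
    then show ?thesis using True by (simp add: c_def)
  next
    case False
    with \<open>c \<ge> 0\<close> have c: "c > 0" by simp
    define e where "e x = complex_of_real (1 / sqrt c) * cnj (g x)" for x
    have "(LINT x|M. e x * cnj (e x)) = (LINT x|M. complex_of_real ((norm (g x))\<^sup>2) / of_real c)"
      using c by (intro Bochner_Integration.integral_cong refl)
        (simp add: e_def complex_norm_square mult_ac of_real_mult[symmetric] del: of_real_mult of_real_power)
    also have "\<dots> = 1"
      using c unfolding integral_divide_zero integral_complex_of_real by (simp add: c_def[symmetric])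
    finally have e1: "(LINT x|M. e x * cnj (e x)) = 1" .
    have "sq_int M e" unfolding e_def[abs_def] by (intro sq_int_cmult sq_int_cnj g)
    with e1 have "orthonormal_on M (\<lambda>_::unit. e) {()}" by (simp add: orthonormal_on_def)
    from bessel_inequality[OF this _ order_refl f]
    have "(norm (LINT x|M. f x * cnj (e x)))\<^sup>2 \<le> (LINT x|M. (norm (f x))\<^sup>2)" by simp
    moreover have "(LINT x|M. f x * cnj (e x)) = complex_of_real (1 / sqrt c) * (LINT x|M. f x * g x)"
      unfolding integral_mult_right_zero[symmetric] by (intro Bochner_Integration.integral_cong refl) (simp add: e_def)
    ultimately have "(norm (LINT x|M. f x * g x))\<^sup>2 / c \<le> (LINT x|M. (norm (f x))\<^sup>2)"
      using c by (simp add: norm_mult norm_divide power_divide power_mult_distrib)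
    then show ?thesis using c by (simp add: pos_divide_le_eq c_def[symmetric])
  qed
qed

lemma tendsto_integral_L2:
  fixes f :: "nat \<Rightarrow> 'a::euclidean_space \<Rightarrow> complex"
  assumes f: "\<And>n. square_integrable (f n)" "square_integrable g" "square_integrable \<psi>"
    and lim: "(\<lambda>n. l2norm (\<lambda>x. f n x - g x)) \<longlonglongrightarrow> 0"
  shows "(\<lambda>n. LINT x|lebesgue. f n x * \<psi> x) \<longlonglongrightarrow> (LINT x|lebesgue. g x * \<psi> x)"
proof (rule Lim_null_comparison[THEN Lim_null[THEN iffD2]])
  note sq = f[unfolded square_integrable_iff_sq_int]
  show "\<forall>\<^sub>F n in sequentially. norm ((LINT x|lebesgue. f n x * \<psi> x) - (LINT x|lebesgue. g x * \<psi> x)) \<le>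
     l2norm (\<lambda>x. f n x - g x) * l2norm \<psi>"
  proof (intro always_eventually allI)
    fix n
    have "(LINT x|lebesgue. f n x * \<psi> x) - (LINT x|lebesgue. g x * \<psi> x) = (LINT x|lebesgue. (f n x - g x) * \<psi> x)"
      using integrable_mult_sq_int[OF sq(1) sq(3)] integrable_mult_sq_int[OF sq(2) sq(3)] by (simp add: algebra_simps)
    moreover have "(norm (LINT x|lebesgue. (f n x - g x) * \<psi> x))\<^sup>2 \<le> (l2norm (\<lambda>x. f n x - g x) * l2norm \<psi>)\<^sup>2"
      using l2_cauchy_schwarz[OF sq_int_diff[OF sq(1) sq(2)] sq(3)]
      unfolding l2norm_def power_mult_distrib by (simp add: integral_nonneg_AE)
    ultimately show "norm ((LINT x|lebesgue. f n x * \<psi> x) - (LINT x|lebesgue. g x * \<psi> x)) \<le> l2norm (\<lambda>x. f n x - g x) * l2norm \<psi>"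
      by (simp only:) (rule power2_le_imp_le, auto simp: l2norm_def intro!: mult_nonneg_nonneg integral_nonneg_AE)
  qed
  show "(\<lambda>n. l2norm (\<lambda>x. f n x - g x) * l2norm \<psi>) \<longlonglongrightarrow> 0"
    using tendsto_mult_left_zero[OF lim] .
qed

definition inverse_fourier :: "(real \<Rightarrow> complex) \<Rightarrow> real \<Rightarrow> complex" where
  "inverse_fourier G s = (LINT \<gamma>|lborel. G \<gamma> * cis (2 * pi * \<gamma> * s))"

lemma measurable_cis [measurable (raw)]: "f \<in> borel_measurable M \<Longrightarrow> (\<lambda>x. cis (f x)) \<in> borel_measurable M"
  by (rule borel_measurable_continuous_on[of cis]) (auto intro!: continuous_intros)

lemma inverse_fourier_measurable [measurable]:
  assumes [measurable]: "G \<in> borel_measurable borel" shows "inverse_fourier G \<in> borel_measurable borel"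
  unfolding inverse_fourier_def[abs_def] by measurable

lemma norm_inverse_fourier_le: "norm (inverse_fourier G s) \<le> (LINT \<gamma>|lborel. norm (G \<gamma>))"
  unfolding inverse_fourier_def
  by (rule order_trans[OF integral_norm_bound]) (simp add: norm_mult)

text \<open>
  Test both sides against Gaussians. Let \<open>\<phi> a\<close> be the Gaussian centred at \<open>a\<close> and \<open>\<psi> a\<close> its transform. Each
  transform is the inverse of the other, explicitly. For the integrable functions \<open>h n\<close> that
  approximate \<open>g\<close>, Fubini's theorem gives \<open>\<integral> h n \<psi> = \<integral> fourier (h n) \<phi>\<close>, and in the limit \<open>\<integral> g \<psi> = \<integral> G \<phi>\<close>. The inverse
  transform of \<open>G\<close> satisfies the same identity, again by Fubini. Hence the difference of \<open>g\<close> and this inverse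
  transform, multiplied by a Gaussian, is an integrable function whose transform is zero.
\<close>

lemma fourier_L2_inversion:
  assumes F: "is_fourier_L2 g G" and G': "integrable lborel G'" "AE \<gamma> in lborel. G \<gamma> = G' \<gamma>"
  shows "AE s in lborel. g s = inverse_fourier G' s"
proof -
  have [measurable]: "G' \<in> borel_measurable borel" using G' by auto
  have g: "square_integrable g" and G: "square_integrable G" using F by (auto simp: is_fourier_L2_def)
  obtain h where h: "\<And>n::nat. integrable lebesgue (h n)" "\<And>n. square_integrable (h n)" "\<And>n. square_integrable (fourier (h n))"
    and hg: "(\<lambda>n. l2norm (\<lambda>x. h n x - g x)) \<longlonglongrightarrow> 0"
    and hG: "(\<lambda>n. l2norm (\<lambda>\<gamma>. fourier (h n) \<gamma> - G \<gamma>)) \<longlonglongrightarrow> 0"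
    using F unfolding is_fourier_L2_def by blast
  obtain g' where [measurable]: "g' \<in> borel_measurable borel" and g': "AE x in lborel. g x = g' x"
    using g borel_representative unfolding square_integrable_def by blast
  have sg': "sq_int lborel g'" using sq_int_representative(1)[OF g _ g'] by simp
  define E where "E s = complex_of_real (exp (- pi * s\<^sup>2))" for s :: real
  have E_m [measurable]: "E \<in> borel_measurable borel" unfolding E_def[abs_def] by measurable
  have Ei: "integrable lborel E" unfolding E_def using gaussian_fourier(1) by simp
  have E1: "norm (E s) \<le> 1" for s by (simp add: E_def)
  have Esq: "sq_int lborel E"
    unfolding sq_int_def
  proof
    show "integrable lborel (\<lambda>s. (norm (E s))\<^sup>2)"
    proof (rule Bochner_Integration.integrable_bound[OF Ei])
      show "AE s in lborel. norm ((norm (E s))\<^sup>2) \<le> norm (E s)"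
        using E1 by (intro AE_I2) (simp add: power2_eq_square mult_left_le)
    qed measurable
  qed simp
  define \<phi> where "\<phi> a \<gamma> = E (\<gamma> - a)" for a \<gamma>
  define \<psi> where "\<psi> a s = E s * cis (2 * pi * (- a) * s)" for a s
  have \<phi>_m [measurable]: "\<phi> a \<in> borel_measurable borel" and \<psi>_m [measurable]: "\<psi> a \<in> borel_measurable borel" for a
    unfolding \<phi>_def[abs_def] \<psi>_def[abs_def] by measurable
  have \<psi>i: "integrable lborel (\<psi> a)" and \<psi>sq: "sq_int lborel (\<psi> a)" for a
  proof -
    show "integrable lborel (\<psi> a)"
      by (rule Bochner_Integration.integrable_bound[OF Ei]) (auto simp: \<psi>_def norm_mult)
    show "sq_int lborel (\<psi> a)"
      by (rule sq_int_bound[OF Esq, where C = 1]) (auto simp: \<psi>_def norm_mult)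
  qed
  have \<phi>i: "integrable lborel (\<phi> a)" and \<phi>sq: "sq_int lborel (\<phi> a)" for a
    using lborel_integrable_real_affine[OF Ei, of 1 "-a"]
      lborel_integrable_real_affine[OF sq_int_integrable[OF Esq], of 1 "-a"]
    by (simp_all add: \<phi>_def[abs_def] sq_int_def)
  have \<phi>_hat: "(LINT \<gamma>|lborel. \<phi> a \<gamma> * cis (- 2 * pi * \<gamma> * s)) = \<psi> a s" for a s
  proof -
    have "(LINT \<gamma>|lborel. \<phi> a \<gamma> * cis (- 2 * pi * \<gamma> * s)) = (LINT x|lborel. \<phi> a (a + 1 * x) * cis (- 2 * pi * (a + 1 * x) * s))"
      by (subst lborel_integral_real_affine[where c = 1 and t = a]) auto
    also have "\<dots> = (LINT x|lborel. cis (2 * pi * (- a) * s) * (E x * cis (2 * pi * (- s) * x)))"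
    proof (intro Bochner_Integration.integral_cong refl)
      fix x
      have "cis (- 2 * pi * (a + 1 * x) * s) = cis (2 * pi * (- a) * s) * cis (2 * pi * (- s) * x)"
        unfolding cis_mult by (rule arg_cong[where f = cis]) (simp add: algebra_simps)
      then show "\<phi> a (a + 1 * x) * cis (- 2 * pi * (a + 1 * x) * s) =
          cis (2 * pi * (- a) * s) * (E x * cis (2 * pi * (- s) * x))"
        by (simp only:) (simp add: \<phi>_def mult_ac)
    qed
    also have "\<dots> = \<psi> a s"
      using gaussian_fourier(2)[of "- s"] by (simp add: E_def \<psi>_def mult.commute)
    finally show ?thesis .
  qed
  have \<psi>_check: "(LINT s|lborel. \<psi> a s * cis (2 * pi * \<gamma> * s)) = \<phi> a \<gamma>" for a \<gamma>
  proof -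
    have "(LINT s|lborel. \<psi> a s * cis (2 * pi * \<gamma> * s)) = (LINT s|lborel. E s * cis (2 * pi * (\<gamma> - a) * s))"
      by (intro Bochner_Integration.integral_cong refl) (simp add: \<psi>_def mult.assoc cis_mult, simp add: algebra_simps)
    then show ?thesis using gaussian_fourier(2)[of "\<gamma> - a"] by (simp add: E_def \<phi>_def)
  qed
  have sq_leb: "square_integrable f" if "sq_int lborel f" for f :: "real \<Rightarrow> complex"
  proof -
    have "f \<in> borel_measurable borel" using that by (auto simp: sq_int_def)
    then show ?thesis using that integrable_lebesgue_representative[of "\<lambda>x. (norm (f x))\<^sup>2" "\<lambda>x. (norm (f x))\<^sup>2"]
      by (auto simp: square_integrable_def sq_int_def intro: measurable_completion)
  qed
  have mult: "(LINT s|lebesgue. h n s * \<psi> a s) = (LINT \<gamma>|lebesgue. fourier (h n) \<gamma> * \<phi> a \<gamma>)" for n a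
  proof -
    have "h n \<in> borel_measurable lebesgue" using h(1) by auto
    then obtain h' where [measurable]: "h' \<in> borel_measurable borel" and h': "AE x in lborel. h n x = h' x"
      by (rule borel_representative)
    have h'i: "integrable lborel h'" using integrable_lebesgue_representative[OF _ h'] h(1) by simp
    have ft: "fourier (h n) \<gamma> = (LINT x|lborel. h' x * cis (- 2 * pi * \<gamma> * x))" for \<gamma>
      unfolding fourier_def by (rule lebesgue_integral_representative) (use h' in \<open>auto elim: eventually_mono\<close>)
    have "(LINT s|lebesgue. h n s * \<psi> a s) = (LINT s|lborel. h' s * \<psi> a s)"
      by (rule lebesgue_integral_representative) (use h' in \<open>auto elim: eventually_mono\<close>)
    also have "\<dots> = (LINT s|lborel. h' s * (LINT \<gamma>|lborel. \<phi> a \<gamma> * cis (- 2 * pi * \<gamma> * s)))"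
      unfolding \<phi>_hat ..
    also have "\<dots> = (LINT \<gamma>|lborel. \<phi> a \<gamma> * (LINT s|lborel. h' s * cis (- 2 * pi * \<gamma> * s)))"
      by (rule fubini_kernel[OF \<phi>i h'i]) auto
    also have "\<dots> = (LINT \<gamma>|lborel. fourier (h n) \<gamma> * \<phi> a \<gamma>)"
      unfolding ft by (simp add: mult.commute)
    also have "\<dots> = (LINT \<gamma>|lebesgue. fourier (h n) \<gamma> * \<phi> a \<gamma>)"
      unfolding ft by (rule lebesgue_integral_representative[symmetric]) auto
    finally show ?thesis .
  qed
  have key: "(LINT s|lborel. g' s * \<psi> a s) = (LINT \<gamma>|lborel. G' \<gamma> * \<phi> a \<gamma>)" for a
  proof -
    have "(\<lambda>n. LINT s|lebesgue. h n s * \<psi> a s) \<longlonglongrightarrow> (LINT s|lebesgue. g s * \<psi> a s)"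
      by (rule tendsto_integral_L2[OF h(2) g sq_leb[OF \<psi>sq] hg])
    moreover have "(\<lambda>n. LINT \<gamma>|lebesgue. fourier (h n) \<gamma> * \<phi> a \<gamma>) \<longlonglongrightarrow> (LINT \<gamma>|lebesgue. G \<gamma> * \<phi> a \<gamma>)"
      by (rule tendsto_integral_L2[OF h(3) G sq_leb[OF \<phi>sq] hG])
    ultimately have "(LINT s|lebesgue. g s * \<psi> a s) = (LINT \<gamma>|lebesgue. G \<gamma> * \<phi> a \<gamma>)"
      unfolding mult by (rule LIMSEQ_unique)
    moreover have "(LINT s|lebesgue. g s * \<psi> a s) = (LINT s|lborel. g' s * \<psi> a s)"
      by (rule lebesgue_integral_representative) (use g' in \<open>auto elim: eventually_mono\<close>)
    moreover have "(LINT \<gamma>|lebesgue. G \<gamma> * \<phi> a \<gamma>) = (LINT \<gamma>|lborel. G' \<gamma> * \<phi> a \<gamma>)"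
      by (rule lebesgue_integral_representative) (use G' in \<open>auto elim: eventually_mono\<close>)
    ultimately show ?thesis by simp
  qed
  have key': "(LINT s|lborel. inverse_fourier G' s * \<psi> a s) = (LINT \<gamma>|lborel. G' \<gamma> * \<phi> a \<gamma>)" for a
  proof -
    have "(LINT s|lborel. \<psi> a s * (LINT \<gamma>|lborel. G' \<gamma> * cis (2 * pi * \<gamma> * s))) =
          (LINT \<gamma>|lborel. G' \<gamma> * (LINT s|lborel. \<psi> a s * cis (2 * pi * \<gamma> * s)))"
      by (rule fubini_kernel[OF G'(1) \<psi>i]) auto
    then show ?thesis unfolding \<psi>_check inverse_fourier_def by (simp add: mult.commute)
  qed
  define q where "q s = (g' s - inverse_fourier G' s) * E s" for s
  have gE: "integrable lborel (\<lambda>s. g' s * E s)" by (rule integrable_mult_sq_int[OF sg' Esq])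
  have iE: "integrable lborel (\<lambda>s. inverse_fourier G' s * E s)"
    by (rule Bochner_Integration.integrable_bound[where f = "\<lambda>s. complex_of_real (LINT \<gamma>|lborel. norm (G' \<gamma>)) * E s"])
       (use Ei norm_inverse_fourier_le[of G'] in \<open>auto simp: norm_mult intro!: mult_right_mono order_trans[OF _ abs_ge_self]\<close>)
  have "AE s in lborel. q s = 0"
  proof (rule fourier_injective)
    show "integrable lborel q" unfolding q_def using gE iE by (simp add: left_diff_distrib)
    fix t
    have g\<psi>: "integrable lborel (\<lambda>s. g' s * \<psi> (- t) s)" by (rule integrable_mult_sq_int[OF sg' \<psi>sq])
    have i\<psi>: "integrable lborel (\<lambda>s. inverse_fourier G' s * \<psi> (- t) s)"
      by (rule Bochner_Integration.integrable_bound[OF iE]) (auto simp: \<psi>_def norm_mult)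
    have "(LINT s|lborel. q s * cis (2 * pi * t * s)) = (LINT s|lborel. g' s * \<psi> (- t) s - inverse_fourier G' s * \<psi> (- t) s)"
      by (intro Bochner_Integration.integral_cong refl) (simp add: q_def \<psi>_def algebra_simps)
    also have "\<dots> = 0" using g\<psi> i\<psi> key key' by simp
    finally show "(LINT s|lborel. q s * cis (2 * pi * t * s)) = 0" .
  qed
  with g' show ?thesis by eventually_elim (simp add: q_def E_def)
qed

section \<open>Samples of the transform at perturbed lattice points\<close>

definition cube_hat :: "('a::euclidean_space \<Rightarrow> complex) \<Rightarrow> 'a \<Rightarrow> complex" where
  "cube_hat f \<xi> = (LINT x|cube_measure. f x * cnj (harmonic \<xi> x))"

text \<open>
  Up to the factor \<open>(- 2 \<pi> i)\<^sup>n / n!\<close> this is the \<open>n\<close>-th Taylor coefficient at \<open>\<gamma> = 0\<close> of \<open>cube_hat f (k + \<gamma> u)\<close>.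
\<close>

definition moment :: "('a::euclidean_space \<Rightarrow> complex) \<Rightarrow> nat \<Rightarrow> 'a \<Rightarrow> 'a \<Rightarrow> complex" where
  "moment f n k u = (LINT x|cube_measure. f x * of_real (u \<bullet> x) ^ n * cnj (harmonic k x))"

abbreviation (input) cube_energy :: "('a::euclidean_space \<Rightarrow> complex) \<Rightarrow> real" where
  "cube_energy f \<equiv> (LINT x|cube_measure. (norm (f x))\<^sup>2)"

text \<open>
  Half the diagonal of the cube, the only place where the dimension enters the estimates.
\<close>

definition cube_radius :: "'a::euclidean_space itself \<Rightarrow> real" where
  "cube_radius _ = sqrt (real DIM('a)) / 2"

lemma norm_le_cube_radius:
  fixes x :: "'a::euclidean_space"
  assumes "x \<in> cube" shows "norm x \<le> cube_radius TYPE('a)"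
proof (rule power2_le_imp_le)
  have "(norm x)\<^sup>2 = (\<Sum>b\<in>Basis. (x \<bullet> b)\<^sup>2)"
    unfolding power2_norm_eq_inner by (subst euclidean_inner) (simp add: power2_eq_square)
  also have "\<dots> \<le> (\<Sum>b\<in>(Basis::'a set). (1/2)\<^sup>2)"
  proof (rule sum_mono)
    fix b :: 'a assume "b \<in> Basis"
    then have "\<bar>x \<bullet> b\<bar> \<le> \<bar>1/2\<bar>" using assms by (simp add: cube_def)
    then show "(x \<bullet> b)\<^sup>2 \<le> (1/2)\<^sup>2" by (simp only: abs_le_square_iff)
  qed
  also have "\<dots> = (cube_radius TYPE('a))\<^sup>2" by (simp add: cube_radius_def power_divide)
  finally show "(norm x)\<^sup>2 \<le> (cube_radius TYPE('a))\<^sup>2" .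
qed (simp add: cube_radius_def)

lemma cube_radius_nonneg [simp]: "cube_radius TYPE('a::euclidean_space) \<ge> 0"
  by (simp add: cube_radius_def)

lemma inner_le_cube_radius:
  fixes x u :: "'a::euclidean_space"
  assumes "x \<in> cube" "norm u \<le> 1" shows "\<bar>u \<bullet> x\<bar> \<le> cube_radius TYPE('a)"
proof -
  have "\<bar>u \<bullet> x\<bar> \<le> norm u * norm x" by (rule Cauchy_Schwarz_ineq2)
  also have "\<dots> \<le> 1 * cube_radius TYPE('a)" using assms norm_le_cube_radius by (intro mult_mono) auto
  finally show ?thesis by simp
qed

lemma cube_energy_nonneg: "cube_energy f \<ge> 0"
  by (intro integral_nonneg_AE) auto

lemma sq_int_moment:
  fixes f :: "'a::euclidean_space \<Rightarrow> complex"
  assumes f: "sq_int cube_measure f"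
  shows "sq_int cube_measure (\<lambda>x. f x * of_real (u \<bullet> x) ^ n)"
proof (rule sq_int_bound[OF f])
  show "(\<lambda>x. f x * of_real (u \<bullet> x) ^ n) \<in> borel_measurable cube_measure"
    using f by (auto simp: sq_int_def)
  show "AE x in cube_measure. norm (f x * of_real (u \<bullet> x) ^ n) \<le> (norm u * cube_radius TYPE('a)) ^ n * norm (f x)"
    unfolding AE_cube_measure
  proof (intro AE_I2 impI)
    fix x :: 'a assume x: "x \<in> cube"
    have "\<bar>u \<bullet> x\<bar> \<le> norm u * norm x" by (rule Cauchy_Schwarz_ineq2)
    also have "\<dots> \<le> norm u * cube_radius TYPE('a)" using norm_le_cube_radius[OF x] by (intro mult_left_mono) auto
    finally show "norm (f x * of_real (u \<bullet> x) ^ n) \<le> (norm u * cube_radius TYPE('a)) ^ n * norm (f x)"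
      by (auto simp: norm_mult norm_power mult.commute intro!: mult_left_mono power_mono)
  qed
qed

lemma integrable_mult_harmonic:
  assumes "sq_int cube_measure f" shows "integrable cube_measure (\<lambda>x. f x * cnj (harmonic k x))"
proof (rule integrable_mult_sq_int[OF assms])
  show "sq_int cube_measure (\<lambda>x. cnj (harmonic k x))"
    by (rule cube.sq_int_bounded[where B = 1]) auto
qed

lemma moment_Suc:
  fixes f :: "'a::euclidean_space \<Rightarrow> complex"
  assumes f: "sq_int cube_measure f"
  shows "moment f (Suc n) k u = (\<Sum>b\<in>Basis. of_real (u \<bullet> b) * moment (\<lambda>x. f x * of_real (x \<bullet> b)) n k u)"
proof -
  have sb: "sq_int cube_measure (\<lambda>x. f x * of_real (x \<bullet> b))" for b
    using sq_int_moment[OF f, of b 1] by (simp add: inner_commute)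
  have "moment f (Suc n) k u = (LINT x|cube_measure. (\<Sum>b\<in>Basis. of_real (u \<bullet> b) *
          ((f x * of_real (x \<bullet> b)) * of_real (u \<bullet> x) ^ n * cnj (harmonic k x))))"
    unfolding moment_def
  proof (intro Bochner_Integration.integral_cong refl)
    fix x :: 'a
    have "complex_of_real (u \<bullet> x) = (\<Sum>b\<in>Basis. of_real (u \<bullet> b) * of_real (x \<bullet> b))"
      using arg_cong[OF euclidean_inner[of u x], of complex_of_real] by simp
    then have "f x * of_real (u \<bullet> x) ^ Suc n * cnj (harmonic k x) =
       f x * ((\<Sum>b\<in>Basis. of_real (u \<bullet> b) * of_real (x \<bullet> b)) * of_real (u \<bullet> x) ^ n) * cnj (harmonic k x)"
      by (simp only: power_Suc)
    also have "\<dots> = (\<Sum>b\<in>Basis. of_real (u \<bullet> b) *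
          ((f x * of_real (x \<bullet> b)) * of_real (u \<bullet> x) ^ n * cnj (harmonic k x)))"
      by (simp only: sum_distrib_left sum_distrib_right mult_ac)
    finally show "f x * of_real (u \<bullet> x) ^ Suc n * cnj (harmonic k x) = (\<Sum>b\<in>Basis. of_real (u \<bullet> b) *
          ((f x * of_real (x \<bullet> b)) * of_real (u \<bullet> x) ^ n * cnj (harmonic k x)))" .
  qed
  also have "\<dots> = (\<Sum>b\<in>Basis. of_real (u \<bullet> b) * moment (\<lambda>x. f x * of_real (x \<bullet> b)) n k u)"
    unfolding moment_def
    by (subst Bochner_Integration.integral_sum)
       (auto intro!: integrable_mult_right integrable_mult_harmonic sq_int_moment sb)
  finally show ?thesis .
qed

text \<open>
  The direction \<open>u k\<close> varies with \<open>k\<close>, so a moment is not a single Fourier coefficient of a fixed function.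
  Splitting off one factor \<open>u k \<bullet> x = (\<Sum>b. (u k \<bullet> b) (x \<bullet> b))\<close> moves the dependence on \<open>k\<close> into scalars of square sum
  at most \<open>1\<close>. This trades the moment of order \<open>n + 1\<close> of \<open>f\<close> for moments of order \<open>n\<close> of the functions
  \<open>(x \<bullet> b) f\<close>, whose energies add up to that of \<open>|x| f\<close>. The induction ends with Bessel's inequality.
\<close>

lemma moment_bound:
  fixes f :: "'a::euclidean_space \<Rightarrow> complex"
  assumes S: "finite S" "S \<subseteq> lattice" and u: "\<And>k. k \<in> S \<Longrightarrow> norm (u k) \<le> 1"
    and f: "sq_int cube_measure f"
  shows "(\<Sum>k\<in>S. (norm (moment f n k (u k)))\<^sup>2) \<le> (cube_radius TYPE('a)) ^ (2 * n) * cube_energy f"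
  using f
proof (induction n arbitrary: f)
  case 0
  then show ?case using bessel_inequality[OF orthonormal_harmonic S 0] by (simp add: moment_def)
next
  case (Suc n)
  let ?f = "\<lambda>b x. f x * complex_of_real (x \<bullet> b)"
  let ?\<rho> = "cube_radius TYPE('a)"
  have sb: "sq_int cube_measure (?f b)" for b
    using sq_int_moment[OF Suc.prems, of b 1] by (simp add: inner_commute)
  have 1: "(norm (moment f (Suc n) k (u k)))\<^sup>2 \<le> (\<Sum>b\<in>Basis. (norm (moment (?f b) n k (u k)))\<^sup>2)" if "k \<in> S" for k
  proof -
    have "norm (moment f (Suc n) k (u k)) \<le> (\<Sum>b\<in>Basis. \<bar>u k \<bullet> b\<bar> * norm (moment (?f b) n k (u k)))"
      unfolding moment_Suc[OF Suc.prems] by (rule order_trans[OF norm_sum]) (simp add: norm_mult)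
    then have "(norm (moment f (Suc n) k (u k)))\<^sup>2 \<le> (\<Sum>b\<in>Basis. \<bar>u k \<bullet> b\<bar> * norm (moment (?f b) n k (u k)))\<^sup>2"
      by (rule power_mono) auto
    also have "\<dots> \<le> (\<Sum>b\<in>Basis. \<bar>u k \<bullet> b\<bar>\<^sup>2) * (\<Sum>b\<in>Basis. (norm (moment (?f b) n k (u k)))\<^sup>2)"
      by (rule Cauchy_Schwarz_ineq_sum)
    also have "(\<Sum>b\<in>Basis. \<bar>u k \<bullet> b\<bar>\<^sup>2) = (norm (u k))\<^sup>2"
      unfolding power2_norm_eq_inner by (subst euclidean_inner) (simp add: power2_eq_square)
    also have "(norm (u k))\<^sup>2 * (\<Sum>b\<in>Basis. (norm (moment (?f b) n k (u k)))\<^sup>2) \<le> 1 * (\<Sum>b\<in>Basis. (norm (moment (?f b) n k (u k)))\<^sup>2)"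
      using u[OF that] by (intro mult_right_mono sum_nonneg) (auto simp: power_le_one)
    finally show ?thesis by simp
  qed
  have "(\<Sum>k\<in>S. (norm (moment f (Suc n) k (u k)))\<^sup>2) \<le> (\<Sum>k\<in>S. \<Sum>b\<in>Basis. (norm (moment (?f b) n k (u k)))\<^sup>2)"
    by (rule sum_mono) (rule 1)
  also have "\<dots> = (\<Sum>b\<in>Basis. \<Sum>k\<in>S. (norm (moment (?f b) n k (u k)))\<^sup>2)"
    by (rule sum.swap)
  also have "\<dots> \<le> (\<Sum>b\<in>Basis. ?\<rho> ^ (2 * n) * cube_energy (?f b))"
    by (rule sum_mono) (rule Suc.IH[OF sb])
  also have "\<dots> = ?\<rho> ^ (2 * n) * (LINT x|cube_measure. (\<Sum>b\<in>Basis. (norm (?f b x))\<^sup>2))"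
    by (subst Bochner_Integration.integral_sum) (auto intro: sq_int_integrable[OF sb] simp: sum_distrib_left)
  also have "\<dots> \<le> ?\<rho> ^ (2 * n) * (LINT x|cube_measure. ?\<rho>\<^sup>2 * (norm (f x))\<^sup>2)"
  proof (intro mult_left_mono integral_mono_AE)
    show "AE x in cube_measure. (\<Sum>b\<in>Basis. (norm (?f b x))\<^sup>2) \<le> ?\<rho>\<^sup>2 * (norm (f x))\<^sup>2"
      unfolding AE_cube_measure
    proof (intro AE_I2 impI)
      fix x :: 'a assume x: "x \<in> cube"
      have "(norm x)\<^sup>2 = (\<Sum>b\<in>Basis. (x \<bullet> b)\<^sup>2)"
        unfolding power2_norm_eq_inner by (subst euclidean_inner) (simp add: power2_eq_square)
      then have "(\<Sum>b\<in>Basis. (norm (?f b x))\<^sup>2) = (norm x)\<^sup>2 * (norm (f x))\<^sup>2"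
        by (simp add: norm_mult power_mult_distrib sum_distrib_left mult.commute)
      also have "\<dots> \<le> ?\<rho>\<^sup>2 * (norm (f x))\<^sup>2"
        using norm_le_cube_radius[OF x] by (intro mult_right_mono power_mono) auto
      finally show "(\<Sum>b\<in>Basis. (norm (?f b x))\<^sup>2) \<le> ?\<rho>\<^sup>2 * (norm (f x))\<^sup>2" .
    qed
  qed (use sq_int_integrable[OF sb] sq_int_integrable[OF Suc.prems] in auto)
  also have "\<dots> = ?\<rho> ^ (2 * Suc n) * cube_energy f" by (simp add: power2_eq_square mult_ac)
  finally show ?case .
qed

lemma cube_hat_series:
  fixes f :: "'a::euclidean_space \<Rightarrow> complex"
  assumes f: "sq_int cube_measure f" and u: "norm u \<le> 1"
  shows "(\<lambda>n. ((- 2 * pi * \<i>) ^ n / fact n * moment f n k u) * of_real \<gamma> ^ n) sums cube_hat f (k + \<gamma> *\<^sub>R u)"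
proof -
  let ?\<rho> = "cube_radius TYPE('a)"
  have [measurable]: "f \<in> borel_measurable borel" using f by (auto simp: sq_int_def)
  define c where "c n = ((- 2 * pi * \<i>) ^ n / fact n) * of_real \<gamma> ^ n" for n
  define s where "s N x = (\<Sum>n<N. c n * (f x * of_real (u \<bullet> x) ^ n * cnj (harmonic k x)))" for N x
  have int: "integrable cube_measure (\<lambda>x. f x * of_real (u \<bullet> x) ^ n * cnj (harmonic k x))" for n
    by (intro integrable_mult_harmonic sq_int_moment f)
  define z where "z x = - 2 * pi * \<i> * of_real \<gamma> * of_real (u \<bullet> x)" for x
  have zn: "z x ^ n = (- 2 * pi * \<i>) ^ n * of_real \<gamma> ^ n * of_real (u \<bullet> x) ^ n" for x n
    unfolding z_def power_mult_distrib[symmetric] ..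
  have s_eq: "s N x = f x * cnj (harmonic k x) * (\<Sum>n<N. z x ^ n /\<^sub>R fact n)" for N x
    unfolding s_def sum_distrib_left
    by (intro sum.cong refl) (simp only: c_def zn scaleR_conv_of_real of_real_inverse of_real_fact divide_inverse mult_ac)
  have expz: "(\<lambda>n. z x ^ n /\<^sub>R fact n) sums exp (z x)" for x by (rule exp_converges)
  have ez: "cnj (harmonic k x) * exp (z x) = cnj (harmonic (k + \<gamma> *\<^sub>R u) x)" for x
  proof -
    have "exp (z x) = cnj (harmonic (\<gamma> *\<^sub>R u) x)"
      unfolding harmonic_def cis_cnj by (simp add: cis_conv_exp z_def mult_ac)
    then show ?thesis by (simp add: harmonic_mult flip: complex_cnj_mult)
  qed
  have nz: "norm (z x) \<le> 2 * pi * \<bar>\<gamma>\<bar> * ?\<rho>" if "x \<in> cube" for x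
    using inner_le_cube_radius[OF that u] by (auto simp: z_def norm_mult intro!: mult_left_mono)
  have "(\<lambda>N. integral\<^sup>L cube_measure (s N)) \<longlonglongrightarrow> (LINT x|cube_measure. f x * cnj (harmonic (k + \<gamma> *\<^sub>R u) x))"
  proof (rule integral_dominated_convergence)
    show "integrable cube_measure (\<lambda>x. exp (2 * pi * \<bar>\<gamma>\<bar> * ?\<rho>) * norm (f x))"
      using cube.integrable_sq_int[OF f] by auto
    show "AE x in cube_measure. (\<lambda>N. s N x) \<longlonglongrightarrow> f x * cnj (harmonic (k + \<gamma> *\<^sub>R u) x)"
    proof (rule AE_I2)
      fix x
      have "(\<lambda>N. s N x) \<longlonglongrightarrow> f x * cnj (harmonic k x) * exp (z x)"
        unfolding s_eq using expz[of x] unfolding sums_def by (intro tendsto_intros)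
      then show "(\<lambda>N. s N x) \<longlonglongrightarrow> f x * cnj (harmonic (k + \<gamma> *\<^sub>R u) x)"
        by (simp only: mult.assoc ez)
    qed
    show "AE x in cube_measure. norm (s N x) \<le> exp (2 * pi * \<bar>\<gamma>\<bar> * ?\<rho>) * norm (f x)" for N
      unfolding AE_cube_measure
    proof (intro AE_I2 impI)
      fix x :: 'a assume x: "x \<in> cube"
      have "norm (\<Sum>n<N. z x ^ n /\<^sub>R fact n) \<le> (\<Sum>n<N. norm (z x) ^ n /\<^sub>R fact n)"
        by (rule order_trans[OF norm_sum]) (simp add: norm_power divide_inverse mult.commute)
      also have "\<dots> \<le> exp (norm (z x))"
        unfolding exp_def by (intro sum_le_suminf summable_exp_generic) auto
      also have "\<dots> \<le> exp (2 * pi * \<bar>\<gamma>\<bar> * ?\<rho>)" using nz[OF x] by simp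
      finally have "norm (\<Sum>n<N. z x ^ n /\<^sub>R fact n) \<le> exp (2 * pi * \<bar>\<gamma>\<bar> * ?\<rho>)" .
      then show "norm (s N x) \<le> exp (2 * pi * \<bar>\<gamma>\<bar> * ?\<rho>) * norm (f x)"
        unfolding s_eq by (simp add: norm_mult mult.commute mult_left_mono)
    qed
  qed (auto simp: s_def[abs_def])
  moreover have "integral\<^sup>L cube_measure (s N) = (\<Sum>n<N. c n * moment f n k u)" for N
    unfolding s_def[abs_def] moment_def by (subst Bochner_Integration.integral_sum) (auto intro: int)
  ultimately show ?thesis
    unfolding sums_def cube_hat_def c_def by (simp add: mult_ac)
qed

text \<open>
  The \<open>n\<close>-th Taylor coefficient of \<open>\<gamma> \<mapsto> (\<Sum>k\<in>S. cube_hat f (k + \<gamma> u k) b k)\<close>.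
\<close>

definition sampling_coeff ::
    "('a::euclidean_space \<Rightarrow> complex) \<Rightarrow> ('a \<Rightarrow> 'a) \<Rightarrow> 'a set \<Rightarrow> ('a \<Rightarrow> complex) \<Rightarrow> nat \<Rightarrow> complex" where
  "sampling_coeff f u S b n = (- 2 * pi * \<i>) ^ n / fact n * (\<Sum>k\<in>S. moment f n k (u k) * b k)"

lemma sampling_series:
  fixes f :: "'a::euclidean_space \<Rightarrow> complex"
  assumes f: "sq_int cube_measure f" and u: "\<And>k. k \<in> S \<Longrightarrow> norm (u k) \<le> 1"
  shows "(\<lambda>n. sampling_coeff f u S b n * of_real \<gamma> ^ n) sums (\<Sum>k\<in>S. cube_hat f (k + \<gamma> *\<^sub>R u k) * b k)"
proof -
  have "(\<lambda>n. \<Sum>k\<in>S. ((- 2 * pi * \<i>) ^ n / fact n * moment f n k (u k)) * of_real \<gamma> ^ n * b k) sums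
        (\<Sum>k\<in>S. cube_hat f (k + \<gamma> *\<^sub>R u k) * b k)"
    by (intro sums_sum sums_mult2 cube_hat_series f u)
  also have "(\<lambda>n. \<Sum>k\<in>S. ((- 2 * pi * \<i>) ^ n / fact n * moment f n k (u k)) * of_real \<gamma> ^ n * b k) =
       (\<lambda>n. sampling_coeff f u S b n * of_real \<gamma> ^ n)"
    by (simp add: sampling_coeff_def sum_distrib_left sum_distrib_right sum_divide_distrib mult_ac)
  finally show ?thesis .
qed

lemma norm_sampling_coeff_le:
  fixes f :: "'a::euclidean_space \<Rightarrow> complex"
  assumes S: "finite S" "S \<subseteq> lattice" and u: "\<And>k. k \<in> S \<Longrightarrow> norm (u k) \<le> 1"
    and f: "sq_int cube_measure f"
  shows "norm (sampling_coeff f u S b n) \<le>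
    (2 * pi * cube_radius TYPE('a)) ^ n / fact n * (sqrt (cube_energy f) * sqrt (\<Sum>k\<in>S. (norm (b k))\<^sup>2))"
proof -
  let ?\<rho> = "cube_radius TYPE('a)"
  have "norm (\<Sum>k\<in>S. moment f n k (u k) * b k) \<le> (\<Sum>k\<in>S. norm (moment f n k (u k)) * norm (b k))"
    by (rule order_trans[OF norm_sum]) (simp add: norm_mult)
  also have "\<dots> \<le> sqrt ((\<Sum>k\<in>S. (norm (moment f n k (u k)))\<^sup>2) * (\<Sum>k\<in>S. (norm (b k))\<^sup>2))"
    by (rule real_le_rsqrt) (rule Cauchy_Schwarz_ineq_sum)
  also have "\<dots> \<le> sqrt ((?\<rho> ^ (2 * n) * cube_energy f) * (\<Sum>k\<in>S. (norm (b k))\<^sup>2))"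
    by (intro real_sqrt_le_mono mult_right_mono moment_bound[OF S u f] sum_nonneg) auto
  also have "\<dots> = ?\<rho> ^ n * (sqrt (cube_energy f) * sqrt (\<Sum>k\<in>S. (norm (b k))\<^sup>2))"
    by (simp add: real_sqrt_mult power_mult mult.commute[of 2] power2_eq_square[symmetric] real_sqrt_power[symmetric]
        mult.assoc del: real_sqrt_power) 
  finally have "norm (\<Sum>k\<in>S. moment f n k (u k) * b k) \<le> ?\<rho> ^ n * (sqrt (cube_energy f) * sqrt (\<Sum>k\<in>S. (norm (b k))\<^sup>2))" .
  then have "(2 * pi) ^ n / fact n * norm (\<Sum>k\<in>S. moment f n k (u k) * b k) \<le>
      (2 * pi) ^ n / fact n * (?\<rho> ^ n * (sqrt (cube_energy f) * sqrt (\<Sum>k\<in>S. (norm (b k))\<^sup>2)))"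
    by (intro mult_left_mono) auto
  then show ?thesis
    by (simp add: sampling_coeff_def norm_mult norm_divide norm_power power_mult_distrib mult_ac)
qed

text \<open>
  Duality: with \<open>b = cnj (cube_hat f (k + \<gamma> u k))\<close> the power series sums to the left side \<open>T\<close>, while the bound on
  its coefficients gives \<open>T \<le> exp (c |\<gamma>|) ||f|| sqrt T\<close>.
\<close>

lemma sampling_upper_bound:
  fixes f :: "'a::euclidean_space \<Rightarrow> complex"
  assumes S: "finite S" "S \<subseteq> lattice" and u: "\<And>k. k \<in> S \<Longrightarrow> norm (u k) \<le> 1"
    and f: "sq_int cube_measure f"
  shows "(\<Sum>k\<in>S. (norm (cube_hat f (k + \<gamma> *\<^sub>R u k)))\<^sup>2) \<le>
     exp (2 * (2 * pi * cube_radius TYPE('a) * \<bar>\<gamma>\<bar>)) * cube_energy f"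
proof -
  let ?r = "2 * pi * cube_radius TYPE('a)"
  define b where "b k = cnj (cube_hat f (k + \<gamma> *\<^sub>R u k))" for k
  define T where "T = (\<Sum>k\<in>S. (norm (cube_hat f (k + \<gamma> *\<^sub>R u k)))\<^sup>2)"
  have T0: "T \<ge> 0" unfolding T_def by (intro sum_nonneg) auto
  have b2: "(\<Sum>k\<in>S. (norm (b k))\<^sup>2) = T" by (simp add: b_def T_def)
  have "(\<Sum>k\<in>S. cube_hat f (k + \<gamma> *\<^sub>R u k) * b k) = of_real T"
    by (simp add: b_def T_def complex_norm_square[symmetric] del: of_real_power)
  then have sT: "(\<lambda>n. sampling_coeff f u S b n * of_real \<gamma> ^ n) sums of_real T"
    using sampling_series[where S = S and u = u and \<gamma> = \<gamma> and b = b, OF f u] by simp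
  have "(\<lambda>n. (?r * \<bar>\<gamma>\<bar>) ^ n /\<^sub>R fact n * (sqrt (cube_energy f) * sqrt T)) sums
        (exp (?r * \<bar>\<gamma>\<bar>) * (sqrt (cube_energy f) * sqrt T))"
    by (intro sums_mult2 exp_converges)
  then have g: "summable (\<lambda>n. (?r * \<bar>\<gamma>\<bar>) ^ n /\<^sub>R fact n * (sqrt (cube_energy f) * sqrt T))"
    "(\<Sum>n. (?r * \<bar>\<gamma>\<bar>) ^ n /\<^sub>R fact n * (sqrt (cube_energy f) * sqrt T)) =
        exp (?r * \<bar>\<gamma>\<bar>) * (sqrt (cube_energy f) * sqrt T)"
    by (auto simp only: sums_iff)
  have "norm (sampling_coeff f u S b n * of_real \<gamma> ^ n) \<le> (?r * \<bar>\<gamma>\<bar>) ^ n /\<^sub>R fact n * (sqrt (cube_energy f) * sqrt T)" for n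
  proof -
    have "norm (sampling_coeff f u S b n) * \<bar>\<gamma>\<bar> ^ n \<le> (?r ^ n / fact n * (sqrt (cube_energy f) * sqrt T)) * \<bar>\<gamma>\<bar> ^ n"
      using norm_sampling_coeff_le[where S = S and u = u and b = b and n = n, OF S u f] unfolding b2 by (intro mult_right_mono) auto
    then show ?thesis by (simp add: norm_mult norm_power power_mult_distrib divide_inverse mult_ac)
  qed
  from norm_suminf_le[OF this g(1)]
  have "norm (complex_of_real T) \<le> exp (?r * \<bar>\<gamma>\<bar>) * (sqrt (cube_energy f) * sqrt T)"
    unfolding g(2) sums_unique[OF sT, symmetric] .
  then have le: "T \<le> exp (?r * \<bar>\<gamma>\<bar>) * sqrt (cube_energy f) * sqrt T" using T0 by (simp add: mult.assoc)
  show ?thesis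
  proof (cases "T = 0")
    case True
    then show ?thesis unfolding T_def[symmetric] using cube_energy_nonneg[of f] by simp
  next
    case False
    with T0 have "sqrt T > 0" by simp
    have "sqrt T * sqrt T \<le> exp (?r * \<bar>\<gamma>\<bar>) * sqrt (cube_energy f) * sqrt T" using le T0 by simp
    then have "sqrt T \<le> exp (?r * \<bar>\<gamma>\<bar>) * sqrt (cube_energy f)"
      using \<open>sqrt T > 0\<close> by (rule mult_right_le_imp_le)
    then have "(sqrt T)\<^sup>2 \<le> (exp (?r * \<bar>\<gamma>\<bar>) * sqrt (cube_energy f))\<^sup>2" using T0 by (intro power_mono) auto
    also have "(sqrt T)\<^sup>2 = T" using T0 by simp
    also have "(exp (?r * \<bar>\<gamma>\<bar>) * sqrt (cube_energy f))\<^sup>2 = exp (2 * (?r * \<bar>\<gamma>\<bar>)) * cube_energy f"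
      using cube_energy_nonneg[of f] unfolding power_mult_distrib exp_double by simp
    finally show ?thesis unfolding T_def .
  qed
qed

section \<open>Lower bounds for families of entire functions\<close>

lemma entire_power_series_bound:
  fixes a :: "nat \<Rightarrow> complex"
  assumes a: "\<And>n. norm (a n) \<le> r ^ n / fact n"
  shows "(\<lambda>n. a n * z ^ n) sums (\<Sum>n. a n * z ^ n)"
    and "norm (\<Sum>n. a n * z ^ n) \<le> exp (r * norm z)"
proof -
  have e: "(\<lambda>n. (r * norm z) ^ n /\<^sub>R fact n) sums exp (r * norm z)" by (rule exp_converges)
  have le: "norm (a n * z ^ n) \<le> (r * norm z) ^ n /\<^sub>R fact n" for n
    using mult_right_mono[OF a[of n], of "norm z ^ n"]
    by (simp add: norm_mult norm_power power_mult_distrib divide_inverse mult_ac)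
  show s: "(\<lambda>n. a n * z ^ n) sums (\<Sum>n. a n * z ^ n)"
    using summable_comparison_test'[OF sums_summable[OF e] le] by (rule summable_sums)
  have "norm (\<Sum>n. a n * z ^ n) \<le> (\<Sum>n. (r * norm z) ^ n /\<^sub>R fact n)"
    using e le by (intro norm_suminf_le) (auto simp: sums_iff)
  then show "norm (\<Sum>n. a n * z ^ n) \<le> exp (r * norm z)" using e by (simp add: sums_iff)
qed

lemma entire_nonzero_AE:
  assumes g: "g holomorphic_on UNIV" and nz: "g z \<noteq> 0"
  shows "AE \<gamma> in lborel. g (complex_of_real \<gamma>) \<noteq> 0"
proof -
  have "countable {z \<in> UNIV. g z = 0}"
  proof (cases "g constant_on UNIV")
    case True
    then have "{z \<in> UNIV. g z = 0} = {}" using nz by (auto simp: constant_on_def)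
    then show ?thesis by simp
  next
    case False
    then show ?thesis using g
      by (intro holomorphic_countable_zeros) auto
  qed
  then have "countable (Re ` {z. g z = 0})" by simp
  moreover have "complex_of_real -` {z. g z = 0} \<subseteq> Re ` {z. g z = 0}" by force
  ultimately have "countable (complex_of_real -` {z. g z = 0})" by (rule countable_subset[rotated])
  then have "complex_of_real -` {z. g z = 0} \<in> null_sets lborel"
    by (rule countable_imp_null_set_lborel)
  then have "AE \<gamma> in lborel. \<gamma> \<notin> complex_of_real -` {z. g z = 0}" by (rule AE_not_in)
  then show ?thesis by simp
qed

text \<open>
  If there were no such \<open>A\<close>, some members \<open>h m\<close> of the family would have integrals tending to zero. The
  coefficient bounds make the family locally bounded, so by Montel's theorem a subsequence converges locally
  uniformly to an entire function \<open>g\<close>. Then \<open>\<integral> w |g|\<^sup>2 = 0\<close> although \<open>|g 0| \<ge> 1/2\<close>. An entire function that is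
  not identically zero has only countably many zeros, so \<open>w\<close> would vanish almost everywhere.
\<close>

lemma entire_family_lower_bound:
  fixes w :: "real \<Rightarrow> real"
  assumes w: "integrable lborel w" "\<And>\<gamma>. w \<gamma> \<ge> 0" "\<not> (AE \<gamma> in lborel. w \<gamma> = 0)"
    and R: "\<And>\<gamma>. R < \<bar>\<gamma>\<bar> \<Longrightarrow> w \<gamma> = 0" and r: "r \<ge> 0"
  shows "\<exists>A>0. \<forall>a. (\<forall>n. norm (a n) \<le> r ^ n / fact n) \<longrightarrow> norm (a 0) \<ge> 1/2 \<longrightarrow>
           A \<le> (LINT \<gamma>|lborel. w \<gamma> * (norm (\<Sum>n. a n * complex_of_real \<gamma> ^ n))\<^sup>2)"
proof (rule ccontr)
  have [measurable]: "w \<in> borel_measurable borel" using w by auto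
  assume neg: "\<not> ?thesis"
  have "\<exists>a. (\<forall>n. norm (a n) \<le> r ^ n / fact n) \<and> norm (a 0) \<ge> 1/2 \<and>
      (LINT \<gamma>|lborel. w \<gamma> * (norm (\<Sum>n. a n * complex_of_real \<gamma> ^ n))\<^sup>2) < 1 / real (Suc m)" (is "\<exists>a. ?P m a") for m
  proof (rule ccontr)
    assume "\<not> ?thesis"
    then have "\<forall>a. (\<forall>n. norm (a n) \<le> r ^ n / fact n) \<longrightarrow> norm (a 0) \<ge> 1/2 \<longrightarrow>
           1 / real (Suc m) \<le> (LINT \<gamma>|lborel. w \<gamma> * (norm (\<Sum>n. a n * complex_of_real \<gamma> ^ n))\<^sup>2)"
      by (auto simp: not_less)
    moreover have "1 / real (Suc m) > 0" by simp
    ultimately show False using neg by blast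
  qed
  then have "\<forall>m. \<exists>a. ?P m a" ..
  from choice[OF this] obtain a where "\<forall>m. ?P m (a m)" ..
  then have a: "\<And>m n. norm (a m n) \<le> r ^ n / fact n" "\<And>m. norm (a m 0) \<ge> 1/2"
    and small: "\<And>m. (LINT \<gamma>|lborel. w \<gamma> * (norm (\<Sum>n. a m n * complex_of_real \<gamma> ^ n))\<^sup>2) < 1 / real (Suc m)"
    by simp_all
  define h where "h m z = (\<Sum>n. a m n * z ^ n)" for m and z :: complex
  have hb: "(\<lambda>n. a m n * z ^ n) sums h m z" "norm (h m z) \<le> exp (r * norm z)" for m z
    unfolding h_def by (rule entire_power_series_bound[OF a(1)])+
  have hol: "h m holomorphic_on UNIV" for m
  proof -
    have "h m holomorphic_on ball 0 s" for s
      by (rule power_series_holomorphic[where a = "a m"]) (use hb(1) in simp)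
    then have "h m field_differentiable at z" for z
      using holomorphic_on_imp_differentiable_at[of "h m" "ball 0 (norm z + 1)" z] by auto
    then show ?thesis by (auto simp: holomorphic_on_def field_differentiable_at_within)
  qed
  obtain g \<sigma> where g: "g holomorphic_on UNIV" and \<sigma>: "strict_mono \<sigma>"
    and lim: "\<And>z. (\<lambda>m. h (\<sigma> m) z) \<longlonglongrightarrow> g z"
  proof (rule Montel[of UNIV "range h" h])
    fix K :: "complex set" assume "compact K"
    then have "bounded K" by (rule compact_imp_bounded)
    then obtain B where B: "\<And>z. z \<in> K \<Longrightarrow> norm z \<le> B"
      unfolding bounded_iff by blast
    have "norm (h m z) \<le> exp (r * B)" if "z \<in> K" for m z
      using hb(2)[of m z] B[OF that] r by (rule_tac order_trans) (auto intro: mult_left_mono)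
    then show "\<exists>B. \<forall>h\<in>range h. \<forall>z\<in>K. norm (h z) \<le> B" by blast
  qed (use hol in auto)
  have "h m 0 = a m 0" for m
    unfolding h_def using suminf_finite[of "{0::nat}" "\<lambda>n. a m n * 0 ^ n"] by simp
  then have "1/2 \<le> norm (g 0)"
    using a(2) by (intro LIMSEQ_le_const[OF tendsto_norm[OF lim[of 0]]]) auto
  then have gnz: "AE \<gamma> in lborel. g (complex_of_real \<gamma>) \<noteq> 0"
    by (intro entire_nonzero_AE[OF g, of 0]) auto
  have gm [measurable]: "(\<lambda>\<gamma>. g (complex_of_real \<gamma>)) \<in> borel_measurable borel"
    and hm [measurable]: "(\<lambda>\<gamma>. h m (complex_of_real \<gamma>)) \<in> borel_measurable borel" for m
    using holomorphic_on_imp_continuous_on[OF g] holomorphic_on_imp_continuous_on[OF hol]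
    by (auto intro!: borel_measurable_continuous_onI continuous_on_compose2[of UNIV _ UNIV of_real] continuous_intros)
  \<comment> \<open>The weight has bounded support, so the growth of the family at infinity does not matter.\<close>
  have dom: "norm (w \<gamma> * (norm (h m (complex_of_real \<gamma>)))\<^sup>2) \<le> (exp (r * R))\<^sup>2 * w \<gamma>" for m \<gamma>
  proof (cases "R < \<bar>\<gamma>\<bar>")
    case False
    have "norm (h m (complex_of_real \<gamma>)) \<le> exp (r * \<bar>\<gamma>\<bar>)" using hb(2)[of m "complex_of_real \<gamma>"] by simp
    also have "\<dots> \<le> exp (r * R)" using False r by (auto intro: mult_left_mono)
    finally show ?thesis using w(2)[of \<gamma>] by (auto simp: abs_mult mult.commute intro!: mult_left_mono power_mono)
  qed (use R in auto)
  have ig: "integrable lborel (\<lambda>\<gamma>. w \<gamma> * (norm (g (complex_of_real \<gamma>)))\<^sup>2)"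
    and limint: "(\<lambda>m. LINT \<gamma>|lborel. w \<gamma> * (norm (h (\<sigma> m) (complex_of_real \<gamma>)))\<^sup>2) \<longlonglongrightarrow>
      (LINT \<gamma>|lborel. w \<gamma> * (norm (g (complex_of_real \<gamma>)))\<^sup>2)"
  proof -
    have 1: "integrable lborel (\<lambda>\<gamma>. (exp (r * R))\<^sup>2 * w \<gamma>)" using w by auto
    have 2: "AE \<gamma> in lborel. (\<lambda>m. w \<gamma> * (norm (h (\<sigma> m) (complex_of_real \<gamma>)))\<^sup>2) \<longlonglongrightarrow> w \<gamma> * (norm (g (complex_of_real \<gamma>)))\<^sup>2"
      by (intro AE_I2 tendsto_intros lim)
    have 3: "AE \<gamma> in lborel. norm (w \<gamma> * (norm (h (\<sigma> m) (complex_of_real \<gamma>)))\<^sup>2) \<le> (exp (r * R))\<^sup>2 * w \<gamma>" for m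
      using dom by (intro AE_I2)
    show "integrable lborel (\<lambda>\<gamma>. w \<gamma> * (norm (g (complex_of_real \<gamma>)))\<^sup>2)"
      by (rule integrable_dominated_convergence[OF _ _ 1 2 3]) auto
    show "(\<lambda>m. LINT \<gamma>|lborel. w \<gamma> * (norm (h (\<sigma> m) (complex_of_real \<gamma>)))\<^sup>2) \<longlonglongrightarrow>
      (LINT \<gamma>|lborel. w \<gamma> * (norm (g (complex_of_real \<gamma>)))\<^sup>2)"
      by (rule integral_dominated_convergence[OF _ _ 1 2 3]) auto
  qed
  have "(\<lambda>m. LINT \<gamma>|lborel. w \<gamma> * (norm (h (\<sigma> m) (complex_of_real \<gamma>)))\<^sup>2) \<longlonglongrightarrow> 0"
  proof (rule tendsto_sandwich[OF _ _ tendsto_const])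
    show "\<forall>\<^sub>F m in sequentially. 0 \<le> (LINT \<gamma>|lborel. w \<gamma> * (norm (h (\<sigma> m) (complex_of_real \<gamma>)))\<^sup>2)"
      using w(2) by (auto intro!: always_eventually integral_nonneg_AE)
    have "(LINT \<gamma>|lborel. w \<gamma> * (norm (h (\<sigma> m) (complex_of_real \<gamma>)))\<^sup>2) \<le> 1 / real (Suc m)" for m
    proof -
      have "1 / real (Suc (\<sigma> m)) \<le> 1 / real (Suc m)"
        using seq_suble[OF \<sigma>, of m] by (intro divide_left_mono) auto
      then show ?thesis using small[of "\<sigma> m"] by (simp add: h_def)
    qed
    then show "\<forall>\<^sub>F m in sequentially. (LINT \<gamma>|lborel. w \<gamma> * (norm (h (\<sigma> m) (complex_of_real \<gamma>)))\<^sup>2) \<le> 1 / real (Suc m)"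
      by simp
    show "(\<lambda>m. 1 / real (Suc m)) \<longlonglongrightarrow> 0" by (rule lim_1_over_n[THEN LIMSEQ_Suc])
  qed
  with limint have "(LINT \<gamma>|lborel. w \<gamma> * (norm (g (complex_of_real \<gamma>)))\<^sup>2) = 0" by (rule LIMSEQ_unique)
  then have "AE \<gamma> in lborel. w \<gamma> * (norm (g (complex_of_real \<gamma>)))\<^sup>2 = 0"
    using integral_nonneg_eq_0_iff_AE[OF ig] w(2) by auto
  with gnz have "AE \<gamma> in lborel. w \<gamma> = 0" by eventually_elim auto
  with w(3) show False by simp
qed

lemma parseval_cube_hat:
  "sq_int cube_measure f \<Longrightarrow> ((\<lambda>k. (norm (cube_hat f k))\<^sup>2) has_sum cube_energy f) lattice"
  unfolding cube_hat_def by (rule parseval_cube)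

lemma measurable_cube_hat [measurable]:
  fixes f :: "'a::euclidean_space \<Rightarrow> complex"
  assumes [measurable]: "f \<in> borel_measurable borel"
  shows "cube_hat f \<in> borel_measurable borel"
proof -
  have [measurable]: "case_prod (\<lambda>\<xi> x. f x * cnj (cis (2 * pi * (\<xi> \<bullet> x)))) \<in> borel_measurable (borel \<Otimes>\<^sub>M (cube_measure :: 'a measure))"
    by (subst measurable_cong_sets[OF sets_pair_measure_cong[OF refl sets_cube_measure] refl]) measurable
  show ?thesis unfolding cube_hat_def[abs_def] harmonic_def by measurable
qed

text \<open>
  The single sums \<open>\<Sum>k. |cube_hat f (k + \<gamma> u k)|\<^sup>2\<close> are controlled from above for every \<open>\<gamma>\<close>, but from below only
  on average over \<open>\<gamma>\<close>, through \<open>entire_family_lower_bound\<close>.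
\<close>

theorem averaged_sampling_frame:
  fixes w :: "real \<Rightarrow> real" and u :: "'a::euclidean_space \<Rightarrow> 'a"
  assumes w: "integrable lborel w" "\<And>\<gamma>. w \<gamma> \<ge> 0" "\<not> (AE \<gamma> in lborel. w \<gamma> = 0)"
    and R: "\<And>\<gamma>. R < \<bar>\<gamma>\<bar> \<Longrightarrow> w \<gamma> = 0"
    and u: "\<And>k. k \<in> lattice \<Longrightarrow> norm (u k) \<le> 1"
  defines "I \<equiv> \<lambda>f k. LINT \<gamma>|lborel. w \<gamma> * (norm (cube_hat f (k + \<gamma> *\<^sub>R u k)))\<^sup>2"
  shows "\<exists>A>0. \<exists>B>0. \<forall>f. sq_int cube_measure f \<longrightarrow>
    I f summable_on lattice \<and> A * cube_energy f \<le> infsum (I f) lattice \<and> infsum (I f) lattice \<le> B * cube_energy f"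
proof -
  have [measurable]: "w \<in> borel_measurable borel" using w by auto
  let ?r = "2 * pi * cube_radius TYPE('a)"
  have r: "?r \<ge> 0" by simp
  obtain A where A: "A > 0 \<and> (\<forall>a. (\<forall>n. norm (a n) \<le> ?r ^ n / fact n) \<longrightarrow> norm (a 0) \<ge> 1/2 \<longrightarrow>
           A \<le> (LINT \<gamma>|lborel. w \<gamma> * (norm (\<Sum>n. a n * complex_of_real \<gamma> ^ n))\<^sup>2))"
    using entire_family_lower_bound[OF w R r] ..
  define C where "C = exp (2 * (?r * \<bar>R\<bar>))"
  define B where "B = C * (LINT \<gamma>|lborel. w \<gamma>) + 1"
  have C: "C > 0" by (simp add: C_def)
  have B0: "B > 0" unfolding B_def using C w by (intro add_nonneg_pos mult_nonneg_nonneg integral_nonneg_AE) auto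

  have ub: "w \<gamma> * (\<Sum>k\<in>S. (norm (cube_hat f (k + \<gamma> *\<^sub>R u k)))\<^sup>2) \<le> w \<gamma> * (C * cube_energy f)"
    if "sq_int cube_measure f" "finite S" "S \<subseteq> lattice" for f S \<gamma>
  proof (cases "R < \<bar>\<gamma>\<bar>")
    case False
    have "(\<Sum>k\<in>S. (norm (cube_hat f (k + \<gamma> *\<^sub>R u k)))\<^sup>2) \<le> exp (2 * (?r * \<bar>\<gamma>\<bar>)) * cube_energy f"
      using that u by (intro sampling_upper_bound) auto
    also have "\<dots> \<le> C * cube_energy f"
      unfolding C_def using False r by (intro mult_right_mono cube_energy_nonneg) (auto intro!: mult_left_mono)
    finally show ?thesis using w(2) by (rule mult_left_mono)
  qed (use R in auto)
  have int: "integrable lborel (\<lambda>\<gamma>. w \<gamma> * (norm (cube_hat f (k + \<gamma> *\<^sub>R u k)))\<^sup>2)"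
    if f: "sq_int cube_measure f" and k: "k \<in> lattice" for f k
  proof (rule Bochner_Integration.integrable_bound)
    have [measurable]: "f \<in> borel_measurable borel" using f by (auto simp: sq_int_def)
    show "integrable lborel (\<lambda>\<gamma>. w \<gamma> * (C * cube_energy f))" using w by auto
    show "AE \<gamma> in lborel. norm (w \<gamma> * (norm (cube_hat f (k + \<gamma> *\<^sub>R u k)))\<^sup>2) \<le> norm (w \<gamma> * (C * cube_energy f))"
      using ub[OF f, of "{k}"] k w(2) C cube_energy_nonneg[of f] by (intro AE_I2) (auto simp: abs_mult)
    show "(\<lambda>\<gamma>. w \<gamma> * (norm (cube_hat f (k + \<gamma> *\<^sub>R u k)))\<^sup>2) \<in> borel_measurable lborel" by measurable
  qed
  have sumI: "sum (I f) S = (LINT \<gamma>|lborel. w \<gamma> * (\<Sum>k\<in>S. (norm (cube_hat f (k + \<gamma> *\<^sub>R u k)))\<^sup>2))"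
    and intS: "integrable lborel (\<lambda>\<gamma>. w \<gamma> * (\<Sum>k\<in>S. (norm (cube_hat f (k + \<gamma> *\<^sub>R u k)))\<^sup>2))"
    if f: "sq_int cube_measure f" and S: "finite S" "S \<subseteq> lattice" for f S
  proof -
    have i: "integrable lborel (\<lambda>\<gamma>. w \<gamma> * (norm (cube_hat f (k + \<gamma> *\<^sub>R u k)))\<^sup>2)" if "k \<in> S" for k
      using int[OF f] S that by blast
    show "sum (I f) S = (LINT \<gamma>|lborel. w \<gamma> * (\<Sum>k\<in>S. (norm (cube_hat f (k + \<gamma> *\<^sub>R u k)))\<^sup>2))"
      unfolding I_def sum_distrib_left by (rule Bochner_Integration.integral_sum[symmetric]) (rule i)
    show "integrable lborel (\<lambda>\<gamma>. w \<gamma> * (\<Sum>k\<in>S. (norm (cube_hat f (k + \<gamma> *\<^sub>R u k)))\<^sup>2))"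
      unfolding sum_distrib_left by (rule Bochner_Integration.integrable_sum) (rule i)
  qed
  have I0: "I f k \<ge> 0" for f k unfolding I_def using w by (intro integral_nonneg_AE) auto
  have le: "sum (I f) S \<le> B * cube_energy f" if f: "sq_int cube_measure f" and S: "finite S" "S \<subseteq> lattice" for f S
  proof -
    have "sum (I f) S \<le> (LINT \<gamma>|lborel. w \<gamma> * (C * cube_energy f))"
      unfolding sumI[OF f S] using intS[OF f S] ub[OF f S] w by (intro integral_mono) auto
    also have "\<dots> = (LINT \<gamma>|lborel. w \<gamma>) * (C * cube_energy f)" by simp
    also have "\<dots> \<le> B * cube_energy f"
      using cube_energy_nonneg[of f] by (simp add: B_def algebra_simps)
    finally show ?thesis .
  qed
  have summ: "I f summable_on lattice" if f: "sq_int cube_measure f" for f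
    using le[OF f] I0 by (intro nonneg_bdd_above_summable_on bdd_aboveI2[where M = "B * cube_energy f"]) auto
  have "\<forall>f. sq_int cube_measure f \<longrightarrow>
    I f summable_on lattice \<and> A * cube_energy f \<le> infsum (I f) lattice \<and> infsum (I f) lattice \<le> B * cube_energy f"
  proof (intro conjI allI impI)
    fix f :: "'a \<Rightarrow> complex" assume f: "sq_int cube_measure f"
    show "I f summable_on lattice" by (rule summ[OF f])
    show "infsum (I f) lattice \<le> B * cube_energy f"
      by (rule infsum_le_finite_sums[OF summ[OF f] le[OF f]])
    show "A * cube_energy f \<le> infsum (I f) lattice"
    proof (cases "cube_energy f = 0")
      case True
      then show ?thesis using infsum_nonneg[of lattice "I f"] I0 by simp
    next
      case False
      define e where "e = cube_energy f"
      have e: "e > 0" using False cube_energy_nonneg[of f] unfolding e_def by linarith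
      \<comment> \<open>A finite part of the lattice suffices, so that no infinite sum of entire functions is needed.\<close>
      have "\<forall>\<^sub>F S in finite_subsets_at_top lattice. (\<Sum>k\<in>S. (norm (cube_hat f k))\<^sup>2) > e / 2"
        using parseval_cube_hat[OF f] e unfolding has_sum_def e_def[symmetric] by (intro order_tendstoD(1)) auto
      then obtain S where S: "finite S" "S \<subseteq> lattice" and Se: "(\<Sum>k\<in>S. (norm (cube_hat f k))\<^sup>2) > e / 2"
        unfolding eventually_finite_subsets_at_top by blast
      have Sle: "(\<Sum>k\<in>S. (norm (cube_hat f k))\<^sup>2) \<le> e"
        unfolding cube_hat_def e_def by (rule bessel_inequality[OF orthonormal_harmonic S f])
      have uS: "norm (u k) \<le> 1" if "k \<in> S" for k using u S that by blast
      define b where "b k = cnj (cube_hat f k)" for k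
      define a where "a n = sampling_coeff f u S b n / of_real e" for n
      have b2: "(\<Sum>k\<in>S. (norm (b k))\<^sup>2) = (\<Sum>k\<in>S. (norm (cube_hat f k))\<^sup>2)" by (simp add: b_def)
      have an: "norm (a n) \<le> ?r ^ n / fact n" for n
      proof -
        have "norm (sampling_coeff f u S b n) \<le> ?r ^ n / fact n * (sqrt e * sqrt (\<Sum>k\<in>S. (norm (b k))\<^sup>2))"
          unfolding e_def by (rule norm_sampling_coeff_le[OF S uS f])
        also have "\<dots> \<le> ?r ^ n / fact n * (sqrt e * sqrt e)"
          using Sle r e unfolding b2 by (intro mult_left_mono) auto
        also have "\<dots> = ?r ^ n / fact n * e" using e by simp
        finally show ?thesis using e by (simp add: a_def norm_divide pos_divide_le_eq)
      qed
      have ser: "(\<Sum>n. a n * complex_of_real \<gamma> ^ n) = (\<Sum>k\<in>S. cube_hat f (k + \<gamma> *\<^sub>R u k) * b k) / of_real e" for \<gamma>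
      proof -
        have "(\<lambda>n. sampling_coeff f u S b n * of_real \<gamma> ^ n / of_real e) sums ((\<Sum>k\<in>S. cube_hat f (k + \<gamma> *\<^sub>R u k) * b k) / of_real e)"
          by (intro sums_divide sampling_series f uS)
        then show ?thesis by (simp add: a_def sums_iff)
      qed
      have "a 0 = (\<Sum>k\<in>S. cube_hat f k * b k) / of_real e"
        by (simp add: a_def sampling_coeff_def moment_def cube_hat_def)
      also have "(\<Sum>k\<in>S. cube_hat f k * b k) = of_real (\<Sum>k\<in>S. (norm (cube_hat f k))\<^sup>2)"
        by (simp add: b_def complex_norm_square[symmetric] del: of_real_power)
      finally have norm_a0: "norm (a 0) = (\<Sum>k\<in>S. (norm (cube_hat f k))\<^sup>2) / e"
        using e by (simp add: norm_divide sum_nonneg del: of_real_sum)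
      have a0: "norm (a 0) \<ge> 1/2" unfolding norm_a0 using Se e by (simp add: pos_le_divide_eq)
      have pt: "(norm (\<Sum>n. a n * complex_of_real \<gamma> ^ n))\<^sup>2 \<le> (\<Sum>k\<in>S. (norm (cube_hat f (k + \<gamma> *\<^sub>R u k)))\<^sup>2) / e" for \<gamma>
      proof -
        have "norm (\<Sum>k\<in>S. cube_hat f (k + \<gamma> *\<^sub>R u k) * b k) \<le> (\<Sum>k\<in>S. norm (cube_hat f (k + \<gamma> *\<^sub>R u k)) * norm (b k))"
          by (rule order_trans[OF norm_sum]) (simp add: norm_mult)
        then have "(norm (\<Sum>k\<in>S. cube_hat f (k + \<gamma> *\<^sub>R u k) * b k))\<^sup>2 \<le> (\<Sum>k\<in>S. norm (cube_hat f (k + \<gamma> *\<^sub>R u k)) * norm (b k))\<^sup>2"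
          by (intro power_mono) auto
        also have "\<dots> \<le> (\<Sum>k\<in>S. (norm (cube_hat f (k + \<gamma> *\<^sub>R u k)))\<^sup>2) * (\<Sum>k\<in>S. (norm (b k))\<^sup>2)"
          by (rule Cauchy_Schwarz_ineq_sum)
        also have "\<dots> \<le> (\<Sum>k\<in>S. (norm (cube_hat f (k + \<gamma> *\<^sub>R u k)))\<^sup>2) * e"
          using Sle unfolding b2 by (intro mult_left_mono sum_nonneg) auto
        finally show ?thesis
          using e unfolding ser by (simp add: norm_divide power_divide power2_eq_square field_simps)
      qed
      have "A \<le> (LINT \<gamma>|lborel. w \<gamma> * (norm (\<Sum>n. a n * complex_of_real \<gamma> ^ n))\<^sup>2)"
        using A an a0 by blast
      also have "\<dots> \<le> (LINT \<gamma>|lborel. w \<gamma> * (\<Sum>k\<in>S. (norm (cube_hat f (k + \<gamma> *\<^sub>R u k)))\<^sup>2) / e)"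
      proof (rule integral_mono')
        show "integrable lborel (\<lambda>\<gamma>. w \<gamma> * (\<Sum>k\<in>S. (norm (cube_hat f (k + \<gamma> *\<^sub>R u k)))\<^sup>2) / e)"
          using intS[OF f S] by auto
        show "w \<gamma> * (norm (\<Sum>n. a n * complex_of_real \<gamma> ^ n))\<^sup>2 \<le> w \<gamma> * (\<Sum>k\<in>S. (norm (cube_hat f (k + \<gamma> *\<^sub>R u k)))\<^sup>2) / e" for \<gamma>
          using mult_left_mono[OF pt w(2)] by simp
        show "0 \<le> w \<gamma> * (\<Sum>k\<in>S. (norm (cube_hat f (k + \<gamma> *\<^sub>R u k)))\<^sup>2) / e" for \<gamma>
          using w(2) e by (intro divide_nonneg_nonneg mult_nonneg_nonneg sum_nonneg) auto
      qed
      also have "\<dots> = sum (I f) S / e" using sumI[OF f S] by simp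
      finally have "A * e \<le> sum (I f) S" using e by (simp add: pos_le_divide_eq)
      also have "\<dots> \<le> infsum (I f) lattice"
        using summ[OF f] S I0 by (intro finite_sum_le_infsum) auto
      finally show ?thesis by (simp add: e_def)
    qed
  qed
  with A B0 show ?thesis by blast
qed

section \<open>The coefficients of a function against the ridges of one direction\<close>

lemma sq_int_cube_measure:
  assumes "sq_int lborel f" shows "sq_int cube_measure f"
proof -
  have [measurable]: "f \<in> borel_measurable borel" using assms by (auto simp: sq_int_def)
  have "integrable lborel (\<lambda>x. indicator cube x *\<^sub>R (norm (f x))\<^sup>2)"
    by (rule integrable_mult_indicator) (use assms in \<open>auto simp: sq_int_def\<close>)
  then show ?thesis by (simp add: sq_int_def integrable_cube_measure)
qed

lemma
  fixes f :: "'a::euclidean_space \<Rightarrow> 'b::{banach, second_countable_topology}"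
  assumes m: "f \<in> borel_measurable borel" and z: "\<And>x. x \<notin> cube \<Longrightarrow> f x = 0"
  shows integral_supported_in_cube: "(LINT x|cube_measure. f x) = (LINT x|lborel. f x)"
    and integrable_supported_in_cube: "integrable cube_measure f \<longleftrightarrow> integrable lborel f"
proof -
  have e: "(\<lambda>x. indicator cube x *\<^sub>R f x) = f" using z by (auto simp: fun_eq_iff indicator_def)
  show "(LINT x|cube_measure. f x) = (LINT x|lborel. f x)" unfolding integral_cube_measure[OF m] e ..
  show "integrable cube_measure f \<longleftrightarrow> integrable lborel f" unfolding integrable_cube_measure[OF m] e ..
qed

text \<open>
  Insert \<open>g(s) = \<integral> G(\<gamma>) e\<^sup>2\<^sup>\<pi>\<^sup>i\<^sup>\<gamma>\<^sup>s d\<gamma>\<close> and exchange the integrals: the inner integral over \<open>x\<close> collects the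
  frequencies \<open>m u\<close> of the modulation and \<open>\<gamma> u\<close> of the ridge.
\<close>

lemma pairing_ridge:
  fixes f :: "'a::euclidean_space \<Rightarrow> complex" and u :: 'a
  assumes f': "sq_int lborel f'" "AE x in lborel. f x = f' x" "\<And>x. x \<notin> cube \<Longrightarrow> f' x = 0"
    and G: "integrable lborel G" and g: "AE s in lborel. g s = inverse_fourier G s"
    and u: "u \<noteq> 0"
  shows "pairing f (\<lambda>x. gabor g m t (u \<bullet> x)) =
    (LINT \<gamma>|lborel. cnj (G \<gamma>) * cube_hat f' ((m + \<gamma>) *\<^sub>R u) * cis (2 * pi * \<gamma> * t))"
proof -
  have [measurable]: "f' \<in> borel_measurable borel" "G \<in> borel_measurable borel"
    using f' G by (auto simp: sq_int_def)
  have f'i: "integrable lborel f'"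
    using cube.integrable_sq_int[OF sq_int_cube_measure[OF f'(1)]] f'(3)
    by (subst (asm) integrable_supported_in_cube) auto
  define a where "a \<gamma> = cnj (G \<gamma>) * cis (2 * pi * \<gamma> * t)" for \<gamma>
  define b where "b x = f' x * cis (- 2 * pi * m * (u \<bullet> x))" for x
  have ai: "integrable lborel a" and bi: "integrable lborel b"
    unfolding a_def[abs_def] b_def[abs_def]
    by (rule Bochner_Integration.integrable_bound[OF G] Bochner_Integration.integrable_bound[OF f'i]; simp add: norm_mult)+
  have ae: "AE x in lborel. f x * cnj (gabor g m t (u \<bullet> x)) =
      f' x * cnj (cis (2 * pi * m * (u \<bullet> x)) * inverse_fourier G (u \<bullet> x - t))"
    using f'(2) AE_inner_affine[OF g u, of "- t"] by eventually_elim (simp add: gabor_def)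
  have "pairing f (\<lambda>x. gabor g m t (u \<bullet> x)) =
      (LINT x|lborel. f' x * cnj (cis (2 * pi * m * (u \<bullet> x)) * inverse_fourier G (u \<bullet> x - t)))"
    unfolding pairing_def by (rule lebesgue_integral_representative[OF _ ae]) measurable
  also have "\<dots> = (LINT x|lborel. b x * (LINT \<gamma>|lborel. a \<gamma> * cis (- 2 * pi * \<gamma> * (u \<bullet> x))))"
  proof (intro Bochner_Integration.integral_cong refl)
    fix x
    have "cnj (inverse_fourier G (u \<bullet> x - t)) = (LINT \<gamma>|lborel. cnj (G \<gamma> * cis (2 * pi * \<gamma> * (u \<bullet> x - t))))"
      unfolding inverse_fourier_def by (rule Bochner_Integration.integral_cnj[symmetric])
    also have "\<dots> = (LINT \<gamma>|lborel. a \<gamma> * cis (- 2 * pi * \<gamma> * (u \<bullet> x)))"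
    proof (intro Bochner_Integration.integral_cong refl)
      fix \<gamma>
      have "cnj (cis (2 * pi * \<gamma> * (u \<bullet> x - t))) = cis (2 * pi * \<gamma> * t) * cis (- 2 * pi * \<gamma> * (u \<bullet> x))"
        unfolding cis_cnj cis_mult by (rule arg_cong[where f = cis]) (simp add: algebra_simps)
      then show "cnj (G \<gamma> * cis (2 * pi * \<gamma> * (u \<bullet> x - t))) = a \<gamma> * cis (- 2 * pi * \<gamma> * (u \<bullet> x))"
        by (simp only: a_def complex_cnj_mult mult.assoc)
    qed
    finally show "f' x * cnj (cis (2 * pi * m * (u \<bullet> x)) * inverse_fourier G (u \<bullet> x - t)) =
        b x * (LINT \<gamma>|lborel. a \<gamma> * cis (- 2 * pi * \<gamma> * (u \<bullet> x)))"
      by (simp add: b_def cis_cnj)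
  qed
  also have "\<dots> = (LINT \<gamma>|lborel. a \<gamma> * (LINT x|lborel. b x * cis (- 2 * pi * \<gamma> * (u \<bullet> x))))"
    by (rule fubini_kernel[OF ai bi]) auto
  also have "\<dots> = (LINT \<gamma>|lborel. cnj (G \<gamma>) * cube_hat f' ((m + \<gamma>) *\<^sub>R u) * cis (2 * pi * \<gamma> * t))"
  proof (intro Bochner_Integration.integral_cong refl)
    fix \<gamma>
    have "b x * cis (- 2 * pi * \<gamma> * (u \<bullet> x)) = f' x * cnj (harmonic ((m + \<gamma>) *\<^sub>R u) x)" for x
    proof -
      have "cis (- 2 * pi * m * (u \<bullet> x)) * cis (- 2 * pi * \<gamma> * (u \<bullet> x)) = cnj (harmonic ((m + \<gamma>) *\<^sub>R u) x)"
        unfolding harmonic_def cis_cnj cis_mult by (rule arg_cong[where f = cis]) (simp add: algebra_simps)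
      then show ?thesis by (simp only: b_def mult.assoc)
    qed
    then have "(LINT x|lborel. b x * cis (- 2 * pi * \<gamma> * (u \<bullet> x))) = cube_hat f' ((m + \<gamma>) *\<^sub>R u)"
      unfolding cube_hat_def using f'(3) by (subst integral_supported_in_cube) auto
    then show "a \<gamma> * (LINT x|lborel. b x * cis (- 2 * pi * \<gamma> * (u \<bullet> x))) =
        cnj (G \<gamma>) * cube_hat f' ((m + \<gamma>) *\<^sub>R u) * cis (2 * pi * \<gamma> * t)"
      by (simp add: a_def)
  qed
  finally show ?thesis .
qed

text \<open>
  The closed intervals \<open>[k - 1/2, k + 1/2]\<close> overlap only in the countably many half-integers. They are indexed
  up to \<open>N + 1\<close>, since rounding can increase \<open>|t|\<close>.
\<close>

lemma integral_unit_intervals: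
  fixes \<phi> :: "real \<Rightarrow> 'b::{banach, second_countable_topology}"
  assumes \<phi>: "integrable lborel \<phi>" and N: "\<And>t. real N < \<bar>t\<bar> \<Longrightarrow> \<phi> t = 0"
  shows "(LINT t|lborel. \<phi> t) = (\<Sum>k\<in>{- int (Suc N)..int (Suc N)}. LINT t|cube_measure. \<phi> (t + of_int k))"
proof -
  have [measurable]: "\<phi> \<in> borel_measurable borel" using \<phi> by auto
  let ?K = "{- int (Suc N)..int (Suc N)}"
  have i: "integrable lborel (\<lambda>t. indicator cube (t - of_int k) *\<^sub>R \<phi> t)" for k
    by (rule Bochner_Integration.integrable_bound[OF \<phi>]) (auto simp: indicator_def)
  have "(LINT t|cube_measure. \<phi> (t + of_int k)) = (LINT t|lborel. indicator cube (t - of_int k) *\<^sub>R \<phi> t)" for k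
  proof -
    have "(LINT t|cube_measure. \<phi> (t + of_int k)) = (LINT t|lborel. indicator cube t *\<^sub>R \<phi> (t + of_int k))"
      by (rule integral_cube_measure) measurable
    also have "\<dots> = (LINT t|lborel. indicator cube (t - of_int k) *\<^sub>R \<phi> t)"
      using lborel_integral_real_affine[of 1 "\<lambda>t. indicator cube (t - of_int k) *\<^sub>R \<phi> t" "of_int k"]
      by (simp add: add.commute)
    finally show ?thesis .
  qed
  then have "(\<Sum>k\<in>?K. LINT t|cube_measure. \<phi> (t + of_int k)) = (LINT t|lborel. (\<Sum>k\<in>?K. indicator cube (t - of_int k) *\<^sub>R \<phi> t))"
    using Bochner_Integration.integral_sum[of ?K lborel "\<lambda>k t. indicator cube (t - of_int k) *\<^sub>R \<phi> t"] i by simp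
  also have "\<dots> = (LINT t|lborel. \<phi> t)"
  proof (rule integral_cong_AE)
    have "countable (range (\<lambda>j::int. of_int j + 1/2 :: real))" by simp
    then have "AE t in lborel. (t::real) \<notin> range (\<lambda>j::int. of_int j + 1/2)"
      by (intro AE_not_in countable_imp_null_set_lborel)
    then show "AE t in lborel. (\<Sum>k\<in>?K. indicator cube (t - of_int k) *\<^sub>R \<phi> t) = \<phi> t"
    proof eventually_elim
      case (elim t)
      show ?case
      proof (cases "real N < \<bar>t\<bar>")
        case True then show ?thesis using N by simp
      next
        case False
        have "t - of_int k \<in> cube \<longleftrightarrow> k = round t" for k
        proof
          assume "t - of_int k \<in> cube"
          then have "\<bar>t - of_int k\<bar> \<le> 1/2" by (simp add: cube_def)
          moreover have "t - of_int k \<noteq> 1/2"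
          proof
            assume "t - of_int k = 1/2"
            then have "t = of_int k + 1/2" by linarith
            then show False using elim by blast
          qed
          ultimately have "t - of_int k < 1/2" "of_int k - t \<le> 1/2" by linarith+
          then show "k = round t" by (intro round_unique[symmetric]) linarith+
        next
          assume "k = round t"
          then show "t - of_int k \<in> cube"
            using of_int_round_abs_le[of t] by (simp add: cube_def abs_minus_commute)
        qed
        then have "(\<Sum>k\<in>?K. indicator cube (t - of_int k) *\<^sub>R \<phi> t) = (\<Sum>k\<in>?K. if k = round t then \<phi> t else 0)"
          by (intro sum.cong refl) (auto simp: indicator_def)
        also have "round t \<in> ?K"
        proof -
          have "real_of_int (round t) - t \<le> 1/2" "- (1/2) \<le> real_of_int (round t) - t"
            using of_int_round_abs_le[of t] unfolding abs_le_iff by linarith+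
          moreover have "t \<le> real N" "- real N \<le> t" using False by auto
          ultimately have "real_of_int (round t) \<le> real N + 1" "- (real N + 1) \<le> real_of_int (round t)"
            by linarith+
          then have "real_of_int (round t) \<le> of_int (int N + 1)" "real_of_int (- (int N + 1)) \<le> of_int (round t)"
            by simp_all
          then show ?thesis unfolding of_int_le_iff by simp
        qed
        then have "(\<Sum>k\<in>?K. if k = round t then \<phi> t else 0) = \<phi> t" by simp
        finally show ?thesis .
      qed
    qed
  qed measurable
  finally show ?thesis ..
qed

lemma norm_sum_disjoint_supports:
  fixes a :: "'i \<Rightarrow> complex"
  assumes "finite I" "\<And>k l. k \<in> I \<Longrightarrow> l \<in> I \<Longrightarrow> k \<noteq> l \<Longrightarrow> a k * a l = 0"
  shows "(norm (\<Sum>k\<in>I. a k))\<^sup>2 = (\<Sum>k\<in>I. (norm (a k))\<^sup>2)"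
proof (cases "\<exists>k\<in>I. a k \<noteq> 0")
  case True
  then obtain k where k: "k \<in> I" "a k \<noteq> 0" by blast
  then have "\<forall>l\<in>I - {k}. a l = 0" using assms(2)[of k] by auto
  then show ?thesis using assms(1) k by (simp add: sum.remove[of I k])
qed simp

lemma sq_int_affine:
  fixes H :: "real \<Rightarrow> complex"
  assumes "sq_int lborel H" "c \<noteq> 0"
  shows "sq_int lborel (\<lambda>t. H (s + c * t))"
proof -
  have [measurable]: "H \<in> borel_measurable borel" using assms by (auto simp: sq_int_def)
  show ?thesis using lborel_integrable_real_affine[OF sq_int_integrable[OF assms(1)] assms(2), of s]
    by (simp add: sq_int_def)
qed

lemma integrable_bounded_support:
  fixes H :: "real \<Rightarrow> complex"
  assumes H: "sq_int lborel H" and R: "\<And>t. R < \<bar>t\<bar> \<Longrightarrow> H t = 0"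
  shows "integrable lborel H"
proof -
  have "(norm (indicator {- R..R} t :: complex))\<^sup>2 = indicator {- R..R} t" for t
    by (simp add: indicator_def)
  moreover have "integrable lborel (indicator {- R..R} :: real \<Rightarrow> real)"
    by (simp add: emeasure_lborel_Icc_eq)
  ultimately have "sq_int lborel (\<lambda>t. indicator {- R..R} t :: complex)" unfolding sq_int_def by simp
  then have "integrable lborel (\<lambda>t. H t * indicator {- R..R} t)"
    by (rule integrable_mult_sq_int[OF H])
  also have "(\<lambda>t. H t * indicator {- R..R} t) = H"
    using R by (force simp: fun_eq_iff indicator_def abs_le_iff not_le)
  finally show ?thesis .
qed

text \<open>
  After rescaling to period \<open>1\<close>, the numbers on the left are the Fourier coefficients of
  \<open>P(t) = (\<Sum>k. H((t + k)/\<omega>))\<close>, a finite sum. At almost every \<open>t\<close> at most one term is nonzero, so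
  \<open>|P|\<^sup>2 = (\<Sum>k. |H((t + k)/\<omega>)|\<^sup>2)\<close>, and integrating over one period recovers \<open>\<integral> |H|\<^sup>2\<close>.
\<close>

lemma parseval_periodization:
  fixes H :: "real \<Rightarrow> complex"
  assumes H: "sq_int lborel H" and \<omega>: "\<omega> > 0"
    and R: "\<And>\<gamma>. R < \<bar>\<gamma>\<bar> \<Longrightarrow> H \<gamma> = 0"
    and disj: "\<And>j::int. j \<noteq> 0 \<Longrightarrow> AE \<gamma> in lborel. H \<gamma> * H (\<gamma> + of_int j / \<omega>) = 0"
  shows "((\<lambda>j::int. (norm (LINT \<gamma>|lborel. H \<gamma> * cis (2 * pi * \<gamma> * (\<omega> * of_int j))))\<^sup>2) has_sum
      (1 / \<omega>) * (LINT \<gamma>|lborel. (norm (H \<gamma>))\<^sup>2)) UNIV"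
proof -
  have [measurable]: "H \<in> borel_measurable borel" using H by (auto simp: sq_int_def)
  define H1 where "H1 t = H (0 + (1 / \<omega>) * t)" for t
  have H1_m [measurable]: "H1 \<in> borel_measurable borel" unfolding H1_def[abs_def] by measurable
  have H1: "sq_int lborel H1" unfolding H1_def[abs_def] using \<omega> by (intro sq_int_affine H) auto
  define N where "N = nat \<lceil>\<omega> * R\<rceil>"
  have N: "H1 t = 0" if "real N < \<bar>t\<bar>" for t
  proof -
    have "\<omega> * R < \<bar>t\<bar>" using that unfolding N_def by linarith
    then have "R < \<bar>(1 / \<omega>) * t\<bar>" using \<omega> by (simp add: abs_mult field_simps)
    then show ?thesis unfolding H1_def using R by simp
  qed
  let ?K = "{- int (Suc N)..int (Suc N)}"
  define P where "P t = (\<Sum>k\<in>?K. H1 (t + of_int k))" for t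
  have shift: "sq_int lborel (\<lambda>t. H1 (t + of_int k))" for k :: int
    using sq_int_affine[OF H1, of 1 "of_int k"] by (simp add: add.commute)
  have P: "sq_int cube_measure P"
    unfolding P_def[abs_def] by (intro sq_int_sum sq_int_cube_measure shift)
  have H1i: "integrable lborel H1" by (rule integrable_bounded_support[OF H1 N])
  have coeff: "(LINT \<gamma>|lborel. H \<gamma> * cis (2 * pi * \<gamma> * (\<omega> * of_int j))) =
     of_real (1 / \<omega>) * (LINT t|cube_measure. P t * cnj (harmonic (of_int (- j)) t))" for j :: int
  proof -
    have e: "cis (2 * pi * (t + of_int k) * of_int j) = cnj (harmonic (of_int (- j)) t)" for t :: real and k :: int
    proof -
      have "2 * pi * (t + of_int k) * of_int j = 2 * pi * (of_int j * t) + 2 * pi * of_int (k * j)"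
        by (simp add: algebra_simps)
      then have "cis (2 * pi * (t + of_int k) * of_int j) = cis (2 * pi * (of_int j * t)) * cis (2 * pi * of_int (k * j))"
        by (simp only: cis_mult)
      then show ?thesis by (simp add: harmonic_def cis_cnj)
    qed
    have int: "integrable lborel (\<lambda>t. H1 t * cis (2 * pi * t * of_int j))"
      by (rule Bochner_Integration.integrable_bound[OF H1i]) (auto simp: norm_mult)
    have "(LINT \<gamma>|lborel. H \<gamma> * cis (2 * pi * \<gamma> * (\<omega> * of_int j))) =
       \<bar>1 / \<omega>\<bar> *\<^sub>R (LINT t|lborel. H (0 + (1 / \<omega>) * t) * cis (2 * pi * (0 + (1 / \<omega>) * t) * (\<omega> * of_int j)))"
      using \<omega> by (intro lborel_integral_real_affine) auto
    also have "\<dots> = of_real (1 / \<omega>) * (LINT t|lborel. H1 t * cis (2 * pi * t * of_int j))"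
      using \<omega> by (simp add: H1_def scaleR_conv_of_real mult.assoc)
    also have "(LINT t|lborel. H1 t * cis (2 * pi * t * of_int j)) =
        (\<Sum>k\<in>?K. LINT t|cube_measure. H1 (t + of_int k) * cis (2 * pi * (t + of_int k) * of_int j))"
      by (rule integral_unit_intervals[OF int]) (simp add: N)
    also have "\<dots> = (\<Sum>k\<in>?K. LINT t|cube_measure. H1 (t + of_int k) * cnj (harmonic (of_int (- j)) t))"
      unfolding e ..
    also have "\<dots> = (LINT t|cube_measure. (\<Sum>k\<in>?K. H1 (t + of_int k) * cnj (harmonic (of_int (- j)) t)))"
      by (intro Bochner_Integration.integral_sum[symmetric] integrable_mult_harmonic sq_int_cube_measure shift)
    also have "\<dots> = (LINT t|cube_measure. P t * cnj (harmonic (of_int (- j)) t))"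
      by (simp only: P_def sum_distrib_right)
    finally show ?thesis .
  qed
  have "AE t in lborel. H1 (t + of_int k) * H1 (t + of_int l) = 0" if "k \<noteq> l" for k l :: int
  proof -
    have "AE t in lborel. H ((1 / \<omega>) \<bullet> t + of_int k / \<omega>) * H ((1 / \<omega>) \<bullet> t + of_int k / \<omega> + of_int (l - k) / \<omega>) = 0"
      using \<omega> that by (intro AE_inner_affine[OF disj]) auto
    then show ?thesis
    proof eventually_elim
      case (elim t)
      have "0 + (1 / \<omega>) * (t + of_int k) = (1 / \<omega>) \<bullet> t + of_int k / \<omega>"
        "0 + (1 / \<omega>) * (t + of_int l) = (1 / \<omega>) \<bullet> t + of_int k / \<omega> + of_int (l - k) / \<omega>"
        using \<omega> by (simp_all add: field_simps)
      then show ?case using elim by (simp only: H1_def)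
    qed
  qed
  then have "AE t in lborel. \<forall>k\<in>?K. \<forall>l\<in>?K. k \<noteq> l \<longrightarrow> H1 (t + of_int k) * H1 (t + of_int l) = 0"
    by (simp add: AE_finite_all)
  then have aeP: "AE t in cube_measure. (norm (P t))\<^sup>2 = (\<Sum>k\<in>?K. (norm (H1 (t + of_int k)))\<^sup>2)"
    unfolding AE_cube_measure P_def
    by eventually_elim (auto intro!: norm_sum_disjoint_supports)
  have [measurable]: "P \<in> borel_measurable borel" using P by (auto simp: sq_int_def)
  have "cube_energy P = (LINT t|cube_measure. (\<Sum>k\<in>?K. (norm (H1 (t + of_int k)))\<^sup>2))"
    by (rule integral_cong_AE[OF _ _ aeP]) auto
  also have "\<dots> = (\<Sum>k\<in>?K. LINT t|cube_measure. (norm (H1 (t + of_int k)))\<^sup>2)"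
    by (intro Bochner_Integration.integral_sum sq_int_integrable sq_int_cube_measure shift)
  also have "\<dots> = (LINT t|lborel. (norm (H1 t))\<^sup>2)"
    by (rule integral_unit_intervals[OF sq_int_integrable[OF H1], symmetric]) (simp add: N)
  also have "\<dots> = \<omega> * (LINT \<gamma>|lborel. (norm (H \<gamma>))\<^sup>2)"
    using \<omega> lborel_integral_real_affine[of "1 / \<omega>" "\<lambda>\<gamma>. (norm (H \<gamma>))\<^sup>2" 0] by (simp add: H1_def)
  finally have energy: "cube_energy P = \<omega> * (LINT \<gamma>|lborel. (norm (H \<gamma>))\<^sup>2)" .
  have "bij_betw (\<lambda>j::int. of_int (- j) :: real) UNIV lattice"
  proof (rule bij_betw_imageI)
    show "(\<lambda>j::int. of_int (- j) :: real) ` UNIV = lattice"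
    proof
      show "lattice \<subseteq> range (\<lambda>j::int. of_int (- j) :: real)"
      proof
        fix x :: real assume "x \<in> lattice"
        then obtain i :: int where "x = of_int i" by (auto simp: lattice_def elim: Ints_cases)
        then show "x \<in> range (\<lambda>j::int. of_int (- j) :: real)" by (intro image_eqI[of _ _ "- i"]) auto
      qed
    qed (auto simp: lattice_def)
  qed (auto simp: inj_on_def)
  from has_sum_reindex_bij_betw[OF this, THEN iffD2, OF parseval_cube[OF P]]
  have "((\<lambda>j::int. (1 / \<omega>)\<^sup>2 * (norm (LINT t|cube_measure. P t * cnj (harmonic (of_int (- j)) t)))\<^sup>2) has_sum
     (1 / \<omega>)\<^sup>2 * cube_energy P) UNIV"
    by (rule has_sum_cmult_right)
  also have "(\<lambda>j::int. (1 / \<omega>)\<^sup>2 * (norm (LINT t|cube_measure. P t * cnj (harmonic (of_int (- j)) t)))\<^sup>2) =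
      (\<lambda>j. (norm (LINT \<gamma>|lborel. H \<gamma> * cis (2 * pi * \<gamma> * (\<omega> * of_int j))))\<^sup>2)"
    unfolding coeff using \<omega> by (simp add: norm_mult norm_divide power_mult_distrib power_divide)
  also have "(1 / \<omega>)\<^sup>2 * cube_energy P = (1 / \<omega>) * (LINT \<gamma>|lborel. (norm (H \<gamma>))\<^sup>2)"
    unfolding energy using \<omega> by (simp add: power2_eq_square)
  finally show ?thesis .
qed

section \<open>The frame property\<close>

lemma bij_ridge_index:
  assumes "\<omega> > 0"
  shows "bij_betw (\<lambda>((u, m), j::int). (m, \<omega> * of_int j, u)) (\<Gamma> \<times> UNIV) (ridge_index \<Gamma> \<omega>)"
    (is "bij_betw ?f _ _")
proof (rule bij_betw_imageI)
  show "inj_on ?f (\<Gamma> \<times> UNIV)" using assms by (auto simp: inj_on_def)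
  show "?f ` (\<Gamma> \<times> UNIV) = ridge_index \<Gamma> \<omega>"
  proof
    show "ridge_index \<Gamma> \<omega> \<subseteq> ?f ` (\<Gamma> \<times> UNIV)"
    proof
      fix i assume "i \<in> ridge_index \<Gamma> \<omega>"
      then obtain m u and j :: int where "i = (m, \<omega> * of_int j, u)" "(u, m) \<in> \<Gamma>"
        by (auto simp: ridge_index_def)
      then show "i \<in> ?f ` (\<Gamma> \<times> UNIV)" by (intro image_eqI[of _ _ "((u, m), j)"]) auto
    qed
  qed (auto simp: ridge_index_def)
qed

lemma integer_lattice_eq: "integer_lattice = (lattice :: (real ^ 'd) set)"
  by (auto simp: integer_lattice_def lattice_def Basis_vec_def inner_axis)

lemma cbox_eq_cube: "cbox (\<chi> i. -1/2) (\<chi> i. 1/2) = (cube :: (real ^ 'd) set)"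
proof (rule set_eqI)
  fix x :: "real ^ 'd"
  have "x \<in> cbox (\<chi> i. -1/2) (\<chi> i. 1/2) \<longleftrightarrow> (\<forall>i. -1/2 \<le> x $ i \<and> x $ i \<le> 1/2)"
    by (simp add: mem_box_cart)
  also have "\<dots> \<longleftrightarrow> (\<forall>i. \<bar>x $ i\<bar> \<le> 1/2)"
    by (intro iff_allI) linarith
  also have "\<dots> \<longleftrightarrow> x \<in> cube"
    by (auto simp: cube_def Basis_vec_def inner_axis)
  finally show "x \<in> cbox (\<chi> i. -1/2) (\<chi> i. 1/2) \<longleftrightarrow> x \<in> cube" .
qed

theorem theorem5p6:
  fixes \<Gamma> :: "((real ^ 'd) \<times> real) set"
    and \<omega> :: real
    and g ghat :: "real \<Rightarrow> complex"
  assumes "\<omega> > 0"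
    and "\<Gamma> \<subseteq> sphere 0 1 \<times> UNIV"
    and "bij_betw (\<lambda>(u, m). m *\<^sub>R u) \<Gamma> integer_lattice"
    and "square_integrable g"
    and "is_fourier_L2 g ghat"
    and "\<exists>K. compact K \<and> essentially_supported_in ghat K"
    and "\<And>j::int. j \<noteq> 0 \<Longrightarrow> AE \<gamma> in lebesgue. ghat \<gamma> * ghat (\<gamma> + of_int j / \<omega>) = 0"
    and "\<not> (AE \<gamma> in lebesgue. \<gamma> \<in> {-1/4..1/4} \<longrightarrow> ghat \<gamma> = 0)"
  shows "discrete_frame_for (ridge_index \<Gamma> \<omega>) (gabor_ridge g)
           (L2_supported_in (cbox (\<chi> i. -1/2) (\<chi> i. 1/2) :: (real ^ 'd) set))"
proof -
  note \<omega> = assms(1)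
  define \<Phi> :: "(real ^ 'd) \<times> real \<Rightarrow> real ^ 'd" where "\<Phi> = (\<lambda>(u, m). m *\<^sub>R u)"
  have bij: "bij_betw \<Phi> \<Gamma> lattice" using assms(3) by (simp add: \<Phi>_def integer_lattice_eq)
  \<comment> \<open>The frame sum is organized by lattice points, so the direction is read off from the lattice point.\<close>
  define U where "U k = fst (inv_into \<Gamma> \<Phi> k)" for k
  have U_eq: "U (m *\<^sub>R u) = u" if "(u, m) \<in> \<Gamma>" for u m
    using bij_betw_inv_into_left[OF bij that] by (simp add: U_def \<Phi>_def)
  have U1: "norm (U k) \<le> 1" if "k \<in> lattice" for k
  proof -
    have "inv_into \<Gamma> \<Phi> k \<in> \<Gamma>" using bij_betw_inv_into[OF bij] that by (rule bij_betwE[THEN bspec])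
    then show ?thesis using assms(2) by (cases "inv_into \<Gamma> \<Phi> k") (auto simp: U_def)
  qed
  have "square_integrable ghat" using assms(5) by (simp add: is_fourier_L2_def)
  then obtain G0 where [measurable]: "G0 \<in> borel_measurable borel" and G0: "AE \<gamma> in lborel. ghat \<gamma> = G0 \<gamma>"
    using borel_representative unfolding square_integrable_def by blast
  obtain K where K: "compact K" "AE \<gamma> in lborel. \<gamma> \<notin> K \<longrightarrow> ghat \<gamma> = 0"
    using assms(6) unfolding essentially_supported_in_def AE_completion_iff by blast
  obtain R where R: "\<And>\<gamma>. \<gamma> \<in> K \<Longrightarrow> \<bar>\<gamma>\<bar> \<le> R"
    using compact_imp_bounded[OF K(1)] unfolding bounded_iff by auto
  \<comment> \<open>A representative of the transform that is Borel and vanishes everywhere, not only almost everywhere, off a bounded interval.\<close>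
  define G where "G \<gamma> = (if \<bar>\<gamma>\<bar> \<le> R then G0 \<gamma> else 0)" for \<gamma>
  have G_m [measurable]: "G \<in> borel_measurable borel" unfolding G_def[abs_def] by measurable
  have G: "AE \<gamma> in lborel. ghat \<gamma> = G \<gamma>"
    using G0 K(2) by eventually_elim (use R in \<open>auto simp: G_def\<close>)
  have G_R: "G \<gamma> = 0" if "R < \<bar>\<gamma>\<bar>" for \<gamma> using that by (simp add: G_def)
  have Gsq: "sq_int lborel G"
    by (rule sq_int_representative(1)[OF \<open>square_integrable ghat\<close> G_m G])
  have Gi: "integrable lborel G" by (rule integrable_bounded_support[OF Gsq G_R])
  have gG: "AE s in lborel. g s = inverse_fourier G s"
    by (rule fourier_L2_inversion[OF assms(5) Gi G])
  have Gdisj: "AE \<gamma> in lborel. G \<gamma> * G (\<gamma> + of_int j / \<omega>) = 0" if "j \<noteq> 0" for j :: int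
  proof -
    have "AE \<gamma> in lborel. ghat \<gamma> * ghat (\<gamma> + of_int j / \<omega>) = 0"
      using assms(7)[OF that] by (simp add: AE_completion_iff)
    moreover have "AE \<gamma> in lborel. ghat ((1::real) \<bullet> \<gamma> + of_int j / \<omega>) = G (1 \<bullet> \<gamma> + of_int j / \<omega>)"
      by (rule AE_inner_affine[OF G one_neq_zero])
    ultimately show ?thesis using G by eventually_elim simp
  qed
  define w where "w \<gamma> = (norm (G \<gamma>))\<^sup>2" for \<gamma>
  have w: "integrable lborel w" "\<And>\<gamma>. w \<gamma> \<ge> 0" "\<And>\<gamma>. R < \<bar>\<gamma>\<bar> \<Longrightarrow> w \<gamma> = 0"
    using sq_int_integrable[OF Gsq] G_R by (auto simp: w_def[abs_def])
  have w0: "\<not> (AE \<gamma> in lborel. w \<gamma> = 0)"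
  proof
    assume "AE \<gamma> in lborel. w \<gamma> = 0"
    with G have "AE \<gamma> in lborel. \<gamma> \<in> {-1/4..1/4} \<longrightarrow> ghat \<gamma> = 0"
      by eventually_elim (simp add: w_def)
    then show False using assms(8) unfolding AE_completion_iff by blast
  qed
  let ?I = "\<lambda>f k. LINT \<gamma>|lborel. w \<gamma> * (norm (cube_hat f (k + \<gamma> *\<^sub>R U k)))\<^sup>2"
  have "\<exists>A>0. \<exists>B>0. \<forall>f. sq_int cube_measure f \<longrightarrow> ?I f summable_on lattice \<and>
      A * cube_energy f \<le> infsum (?I f) lattice \<and> infsum (?I f) lattice \<le> B * cube_energy f"
    by (rule averaged_sampling_frame[OF w(1,2) w0]) (fact w(3) U1)+
  then obtain A where A: "A > 0 \<and> (\<exists>B>0. \<forall>f. sq_int cube_measure f \<longrightarrow> ?I f summable_on lattice \<and>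
      A * cube_energy f \<le> infsum (?I f) lattice \<and> infsum (?I f) lattice \<le> B * cube_energy f)" ..
  obtain B where B: "B > 0 \<and> (\<forall>f. sq_int cube_measure f \<longrightarrow> ?I f summable_on lattice \<and>
      A * cube_energy f \<le> infsum (?I f) lattice \<and> infsum (?I f) lattice \<le> B * cube_energy f)"
    using conjunct2[OF A] ..
  have summ: "?I f summable_on lattice" and lower: "A * cube_energy f \<le> infsum (?I f) lattice"
    and upper: "infsum (?I f) lattice \<le> B * cube_energy f" if "sq_int cube_measure f" for f
    using B that by simp_all
  \<comment> \<open>The frame sum in closed form: first over the shifts for each direction, then over the directions.\<close>
  have main: "((\<lambda>i. (norm (pairing f (gabor_ridge g i)))\<^sup>2) has_sum (1 / \<omega>) * infsum (?I f') lattice) (ridge_index \<Gamma> \<omega>)"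
    if f': "sq_int lborel f'" "AE x in lborel. f x = f' x" "\<And>x. x \<notin> cube \<Longrightarrow> f' x = 0" for f f' :: "real ^ 'd \<Rightarrow> complex"
  proof -
    have f'c: "sq_int cube_measure f'" by (rule sq_int_cube_measure[OF f'(1)])
    have [measurable]: "f' \<in> borel_measurable borel" using f'(1) by (auto simp: sq_int_def)
    let ?c = "\<lambda>i. (norm (pairing f (gabor_ridge g i)))\<^sup>2"
    have inner: "((\<lambda>j::int. ?c (m, \<omega> * of_int j, u)) has_sum (1 / \<omega>) * ?I f' (\<Phi> (u, m))) UNIV"
      if um: "(u, m) \<in> \<Gamma>" for u m
    proof -
      have u: "norm u = 1" using um assms(2) by auto
      then have "u \<noteq> 0" by auto
      define H where "H \<gamma> = cnj (G \<gamma>) * cube_hat f' ((m + \<gamma>) *\<^sub>R u)" for \<gamma>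
      have H_m: "H \<in> borel_measurable borel" unfolding H_def[abs_def] by measurable
      have "norm (cube_hat f' \<xi>) \<le> (LINT x|cube_measure. norm (f' x))" for \<xi>
        unfolding cube_hat_def by (rule order_trans[OF integral_norm_bound]) (simp add: norm_mult)
      then have Hsq: "sq_int lborel H"
        using H_m by (intro sq_int_bound[OF Gsq, of _ "LINT x|cube_measure. norm (f' x)"])
          (auto simp: H_def norm_mult mult.commute[of "norm (G _)"] intro!: mult_right_mono)
      have "AE \<gamma> in lborel. H \<gamma> * H (\<gamma> + of_int j / \<omega>) = 0" if "j \<noteq> 0" for j :: int
        using Gdisj[OF that] by eventually_elim (auto simp: H_def)
      then have "((\<lambda>j::int. (norm (LINT \<gamma>|lborel. H \<gamma> * cis (2 * pi * \<gamma> * (\<omega> * of_int j))))\<^sup>2) has_sum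
          (1 / \<omega>) * (LINT \<gamma>|lborel. (norm (H \<gamma>))\<^sup>2)) UNIV"
        using G_R by (intro parseval_periodization[OF Hsq \<omega>, of R]) (auto simp: H_def)
      moreover have "pairing f (gabor_ridge g (m, t, u)) = (LINT \<gamma>|lborel. H \<gamma> * cis (2 * pi * \<gamma> * t))" for t
        unfolding gabor_ridge_def H_def prod.case by (rule pairing_ridge[OF f' Gi gG \<open>u \<noteq> 0\<close>])
      moreover have "(LINT \<gamma>|lborel. (norm (H \<gamma>))\<^sup>2) = ?I f' (\<Phi> (u, m))"
        by (simp add: H_def w_def \<Phi>_def U_eq[OF um] norm_mult power_mult_distrib scaleR_add_left)
      ultimately show ?thesis by simp
    qed
    have outer: "((\<lambda>p. (1 / \<omega>) * ?I f' (\<Phi> p)) has_sum (1 / \<omega>) * infsum (?I f') lattice) \<Gamma>"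
      using has_sum_reindex_bij_betw[OF bij, of "?I f'"] has_sum_infsum[OF summ[OF f'c]]
      by (intro has_sum_cmult_right) blast
    let ?d = "\<lambda>(p, j::int). ?c (snd p, \<omega> * of_int j, fst p)"
    have inner': "((\<lambda>j. ?d (p, j)) has_sum (1 / \<omega>) * ?I f' (\<Phi> p)) UNIV" if "p \<in> \<Gamma>" for p
      using inner[of "fst p" "snd p"] that by simp
    have "?d summable_on (\<Gamma> \<times> UNIV)"
      by (rule summable_on_SigmaI[OF inner' has_sum_imp_summable[OF outer]]) auto
    from has_sum_SigmaI[OF inner' outer this]
    have "(?d has_sum (1 / \<omega>) * infsum (?I f') lattice) (\<Gamma> \<times> UNIV)" .
    also have "?d = (\<lambda>q. ?c ((\<lambda>((u, m), j::int). (m, \<omega> * of_int j, u)) q))"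
      by (auto simp: fun_eq_iff)
    finally show ?thesis
      by (subst (asm) has_sum_reindex_bij_betw[OF bij_ridge_index[OF \<omega>]])
  qed
  show ?thesis
    unfolding discrete_frame_for_def
  proof (rule exI[of _ "A / \<omega>"], rule exI[of _ "max (A / \<omega>) (B / \<omega>)"], intro conjI ballI)
    show "0 < A / \<omega>" "A / \<omega> \<le> max (A / \<omega>) (B / \<omega>)" using A B \<omega> by auto
    fix f :: "real ^ 'd \<Rightarrow> complex"
    assume "f \<in> L2_supported_in (cbox (\<chi> i. -1/2) (\<chi> i. 1/2))"
    then have f: "square_integrable f" and fs: "AE x in lborel. x \<notin> cube \<longrightarrow> f x = 0"
      unfolding cbox_eq_cube
      by (simp_all add: L2_supported_in_def essentially_supported_in_def AE_completion_iff)
    obtain f0 where f0: "f0 \<in> borel_measurable borel" "AE x in lborel. f x = f0 x"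
      using f borel_representative unfolding square_integrable_def by blast
    define f' where "f' x = (if x \<in> cube then f0 x else 0)" for x
    have f'_m: "f' \<in> borel_measurable borel" unfolding f'_def[abs_def] using f0(1) by measurable
    have f'z: "f' x = 0" if "x \<notin> cube" for x using that by (simp add: f'_def)
    have ff': "AE x in lborel. f x = f' x"
      using f0(2) fs by eventually_elim (auto simp: f'_def)
    note f'sq = sq_int_representative[OF f f'_m ff']
    note f'c = sq_int_cube_measure[OF f'sq(1)]
    have energy: "cube_energy f' = (l2norm f)\<^sup>2"
      unfolding f'sq(2) using f'z f'_m by (intro integral_supported_in_cube) auto
    have hs: "((\<lambda>i. (norm (pairing f (gabor_ridge g i)))\<^sup>2) has_sum (1 / \<omega>) * infsum (?I f') lattice)
        (ridge_index \<Gamma> \<omega>)"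
      by (rule main[OF f'sq(1) ff']) (rule f'z)
    show "(\<lambda>i. (norm (pairing f (gabor_ridge g i)))\<^sup>2) summable_on ridge_index \<Gamma> \<omega>"
      using hs by (rule has_sum_imp_summable)
    note eq = infsumI[OF hs]
    show "A / \<omega> * (l2norm f)\<^sup>2 \<le> (\<Sum>\<^sub>\<infinity>i\<in>ridge_index \<Gamma> \<omega>. (norm (pairing f (gabor_ridge g i)))\<^sup>2)"
      unfolding eq energy[symmetric] using lower[OF f'c] \<omega> by (simp add: divide_right_mono)
    have "(\<Sum>\<^sub>\<infinity>i\<in>ridge_index \<Gamma> \<omega>. (norm (pairing f (gabor_ridge g i)))\<^sup>2) \<le> B / \<omega> * (l2norm f)\<^sup>2"
      unfolding eq energy[symmetric] using upper[OF f'c] \<omega> by (simp add: divide_right_mono)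
    also have "\<dots> \<le> max (A / \<omega>) (B / \<omega>) * (l2norm f)\<^sup>2"
      by (intro mult_right_mono) auto
    finally show "(\<Sum>\<^sub>\<infinity>i\<in>ridge_index \<Gamma> \<omega>. (norm (pairing f (gabor_ridge g i)))\<^sup>2) \<le> max (A / \<omega>) (B / \<omega>) * (l2norm f)\<^sup>2" .
  qed
qed

end
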